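(* Enriched finitary monads on $\mathsf{Pos}$ correspond bijectively, up to monad isomorphism, to (finitary) varieties of coherent ordered algebras. Explicitly: for every variety $\mathcal{V}$ of coherent $\Sigma$-algebras ($\Sigma$ any signature) the free-algebra monad $\mathbb{T}_{\mathcal{V}}$ is finitary and enriched, and the assignment $\mathcal{V}\mapsto\mathbb{T}_{\mathcal{V}}$ induces a bijection between varieties of coherent algebras up to concrete isomorphism over $\mathsf{Pos}$ and enriched finitary monads on $\mathsf{Pos}$ up to monad isomorphism.
   Context: $\mathsf{Pos}$ is the category of posets and monotone maps. $\mathsf{Pos}_{\mathsf f}$ is a fixed representative set of all finite posets up to isomorphism; its members are called contexts. For posets $X,Y$, $\mathsf{Pos}(X,Y)$ is the poset of monotone maps $X\to Y$ ordered pointwise. $|X|$ denotes the underlying set of a poset $X$. A monad on $\mathsf{Pos}$ is finitary if its underlying functor $T$ preserves filtered colimits, and enriched if $T$ is locally monotone, i.e. $f\le g$ in $\mathsf{Pos}(X,Y)$ implies $Tf\le Tg$ in $\mathsf{Pos}(TX,TY)$. A signature $\Sigma$ is a family of sets $(\Sigma_\Gamma)_{\Gamma\in\mathsf{Pos}_{\mathsf f}}$; elements $\sigma\in\Sigma_\Gamma$ are operation symbols of arity $\Gamma$. A coherent $\Sigma$-algebra is a poset $A$ with a monotone map $\sigma_A\colon\mathsf{Pos}(\Gamma,A)\to A$ for every $\Gamma\in\mathsf{Pos}_{\mathsf f}$ and $\sigma\in\Sigma_\Gamma$. A homomorphism $h\colon A\to B$ is a monotone map with $h(\sigma_A(f))=\sigma_B(h\cdot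 f)$ for all $\sigma\in\Sigma_\Gamma$ and monotone $f\colon\Gamma\to A$. These form the category $\mathsf{Alg}_{\mathsf c}\Sigma$. For a context $\Gamma$, the set $\mathscr{T}(\Gamma)$ of terms is the least set containing $|\Gamma|$ such that for every $\sigma\in\Sigma_\Delta$ and every function $g\colon|\Delta|\to\mathscr{T}(\Gamma)$ there is a term $\sigma(g)\in\mathscr{T}(\Gamma)$ (terms are formed freely, ignoring the order of arities). Given a coherent $\Sigma$-algebra $A$ and a monotone $f\colon\Gamma\to A$, the evaluation is the partial map $f^{\#}\colon\mathscr{T}(\Gamma)\to|A|$ defined recursively: $f^{\#}(x)=f(x)$ for $x\in|\Gamma|$; for $\sigma\in\Sigma_\Delta$ and $g\colon|\Delta|\to\mathscr{T}(\Gamma)$, $f^{\#}(\sigma(g))$ is defined iff all $f^{\#}(g(i))$, $i\in|\Delta|$, are defined and $i\le j$ in $\Delta$ implies $f^{\#}(g(i))\le f^{\#}(g(j))$ in $A$, and then $f^{\#}(\sigma(g))=\sigma_A(f^{\#}\cdot g)$. An inequation in context $\Gamma\vdash s\le t$ is a pair $s,t\in\mathscr{T}(\Gamma)$; $A$ satisfies it if for every monotone $f\colon\Gamma\to A$ both $f^{\#}(s)$ and $f^{\#}(t)$ are defined and $f^{\#}(s)\le f^{\#}(t)$. A variety of coherent $\Sigma$-algebras is the full subcategory of $\mathsf{Alg}_{\mathsf c}\Sigma$ of all algebras satisfying a given set of inequations in context. The forgetful functor from such a variety $\mathcal{V}$ to $\mathsf{Pos}$ has a left adjoint; the ensuing monad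 on $\mathsf{Pos}$ is the free-algebra monad $\mathbb{T}_{\mathcal{V}}$ of $\mathcal{V}$. A concrete isomorphism over $\mathsf{Pos}$ between varieties (possibly of different signatures) is an isomorphism of categories commuting with the forgetful functors to $\mathsf{Pos}$. *)

theory Defs
  imports Main "HOL-Library.FuncSet"
begin

unbundle cardinal_syntax

section \<open>Categories, functors, adjunctions and monads\<close>

record ('o, 'a) cat =
  Ob :: "'o set"
  Ar :: "'a set"
  Dom :: "'a \<Rightarrow> 'o"
  Cod :: "'a \<Rightarrow> 'o"
  Idn :: "'o \<Rightarrow> 'a"
  Cmp :: "'a \<Rightarrow> 'a \<Rightarrow> 'a"  \<comment> \<open>\<open>Cmp C g f\<close> is \<open>g\<close> after \<open>f\<close>\<close>

definition hom :: "('o, 'a) cat \<Rightarrow> 'o \<Rightarrow> 'o \<Rightarrow> 'a set" where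
  "hom C X Y = {f \<in> Ar C. Dom C f = X \<and> Cod C f = Y}"

definition category :: "('o, 'a) cat \<Rightarrow> bool" where
  "category C \<longleftrightarrow>
     (\<forall>f\<in>Ar C. Dom C f \<in> Ob C \<and> Cod C f \<in> Ob C) \<and>
     (\<forall>X\<in>Ob C. Idn C X \<in> hom C X X) \<and>
     (\<forall>f\<in>Ar C. \<forall>g\<in>Ar C. Cod C f = Dom C g \<longrightarrow> Cmp C g f \<in> hom C (Dom C f) (Cod C g)) \<and>
     (\<forall>f\<in>Ar C. Cmp C f (Idn C (Dom C f)) = f \<and> Cmp C (Idn C (Cod C f)) f = f) \<and>
     (\<forall>f\<in>Ar C. \<forall>g\<in>Ar C. \<forall>h\<in>Ar C. Cod C f = Dom C g \<and> Cod C g = Dom C h \<longrightarrow>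
        Cmp C h (Cmp C g f) = Cmp C (Cmp C h g) f)"

definition full_subcat :: "('o, 'a) cat \<Rightarrow> 'o set \<Rightarrow> ('o, 'a) cat" where
  "full_subcat C S =
     C\<lparr>Ob := Ob C \<inter> S, Ar := {f \<in> Ar C. Dom C f \<in> S \<and> Cod C f \<in> S}\<rparr>"

definition isomorphic :: "('o, 'a) cat \<Rightarrow> 'o \<Rightarrow> 'o \<Rightarrow> bool" where
  "isomorphic C X Y \<longleftrightarrow>
     (\<exists>f\<in>hom C X Y. \<exists>g\<in>hom C Y X. Cmp C g f = Idn C X \<and> Cmp C f g = Idn C Y)"

record ('o, 'a, 'p, 'b) func =
  on_ob :: "'o \<Rightarrow> 'p"
  on_ar :: "'a \<Rightarrow> 'b"

definition is_functor ::
  "('o, 'a) cat \<Rightarrow> ('p, 'b) cat \<Rightarrow> ('o, 'a, 'p, 'b) func \<Rightarrow> bool" where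
  "is_functor C D F \<longleftrightarrow>
     (\<forall>X\<in>Ob C. on_ob F X \<in> Ob D) \<and>
     (\<forall>f\<in>Ar C. on_ar F f \<in> hom D (on_ob F (Dom C f)) (on_ob F (Cod C f))) \<and>
     (\<forall>X\<in>Ob C. on_ar F (Idn C X) = Idn D (on_ob F X)) \<and>
     (\<forall>f\<in>Ar C. \<forall>g\<in>Ar C. Cod C f = Dom C g \<longrightarrow>
        on_ar F (Cmp C g f) = Cmp D (on_ar F g) (on_ar F f))"

definition id_func :: "('o, 'a, 'o, 'a) func" where
  "id_func = \<lparr>on_ob = (\<lambda>X. X), on_ar = (\<lambda>f. f)\<rparr>"

definition comp_func ::
  "('p, 'b, 'q, 'c) func \<Rightarrow> ('o, 'a, 'p, 'b) func \<Rightarrow> ('o, 'a, 'q, 'c) func" where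
  "comp_func G F = \<lparr>on_ob = on_ob G \<circ> on_ob F, on_ar = on_ar G \<circ> on_ar F\<rparr>"

text \<open>Functors and transformations are total functions whose values off the domain category
  are irrelevant, so they are compared on the domain category only.\<close>

definition func_eq_on ::
  "('o, 'a) cat \<Rightarrow> ('o, 'a, 'p, 'b) func \<Rightarrow> ('o, 'a, 'p, 'b) func \<Rightarrow> bool" where
  "func_eq_on C F G \<longleftrightarrow>
     (\<forall>X\<in>Ob C. on_ob F X = on_ob G X) \<and> (\<forall>f\<in>Ar C. on_ar F f = on_ar G f)"

definition nat_trans ::
  "('o, 'a) cat \<Rightarrow> ('p, 'b) cat \<Rightarrow> ('o, 'a, 'p, 'b) func \<Rightarrow> ('o, 'a, 'p, 'b) func
     \<Rightarrow> ('o \<Rightarrow> 'b) \<Rightarrow> bool" where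
  "nat_trans C D F G \<alpha> \<longleftrightarrow>
     (\<forall>X\<in>Ob C. \<alpha> X \<in> hom D (on_ob F X) (on_ob G X)) \<and>
     (\<forall>f\<in>Ar C. Cmp D (\<alpha> (Cod C f)) (on_ar F f) = Cmp D (on_ar G f) (\<alpha> (Dom C f)))"

definition adjunction ::
  "('o, 'a) cat \<Rightarrow> ('p, 'b) cat \<Rightarrow> ('o, 'a, 'p, 'b) func \<Rightarrow> ('p, 'b, 'o, 'a) func
     \<Rightarrow> ('o \<Rightarrow> 'a) \<Rightarrow> ('p \<Rightarrow> 'b) \<Rightarrow> bool" where
  "adjunction C D F U \<eta> \<epsilon> \<longleftrightarrow>
     is_functor C D F \<and> is_functor D C U \<and>
     nat_trans C C id_func (comp_func U F) \<eta> \<and>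
     nat_trans D D (comp_func F U) id_func \<epsilon> \<and>
     (\<forall>X\<in>Ob C. Cmp D (\<epsilon> (on_ob F X)) (on_ar F (\<eta> X)) = Idn D (on_ob F X)) \<and>
     (\<forall>A\<in>Ob D. Cmp C (on_ar U (\<epsilon> A)) (\<eta> (on_ob U A)) = Idn C (on_ob U A))"

record ('o, 'a) monad =
  mfun :: "('o, 'a, 'o, 'a) func"
  unit :: "'o \<Rightarrow> 'a"
  mult :: "'o \<Rightarrow> 'a"

definition is_monad :: "('o, 'a) cat \<Rightarrow> ('o, 'a) monad \<Rightarrow> bool" where
  "is_monad C M \<longleftrightarrow>
     is_functor C C (mfun M) \<and>
     nat_trans C C id_func (mfun M) (unit M) \<and>
     nat_trans C C (comp_func (mfun M) (mfun M)) (mfun M) (mult M) \<and>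
     (\<forall>X\<in>Ob C.
        Cmp C (mult M X) (unit M (on_ob (mfun M) X)) = Idn C (on_ob (mfun M) X) \<and>
        Cmp C (mult M X) (on_ar (mfun M) (unit M X)) = Idn C (on_ob (mfun M) X) \<and>
        Cmp C (mult M X) (mult M (on_ob (mfun M) X)) =
          Cmp C (mult M X) (on_ar (mfun M) (mult M X)))"

definition monad_of_adjunction ::
  "('o, 'a, 'p, 'b) func \<Rightarrow> ('p, 'b, 'o, 'a) func \<Rightarrow> ('o \<Rightarrow> 'a) \<Rightarrow> ('p \<Rightarrow> 'b)
     \<Rightarrow> ('o, 'a) monad" where
  "monad_of_adjunction F U \<eta> \<epsilon> =
     \<lparr>mfun = comp_func U F, unit = \<eta>, mult = (\<lambda>X. on_ar U (\<epsilon> (on_ob F X)))\<rparr>"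

definition monad_morphism ::
  "('o, 'a) cat \<Rightarrow> ('o, 'a) monad \<Rightarrow> ('o, 'a) monad \<Rightarrow> ('o \<Rightarrow> 'a) \<Rightarrow> bool" where
  "monad_morphism C M N \<alpha> \<longleftrightarrow>
     nat_trans C C (mfun M) (mfun N) \<alpha> \<and>
     (\<forall>X\<in>Ob C.
        Cmp C (\<alpha> X) (unit M X) = unit N X \<and>
        Cmp C (\<alpha> X) (mult M X) =
          Cmp C (mult N X) (Cmp C (on_ar (mfun N) (\<alpha> X)) (\<alpha> (on_ob (mfun M) X))))"

definition monad_isomorphic ::
  "('o, 'a) cat \<Rightarrow> ('o, 'a) monad \<Rightarrow> ('o, 'a) monad \<Rightarrow> bool" where
  "monad_isomorphic C M N \<longleftrightarrow>
     (\<exists>\<alpha> \<beta>. monad_morphism C M N \<alpha> \<and> monad_morphism C N M \<beta> \<and>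
        (\<forall>X\<in>Ob C. Cmp C (\<beta> X) (\<alpha> X) = Idn C (on_ob (mfun M) X) \<and>
                   Cmp C (\<alpha> X) (\<beta> X) = Idn C (on_ob (mfun N) X)))"


section \<open>Smallness\<close>

text \<open>The type \<open>'u\<close> plays the role of the universe of sets: a set is small if it has fewer
  elements than \<open>'u\<close>, whose cardinality is assumed uncountable and regular, so that small sets
  are closed under images and small unions. Closure under power sets is not required. If the
  cardinality of \<open>'u\<close> is inaccessible, small sets are, up to bijection, the members of a
  Grothendieck universe; but types of uncountable regular cardinality, such as a successor
  cardinal, also exist in HOL.\<close>

definition small :: "'u set \<Rightarrow> bool" where
  "small A \<longleftrightarrow> |A| <o |UNIV :: 'u set|"

definition universe :: "'u itself \<Rightarrow> bool" where
  "universe _ \<longleftrightarrow> natLeq <o |UNIV :: 'u set| \<and> regularCard |UNIV :: 'u set|"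


section \<open>Filtered colimits\<close>

definition filtered :: "('i, 'j) cat \<Rightarrow> bool" where
  "filtered I \<longleftrightarrow>
     category I \<and> Ob I \<noteq> {} \<and>
     (\<forall>i\<in>Ob I. \<forall>j\<in>Ob I. \<exists>k\<in>Ob I. hom I i k \<noteq> {} \<and> hom I j k \<noteq> {}) \<and>
     (\<forall>i\<in>Ob I. \<forall>j\<in>Ob I. \<forall>u\<in>hom I i j. \<forall>v\<in>hom I i j.
        \<exists>k\<in>Ob I. \<exists>w\<in>hom I j k. Cmp I w u = Cmp I w v)"

definition cocone ::
  "('i, 'j) cat \<Rightarrow> ('o, 'a) cat \<Rightarrow> ('i, 'j, 'o, 'a) func \<Rightarrow> 'o \<Rightarrow> ('i \<Rightarrow> 'a) \<Rightarrow> bool" where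
  "cocone I C D X c \<longleftrightarrow>
     X \<in> Ob C \<and> (\<forall>i\<in>Ob I. c i \<in> hom C (on_ob D i) X) \<and>
     (\<forall>u\<in>Ar I. Cmp C (c (Cod I u)) (on_ar D u) = c (Dom I u))"

definition colimit ::
  "('i, 'j) cat \<Rightarrow> ('o, 'a) cat \<Rightarrow> ('i, 'j, 'o, 'a) func \<Rightarrow> 'o \<Rightarrow> ('i \<Rightarrow> 'a) \<Rightarrow> bool" where
  "colimit I C D X c \<longleftrightarrow>
     cocone I C D X c \<and>
     (\<forall>Y d. cocone I C D Y d \<longrightarrow>
        (\<exists>!h. h \<in> hom C X Y \<and> (\<forall>i\<in>Ob I. Cmp C h (c i) = d i)))"

text \<open>The index categories range over all small filtered categories: up to isomorphism, the
  objects and the arrows of such a category may be taken to be elements of \<open>'u\<close>.\<close>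

definition preserves_filtered_colimits ::
  "'u itself \<Rightarrow> ('o, 'a) cat \<Rightarrow> ('p, 'b) cat \<Rightarrow> ('o, 'a, 'p, 'b) func \<Rightarrow> bool" where
  "preserves_filtered_colimits _ C C' T \<longleftrightarrow>
     (\<forall>(I :: ('u, 'u) cat) D X c.
        filtered I \<and> small (Ob I) \<and> small (Ar I) \<and> is_functor I C D \<and> colimit I C D X c \<longrightarrow>
        colimit I C' (comp_func T D) (on_ob T X) (on_ar T \<circ> c))"


section \<open>Posets\<close>

text \<open>A poset is a relation \<open>X\<close> with \<open>Partial_order X\<close>; its underlying set is \<open>Field X\<close>.
  Maps are extensional (\<open>undefined\<close> off their domain), so that equality of HOL functions is
  equality of maps.\<close>

definition monotone_maps :: "'u rel \<Rightarrow> 'u rel \<Rightarrow> ('u \<Rightarrow> 'u) set" where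
  "monotone_maps X Y =
     {f \<in> Field X \<rightarrow>\<^sub>E Field Y. monotone_on (Field X) (\<lambda>x y. (x, y) \<in> X) (\<lambda>x y. (x, y) \<in> Y) f}"

definition pointwise_le :: "'u rel \<Rightarrow> 'u rel \<Rightarrow> ('u \<Rightarrow> 'u) \<Rightarrow> ('u \<Rightarrow> 'u) \<Rightarrow> bool" where
  "pointwise_le X Y f g \<longleftrightarrow> (\<forall>x\<in>Field X. (f x, g x) \<in> Y)"

datatype ('o, 'u) arrow = Arrow (src: 'o) (tgt: 'o) (fn: "'u \<Rightarrow> 'u")

type_synonym 'u pos_arrow = "('u rel, 'u) arrow"

definition Pos :: "('u rel, 'u pos_arrow) cat" where
  "Pos =
     \<lparr>Ob = {X. Partial_order X \<and> small (Field X)},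
      Ar = {f. Partial_order (src f) \<and> small (Field (src f)) \<and>
               Partial_order (tgt f) \<and> small (Field (tgt f)) \<and>
               fn f \<in> monotone_maps (src f) (tgt f)},
      Dom = src,
      Cod = tgt,
      Idn = (\<lambda>X. Arrow X X (\<lambda>x\<in>Field X. x)),
      Cmp = (\<lambda>g f. Arrow (src f) (tgt g) (compose (Field (src f)) (fn g) (fn f)))\<rparr>"

definition contexts :: "'u rel set \<Rightarrow> bool" where
  "contexts P \<longleftrightarrow>
     (\<forall>\<Gamma>\<in>P. \<Gamma> \<in> Ob Pos \<and> finite (Field \<Gamma>)) \<and>
     (\<forall>X\<in>Ob Pos. finite (Field X) \<longrightarrow> (\<exists>!\<Gamma>. \<Gamma> \<in> P \<and> isomorphic Pos X \<Gamma>))"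

type_synonym 'u pos_monad = "('u rel, 'u pos_arrow) monad"

definition finitary :: "'u pos_monad \<Rightarrow> bool" where
  "finitary M \<longleftrightarrow> preserves_filtered_colimits TYPE('u) Pos Pos (mfun M)"

definition enriched :: "'u pos_monad \<Rightarrow> bool" where
  "enriched M \<longleftrightarrow>
     (\<forall>X\<in>Ob Pos. \<forall>Y\<in>Ob Pos. \<forall>f\<in>hom Pos X Y. \<forall>g\<in>hom Pos X Y.
        pointwise_le X Y (fn f) (fn g) \<longrightarrow>
        pointwise_le (on_ob (mfun M) X) (on_ob (mfun M) Y)
          (fn (on_ar (mfun M) f)) (fn (on_ar (mfun M) g)))"

definition enriched_finitary_monads :: "'u pos_monad set" where
  "enriched_finitary_monads = {M. is_monad Pos M \<and> finitary M \<and> enriched M}"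

definition monad_iso_rel :: "'u pos_monad rel" where
  "monad_iso_rel =
     {(M, N). M \<in> enriched_finitary_monads \<and> N \<in> enriched_finitary_monads \<and>
              monad_isomorphic Pos M N}"


section \<open>Coherent algebras\<close>

text \<open>Throughout, \<open>P\<close> is the set of contexts. The values \<open>S \<Gamma>\<close> of a signature \<open>S\<close> at \<open>\<Gamma> \<notin> P\<close>
  are never used.\<close>

type_synonym 'u signature = "'u rel \<Rightarrow> 'u set"

definition is_signature :: "'u rel set \<Rightarrow> 'u signature \<Rightarrow> bool" where
  "is_signature P S \<longleftrightarrow> (\<forall>\<Gamma>\<in>P. small (S \<Gamma>))"

record 'u algebra =
  poset :: "'u rel"
  oper :: "'u rel \<Rightarrow> 'u \<Rightarrow> ('u \<Rightarrow> 'u) \<Rightarrow> 'u"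

text \<open>The last conjunct makes the operations extensional, so that equality of records is
  equality of algebras; isomorphism of categories refers to equality of objects.\<close>

definition coherent_algebra :: "'u rel set \<Rightarrow> 'u signature \<Rightarrow> 'u algebra \<Rightarrow> bool" where
  "coherent_algebra P S A \<longleftrightarrow>
     poset A \<in> Ob Pos \<and>
     (\<forall>\<Gamma>\<in>P. \<forall>\<sigma>\<in>S \<Gamma>.
        (\<forall>f\<in>monotone_maps \<Gamma> (poset A). oper A \<Gamma> \<sigma> f \<in> Field (poset A)) \<and>
        (\<forall>f\<in>monotone_maps \<Gamma> (poset A). \<forall>g\<in>monotone_maps \<Gamma> (poset A).
           pointwise_le \<Gamma> (poset A) f g \<longrightarrow> (oper A \<Gamma> \<sigma> f, oper A \<Gamma> \<sigma> g) \<in> poset A)) \<and>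
     (\<forall>\<Gamma> \<sigma> f. \<not> (\<Gamma> \<in> P \<and> \<sigma> \<in> S \<Gamma> \<and> f \<in> monotone_maps \<Gamma> (poset A)) \<longrightarrow>
        oper A \<Gamma> \<sigma> f = undefined)"

definition homomorphisms ::
  "'u rel set \<Rightarrow> 'u signature \<Rightarrow> 'u algebra \<Rightarrow> 'u algebra \<Rightarrow> ('u \<Rightarrow> 'u) set" where
  "homomorphisms P S A B =
     {h \<in> monotone_maps (poset A) (poset B).
        \<forall>\<Gamma>\<in>P. \<forall>\<sigma>\<in>S \<Gamma>. \<forall>f\<in>monotone_maps \<Gamma> (poset A).
          h (oper A \<Gamma> \<sigma> f) = oper B \<Gamma> \<sigma> (compose (Field \<Gamma>) h f)}"

type_synonym 'u alg_arrow = "('u algebra, 'u) arrow"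

definition Alg :: "'u rel set \<Rightarrow> 'u signature \<Rightarrow> ('u algebra, 'u alg_arrow) cat" where
  "Alg P S =
     \<lparr>Ob = {A. coherent_algebra P S A},
      Ar = {h. coherent_algebra P S (src h) \<and> coherent_algebra P S (tgt h) \<and>
               fn h \<in> homomorphisms P S (src h) (tgt h)},
      Dom = src,
      Cod = tgt,
      Idn = (\<lambda>A. Arrow A A (\<lambda>x\<in>Field (poset A). x)),
      Cmp = (\<lambda>g f. Arrow (src f) (tgt g) (compose (Field (poset (src f))) (fn g) (fn f)))\<rparr>"

definition forget :: "('u algebra, 'u alg_arrow, 'u rel, 'u pos_arrow) func" where
  "forget = \<lparr>on_ob = poset, on_ar = (\<lambda>h. Arrow (poset (src h)) (poset (tgt h)) (fn h))\<rparr>"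


section \<open>Terms, inequations and varieties\<close>

text \<open>\<open>Op \<Delta> \<sigma> g\<close> is the formal application of the operation symbol \<open>\<sigma>\<close> of arity \<open>\<Delta>\<close> to a
  family \<open>g\<close> indexed by \<open>Field \<Delta>\<close>.\<close>

datatype 'u trm = Var 'u | Op "'u rel" 'u "'u \<Rightarrow> 'u trm"

inductive_set terms :: "'u rel set \<Rightarrow> 'u signature \<Rightarrow> 'u rel \<Rightarrow> 'u trm set"
  for P :: "'u rel set" and S :: "'u signature" and \<Gamma> :: "'u rel" where
  var: "x \<in> Field \<Gamma> \<Longrightarrow> Var x \<in> terms P S \<Gamma>"
| op: "\<Delta> \<in> P \<Longrightarrow> \<sigma> \<in> S \<Delta> \<Longrightarrow> (\<forall>i\<in>Field \<Delta>. g i \<in> terms P S \<Gamma>) \<Longrightarrow> g \<in> extensional (Field \<Delta>)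
       \<Longrightarrow> Op \<Delta> \<sigma> g \<in> terms P S \<Gamma>"

primrec evaluate :: "'u algebra \<Rightarrow> ('u \<Rightarrow> 'u) \<Rightarrow> 'u trm \<Rightarrow> 'u option" where
  "evaluate A f (Var x) = Some (f x)"
| "evaluate A f (Op \<Delta> \<sigma> g) =
     (if (\<forall>i\<in>Field \<Delta>. evaluate A f (g i) \<noteq> None) \<and>
         (\<forall>i j. (i, j) \<in> \<Delta> \<longrightarrow> (the (evaluate A f (g i)), the (evaluate A f (g j))) \<in> poset A)
      then Some (oper A \<Delta> \<sigma> (\<lambda>i\<in>Field \<Delta>. the (evaluate A f (g i))))
      else None)"

text \<open>The triple \<open>(\<Gamma>, s, t)\<close> stands for the inequation \<open>\<Gamma> \<turnstile> s \<le> t\<close>.\<close>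

type_synonym 'u inequation = "'u rel \<times> 'u trm \<times> 'u trm"

definition inequations :: "'u rel set \<Rightarrow> 'u signature \<Rightarrow> 'u inequation set" where
  "inequations P S = {(\<Gamma>, s, t). \<Gamma> \<in> P \<and> s \<in> terms P S \<Gamma> \<and> t \<in> terms P S \<Gamma>}"

fun satisfies :: "'u algebra \<Rightarrow> 'u inequation \<Rightarrow> bool" where
  "satisfies A (\<Gamma>, s, t) \<longleftrightarrow>
     (\<forall>f\<in>monotone_maps \<Gamma> (poset A).
        \<exists>a b. evaluate A f s = Some a \<and> evaluate A f t = Some b \<and> (a, b) \<in> poset A)"

definition variety ::
  "'u rel set \<Rightarrow> 'u signature \<Rightarrow> 'u inequation set \<Rightarrow> ('u algebra, 'u alg_arrow) cat" where
  "variety P S E = full_subcat (Alg P S) {A. \<forall>e\<in>E. satisfies A e}"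

definition varieties :: "'u rel set \<Rightarrow> ('u algebra, 'u alg_arrow) cat set" where
  "varieties P = {variety P S E | S E. is_signature P S \<and> E \<subseteq> inequations P S}"

definition concretely_isomorphic ::
  "('u algebra, 'u alg_arrow) cat \<Rightarrow> ('u algebra, 'u alg_arrow) cat \<Rightarrow> bool" where
  "concretely_isomorphic V W \<longleftrightarrow>
     (\<exists>H K. is_functor V W H \<and> is_functor W V K \<and>
        func_eq_on V (comp_func K H) id_func \<and> func_eq_on W (comp_func H K) id_func \<and>
        func_eq_on V (comp_func forget H) forget)"

definition concrete_iso_rel ::
  "'u rel set \<Rightarrow> ('u algebra, 'u alg_arrow) cat rel" where
  "concrete_iso_rel P =
     {(V, W). V \<in> varieties P \<and> W \<in> varieties P \<and> concretely_isomorphic V W}"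

definition free_algebra_monad ::
  "('u algebra, 'u alg_arrow) cat \<Rightarrow> 'u pos_monad \<Rightarrow> bool" where
  "free_algebra_monad V M \<longleftrightarrow>
     (\<exists>F \<eta> \<epsilon>. adjunction Pos V F forget \<eta> \<epsilon> \<and> M = monad_of_adjunction F forget \<eta> \<epsilon>)"


section \<open>The two isomorphism relations are equivalences\<close>

lemma category_Pos: "category (Pos :: ('u rel, 'u pos_arrow) cat)"
proof -
  have 1: "compose (Field X) g f \<in> monotone_maps X Z"
    if "f \<in> monotone_maps X Y" "g \<in> monotone_maps Y Z" for f g and X Y Z :: "'u rel"
    using that by (auto simp: monotone_maps_def monotone_on_def compose_def PiE_iff
        extensional_def FieldI1 FieldI2)
  have 2: "(\<lambda>x\<in>Field X. x) \<in> monotone_maps X X" for X :: "'u rel"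
    by (auto simp: monotone_maps_def monotone_on_def)
  have 3: "compose (Field X) f (\<lambda>x\<in>Field X. x) = f" "compose (Field X) (\<lambda>x\<in>Field Y. x) f = f"
    if "f \<in> monotone_maps X Y" for f and X Y :: "'u rel"
    using that by (auto simp: monotone_maps_def compose_def PiE_iff extensional_def fun_eq_iff)
  have 4: "compose (Field X) h (compose (Field X) g f) = compose (Field X) (compose (Field Y) h g) f"
    if "f \<in> monotone_maps X Y" for f :: "'u \<Rightarrow> 'u" and g h :: "'u \<Rightarrow> 'u" and X Y :: "'u rel"
    using that by (auto simp: monotone_maps_def compose_def PiE_iff extensional_def fun_eq_iff)
  show ?thesis
    unfolding category_def Pos_def hom_def
    by (auto intro: 1 2 simp: 3 4 intro!: arrow.expand)
qed

lemma equiv_concrete_iso_rel: "equiv (varieties P) (concrete_iso_rel P)"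
proof (rule equivI)
  show "concrete_iso_rel P \<subseteq> varieties P \<times> varieties P"
    by (auto simp: concrete_iso_rel_def)
  show "refl_on (varieties P) (concrete_iso_rel P)"
  proof (rule refl_onI)
    fix V assume "V \<in> varieties P"
    moreover have "concretely_isomorphic V V"
      unfolding concretely_isomorphic_def
      by (rule exI[of _ id_func], rule exI[of _ id_func])
        (use \<open>V \<in> varieties P\<close> in \<open>auto simp: is_functor_def id_func_def func_eq_on_def comp_func_def
          hom_def varieties_def variety_def full_subcat_def Alg_def\<close>)
    ultimately show "(V, V) \<in> concrete_iso_rel P" by (simp add: concrete_iso_rel_def)
  qed
  have comp: "is_functor V X (comp_func G H)"
    if "is_functor V W H" "is_functor W X G" for V W X :: "('a algebra, 'a alg_arrow) cat" and G H
    using that unfolding is_functor_def comp_func_def hom_def by auto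
  show "sym (concrete_iso_rel P)"
  proof (rule symI)
    fix V W assume "(V, W) \<in> concrete_iso_rel P"
    then obtain H K where *: "V \<in> varieties P" "W \<in> varieties P" "is_functor V W H" "is_functor W V K"
      "func_eq_on V (comp_func K H) id_func" "func_eq_on W (comp_func H K) id_func"
      "func_eq_on V (comp_func forget H) forget"
      by (auto simp: concrete_iso_rel_def concretely_isomorphic_def)
    have "func_eq_on W (comp_func forget K) forget"
      using * by (simp add: func_eq_on_def comp_func_def id_func_def is_functor_def hom_def) metis
    with * show "(W, V) \<in> concrete_iso_rel P"
      unfolding concrete_iso_rel_def concretely_isomorphic_def by blast
  qed
  show "trans (concrete_iso_rel P)"
  proof (rule transI)
    fix V W X assume "(V, W) \<in> concrete_iso_rel P" "(W, X) \<in> concrete_iso_rel P"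
    then obtain H K H' K' where *: "V \<in> varieties P" "X \<in> varieties P"
      "is_functor V W H" "is_functor W V K"
      "func_eq_on V (comp_func K H) id_func" "func_eq_on W (comp_func H K) id_func"
      "func_eq_on V (comp_func forget H) forget"
      "is_functor W X H'" "is_functor X W K'"
      "func_eq_on W (comp_func K' H') id_func" "func_eq_on X (comp_func H' K') id_func"
      "func_eq_on W (comp_func forget H') forget"
      by (auto simp: concrete_iso_rel_def concretely_isomorphic_def)
    have "func_eq_on V (comp_func (comp_func K K') (comp_func H' H)) id_func"
      "func_eq_on X (comp_func (comp_func H' H) (comp_func K K')) id_func"
      "func_eq_on V (comp_func forget (comp_func H' H)) forget"
      using * by (simp_all add: func_eq_on_def comp_func_def id_func_def is_functor_def hom_def)
    with * comp show "(V, X) \<in> concrete_iso_rel P"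
      unfolding concrete_iso_rel_def concretely_isomorphic_def by blast
  qed
qed


lemma equiv_monad_iso_rel: "equiv enriched_finitary_monads (monad_iso_rel :: 'u pos_monad rel)"
proof (rule equivI)
  let ?C = "Pos :: ('u rel, 'u pos_arrow) cat"
  have comp: "Cmp ?C g f \<in> hom ?C X Z" if "f \<in> hom ?C X Y" "g \<in> hom ?C Y Z" for f g X Y Z
    using category_Pos that unfolding category_def hom_def by auto
  have assoc: "Cmp ?C h (Cmp ?C g f) = Cmp ?C (Cmp ?C h g) f"
    if "f \<in> hom ?C X Y" "g \<in> hom ?C Y Z" "h \<in> hom ?C Z W" for f g h X Y Z W
    using category_Pos that unfolding category_def hom_def by auto
  have idl: "Cmp ?C (Idn ?C Y) f = f" and idr: "Cmp ?C f (Idn ?C X) = f"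
    if "f \<in> hom ?C X Y" for f X Y
    using category_Pos that unfolding category_def hom_def by auto
  have ido: "Idn ?C X \<in> hom ?C X X" if "X \<in> Ob ?C" for X
    using category_Pos that unfolding category_def by auto
  have ends: "f \<in> hom ?C (Dom ?C f) (Cod ?C f) \<and> Dom ?C f \<in> Ob ?C \<and> Cod ?C f \<in> Ob ?C"
    if "f \<in> Ar ?C" for f
    using category_Pos that unfolding category_def hom_def by auto
  have refl: "monad_morphism ?C M M (\<lambda>X. Idn ?C (on_ob (mfun M) X))" if M: "is_monad ?C M" for M
  proof -
    have T: "on_ob (mfun M) X \<in> Ob ?C" if "X \<in> Ob ?C" for X
      using M that by (auto simp: is_monad_def is_functor_def)
    have Tf: "on_ar (mfun M) f \<in> hom ?C (on_ob (mfun M) (Dom ?C f)) (on_ob (mfun M) (Cod ?C f))"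
      if "f \<in> Ar ?C" for f
      using M that by (auto simp: is_monad_def is_functor_def)
    have Ti: "on_ar (mfun M) (Idn ?C X) = Idn ?C (on_ob (mfun M) X)" if "X \<in> Ob ?C" for X
      using M that by (auto simp: is_monad_def is_functor_def)
    have u: "unit M X \<in> hom ?C X (on_ob (mfun M) X)" if "X \<in> Ob ?C" for X
      using M that by (auto simp: is_monad_def nat_trans_def id_func_def)
    have m: "mult M X \<in> hom ?C (on_ob (mfun M) (on_ob (mfun M) X)) (on_ob (mfun M) X)"
      if "X \<in> Ob ?C" for X
      using M that by (auto simp: is_monad_def nat_trans_def comp_func_def)
    show ?thesis
      unfolding monad_morphism_def nat_trans_def
      using T Tf Ti u m ido by (auto simp: idl[OF Tf] idr[OF Tf] idl[OF u] idl[OF m] idr[OF m] idl[OF ido])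
  qed
  have trans: "monad_morphism ?C M Q (\<lambda>X. Cmp ?C (\<beta> X) (\<alpha> X))"
    if M: "is_monad ?C M" and N: "is_monad ?C N" and Q: "is_monad ?C Q"
      and a: "monad_morphism ?C M N \<alpha>" and b: "monad_morphism ?C N Q \<beta>" for M N Q \<alpha> \<beta>
  proof -
    have T: "on_ob (mfun K) X \<in> Ob ?C" if "is_monad ?C K" "X \<in> Ob ?C" for K X
      using that by (auto simp: is_monad_def is_functor_def)
    have Tf: "on_ar (mfun K) f \<in> hom ?C (on_ob (mfun K) X) (on_ob (mfun K) Y)"
      if "is_monad ?C K" "f \<in> hom ?C X Y" for K f X Y
      using that by (auto simp: is_monad_def is_functor_def hom_def)
    have Tc: "on_ar (mfun K) (Cmp ?C g f) = Cmp ?C (on_ar (mfun K) g) (on_ar (mfun K) f)"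
      if "is_monad ?C K" "f \<in> hom ?C X Y" "g \<in> hom ?C Y Z" for K f g X Y Z
      using that by (auto simp: is_monad_def is_functor_def hom_def)
    have u: "unit K X \<in> hom ?C X (on_ob (mfun K) X)" if "is_monad ?C K" "X \<in> Ob ?C" for K X
      using that by (auto simp: is_monad_def nat_trans_def id_func_def)
    have m: "mult K X \<in> hom ?C (on_ob (mfun K) (on_ob (mfun K) X)) (on_ob (mfun K) X)"
      if "is_monad ?C K" "X \<in> Ob ?C" for K X
      using that by (auto simp: is_monad_def nat_trans_def comp_func_def)
    have A: "\<alpha> X \<in> hom ?C (on_ob (mfun M) X) (on_ob (mfun N) X)" if "X \<in> Ob ?C" for X
      using a that by (auto simp: monad_morphism_def nat_trans_def)
    have B: "\<beta> X \<in> hom ?C (on_ob (mfun N) X) (on_ob (mfun Q) X)" if "X \<in> Ob ?C" for X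
      using b that by (auto simp: monad_morphism_def nat_trans_def)
    have An: "Cmp ?C (\<alpha> Y) (on_ar (mfun M) f) = Cmp ?C (on_ar (mfun N) f) (\<alpha> X)"
      if "f \<in> hom ?C X Y" for f X Y
      using a that by (auto simp: monad_morphism_def nat_trans_def hom_def)
    have Bn: "Cmp ?C (\<beta> Y) (on_ar (mfun N) f) = Cmp ?C (on_ar (mfun Q) f) (\<beta> X)"
      if "f \<in> hom ?C X Y" for f X Y
      using b that by (auto simp: monad_morphism_def nat_trans_def hom_def)
    show ?thesis
      unfolding monad_morphism_def nat_trans_def
    proof (intro conjI ballI)
      fix X assume X: "X \<in> Ob ?C"
      show "Cmp ?C (\<beta> X) (\<alpha> X) \<in> hom ?C (on_ob (mfun M) X) (on_ob (mfun Q) X)"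
        using comp A B X by blast
      show "Cmp ?C (Cmp ?C (\<beta> X) (\<alpha> X)) (unit M X) = unit Q X"
        using a b X assoc[OF u[OF M X] A[OF X] B[OF X]] by (simp add: monad_morphism_def)
      let ?M = "on_ob (mfun M)" and ?N = "on_ob (mfun N)" and ?Q = "on_ob (mfun Q)"
      let ?n = "on_ar (mfun N)" and ?q = "on_ar (mfun Q)"
      note TX = T[OF M X] T[OF N X] T[OF Q X]
      note h = A[OF X] B[OF X] A[OF TX(1)] B[OF TX(1)] A[OF TX(2)] B[OF TX(2)]
        m[OF M X] m[OF N X] m[OF Q X] Tf[OF N A[OF X]] Tf[OF Q A[OF X]] Tf[OF Q B[OF X]]
      have "Cmp ?C (Cmp ?C (\<beta> X) (\<alpha> X)) (mult M X) = Cmp ?C (\<beta> X) (Cmp ?C (\<alpha> X) (mult M X))"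
        using assoc[OF h(7) h(1) h(2)] by simp
      also have "\<dots> = Cmp ?C (\<beta> X) (Cmp ?C (mult N X) (Cmp ?C (?n (\<alpha> X)) (\<alpha> (?M X))))"
        using a X by (simp add: monad_morphism_def)
      also have "\<dots> = Cmp ?C (Cmp ?C (\<beta> X) (mult N X)) (Cmp ?C (?n (\<alpha> X)) (\<alpha> (?M X)))"
        by (rule assoc[OF comp[OF h(3) h(10)] h(8) h(2)])
      also have "\<dots> = Cmp ?C (Cmp ?C (mult Q X) (Cmp ?C (?q (\<beta> X)) (\<beta> (?N X)))) (Cmp ?C (?n (\<alpha> X)) (\<alpha> (?M X)))"
        using b X by (simp add: monad_morphism_def)
      also have "\<dots> = Cmp ?C (mult Q X) (Cmp ?C (Cmp ?C (?q (\<beta> X)) (\<beta> (?N X))) (Cmp ?C (?n (\<alpha> X)) (\<alpha> (?M X))))"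
        by (rule assoc[OF comp[OF h(3) h(10)] comp[OF h(6) h(12)] h(9), symmetric])
      also have "Cmp ?C (Cmp ?C (?q (\<beta> X)) (\<beta> (?N X))) (Cmp ?C (?n (\<alpha> X)) (\<alpha> (?M X))) =
          Cmp ?C (?q (\<beta> X)) (Cmp ?C (Cmp ?C (\<beta> (?N X)) (?n (\<alpha> X))) (\<alpha> (?M X)))"
        using assoc[OF comp[OF h(3) h(10)] h(6) h(12)] assoc[OF h(3) h(10) h(6)] by simp
      also have "Cmp ?C (\<beta> (?N X)) (?n (\<alpha> X)) = Cmp ?C (?q (\<alpha> X)) (\<beta> (?M X))"
        by (rule Bn[OF h(1)])
      also have "Cmp ?C (?q (\<beta> X)) (Cmp ?C (Cmp ?C (?q (\<alpha> X)) (\<beta> (?M X))) (\<alpha> (?M X))) =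
          Cmp ?C (?q (Cmp ?C (\<beta> X) (\<alpha> X))) (Cmp ?C (\<beta> (?M X)) (\<alpha> (?M X)))"
        using assoc[OF h(3) h(4) h(11)] assoc[OF comp[OF h(3) h(4)] h(11) h(12)] Tc[OF Q h(1) h(2)]
        by simp
      finally show "Cmp ?C (Cmp ?C (\<beta> X) (\<alpha> X)) (mult M X) =
          Cmp ?C (mult Q X) (Cmp ?C (?q (Cmp ?C (\<beta> X) (\<alpha> X))) (Cmp ?C (\<beta> (?M X)) (\<alpha> (?M X))))" .
    next
      fix f assume f: "f \<in> Ar ?C"
      let ?X = "Dom ?C f" and ?Y = "Cod ?C f"
      have fh: "f \<in> hom ?C ?X ?Y" and X: "?X \<in> Ob ?C" and Y: "?Y \<in> Ob ?C"
        using ends[OF f] by auto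
      show "Cmp ?C (Cmp ?C (\<beta> ?Y) (\<alpha> ?Y)) (on_ar (mfun M) f) =
          Cmp ?C (on_ar (mfun Q) f) (Cmp ?C (\<beta> ?X) (\<alpha> ?X))"
        using assoc[OF Tf[OF M fh] A[OF Y] B[OF Y]] assoc[OF A[OF X] Tf[OF N fh] B[OF Y]]
          assoc[OF A[OF X] B[OF X] Tf[OF Q fh]] An[OF fh] Bn[OF fh] by simp
    qed
  qed
  show "monad_iso_rel \<subseteq> enriched_finitary_monads \<times> (enriched_finitary_monads :: 'u pos_monad set)"
    by (auto simp: monad_iso_rel_def)
  show "refl_on (enriched_finitary_monads :: 'u pos_monad set) monad_iso_rel"
  proof (rule refl_onI)
    fix M :: "'u pos_monad" assume M: "M \<in> enriched_finitary_monads"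
    then have M': "is_monad ?C M" by (simp add: enriched_finitary_monads_def)
    then have "Idn ?C (on_ob (mfun M) X) \<in> hom ?C (on_ob (mfun M) X) (on_ob (mfun M) X)"
      if "X \<in> Ob ?C" for X
      using that ido by (auto simp: is_monad_def is_functor_def)
    then have "monad_isomorphic ?C M M"
      unfolding monad_isomorphic_def using refl[OF M'] idl by blast
    with M show "(M, M) \<in> monad_iso_rel" by (simp add: monad_iso_rel_def)
  qed
  show "sym (monad_iso_rel :: 'u pos_monad rel)"
    unfolding sym_def monad_iso_rel_def monad_isomorphic_def by blast
  show "Relation.trans (monad_iso_rel :: 'u pos_monad rel)"
  proof (rule transI)
    fix M N Q :: "'u pos_monad"
    assume MN: "(M, N) \<in> monad_iso_rel" and NQ: "(N, Q) \<in> monad_iso_rel"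
    then have mon: "is_monad ?C M" "is_monad ?C N" "is_monad ?C Q"
      by (auto simp: monad_iso_rel_def enriched_finitary_monads_def)
    from MN obtain \<alpha> \<alpha>' where a: "monad_morphism ?C M N \<alpha>" "monad_morphism ?C N M \<alpha>'"
      and a': "\<forall>X\<in>Ob ?C. Cmp ?C (\<alpha>' X) (\<alpha> X) = Idn ?C (on_ob (mfun M) X) \<and>
        Cmp ?C (\<alpha> X) (\<alpha>' X) = Idn ?C (on_ob (mfun N) X)"
      by (auto simp: monad_iso_rel_def monad_isomorphic_def)
    from NQ obtain \<beta> \<beta>' where b: "monad_morphism ?C N Q \<beta>" "monad_morphism ?C Q N \<beta>'"
      and b': "\<forall>X\<in>Ob ?C. Cmp ?C (\<beta>' X) (\<beta> X) = Idn ?C (on_ob (mfun N) X) \<and>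
        Cmp ?C (\<beta> X) (\<beta>' X) = Idn ?C (on_ob (mfun Q) X)"
      by (auto simp: monad_iso_rel_def monad_isomorphic_def)
    have cancel: "Cmp ?C (Cmp ?C p' q') (Cmp ?C q p) = Cmp ?C p' p"
      if "p \<in> hom ?C X Y" "q \<in> hom ?C Y Z" "q' \<in> hom ?C Z Y" "p' \<in> hom ?C Y X"
        "Cmp ?C q' q = Idn ?C Y" for p q p' q' X Y Z
      using assoc[OF comp[OF that(1,2)] that(3,4)] assoc[OF that(1-3)] idl[OF that(1)] that(5)
      by simp
    have "Cmp ?C (Cmp ?C (\<alpha>' X) (\<beta>' X)) (Cmp ?C (\<beta> X) (\<alpha> X)) = Idn ?C (on_ob (mfun M) X) \<and>
        Cmp ?C (Cmp ?C (\<beta> X) (\<alpha> X)) (Cmp ?C (\<alpha>' X) (\<beta>' X)) = Idn ?C (on_ob (mfun Q) X)"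
      if X: "X \<in> Ob ?C" for X
    proof -
      have h: "\<alpha> X \<in> hom ?C (on_ob (mfun M) X) (on_ob (mfun N) X)"
        "\<alpha>' X \<in> hom ?C (on_ob (mfun N) X) (on_ob (mfun M) X)"
        "\<beta> X \<in> hom ?C (on_ob (mfun N) X) (on_ob (mfun Q) X)"
        "\<beta>' X \<in> hom ?C (on_ob (mfun Q) X) (on_ob (mfun N) X)"
        using a b X by (auto simp: monad_morphism_def nat_trans_def)
      show ?thesis
        using cancel[OF h(1,3,4,2)] cancel[OF h(4,2,1,3)] a' b' X by simp
    qed
    then have "monad_isomorphic ?C M Q"
      unfolding monad_isomorphic_def
      using trans[OF mon a(1) b(1)] trans[OF mon(3,2,1) b(2) a(2)] by blast
    with MN NQ show "(M, Q) \<in> monad_iso_rel" by (simp add: monad_iso_rel_def)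
  qed
qed

end

theory Submission
  imports Defs "HOL-Library.Countable_Set"
begin

text \<open>The free-algebra monad of a variety is analysed through its free algebras. The free algebra on \<open>X\<close>
is the subalgebra, generated by \<open>X\<close>, of the product of all models that receive a monotone map from
\<open>X\<close>. The product is too large to be a poset in \<open>Pos\<close>, but operations have finite arity, so the
generated part is small; its projections to models jointly reflect the order, hence it satisfies
every inequation (\<open>models_reflect\<close>, \<open>free_algebra_exists\<close>). The generators generate, so two
homomorphisms, or two inequalities between them, can be compared on generators. This yields the
monad laws and enrichment.

The monad is finitary because arities are finite posets. A filtered colimit in \<open>Pos\<close> is
characterised by two elementwise properties: every element comes from some stage, and an inequality
already holds at a later stage (\<open>colimit_is_concrete\<close>). Consequently a monotone map from a finite
poset into the colimit factors through a stage (\<open>factor_finite\<close>), the operations of a filtered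
diagram of models extend to the colimit of their posets (\<open>filtered_colimit_of_models\<close>), and the
colimit of the free algebras on the stages is free on the colimit.

A variety is recovered from its monad, concretely over \<open>Pos\<close>: a model \<open>A\<close> is the same thing as an
Eilenberg--Moore algebra \<open>T A \<rightarrow> A\<close>, an operation \<open>\<sigma>\<close> being evaluated first in the free algebra at
the generators and then by the structure map (\<open>em_model\<close>, \<open>structure_map_em_model\<close>,
\<open>em_model_structure_map\<close>). Isomorphic monads have the same Eilenberg--Moore algebras, so their
varieties are concretely isomorphic; conversely a concrete isomorphism matches free algebras.

Every enriched finitary monad \<open>T\<close> arises. Take the elements of \<open>T \<Gamma>\<close> as operation symbols of arity
\<open>\<Gamma>\<close>, with inequations expressing the order of \<open>T \<Gamma>\<close>, substitution and the unit. The poset \<open>T X\<close>,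
with \<open>\<sigma>\<close> acting on \<open>f : \<Gamma> \<rightarrow> T X\<close> by the Kleisli extension of \<open>f\<close>, is a model. It is free on \<open>X\<close>
because \<open>X\<close> is the filtered colimit of the contexts it contains, \<open>T\<close> preserves this colimit, and on
\<open>T \<Gamma>\<close> the value of an extension at \<open>\<sigma>\<close> is forced to be the operation \<open>\<sigma>\<close> (\<open>canonical_free\<close>).\<close>

section \<open>Small sets\<close>

text \<open>Smallness for sets of elements of an arbitrary type, so that sets of functions, of finite subsets
or of contexts can be called small before they are coded in \<open>'u\<close>.\<close>

definition few :: "'u itself \<Rightarrow> 'b set \<Rightarrow> bool" where
  "few _ A \<longleftrightarrow> |A| <o |UNIV :: 'u set|"

lemma small_iff_few: "small A \<longleftrightarrow> few TYPE('u) (A :: 'u set)"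
  by (simp add: small_def few_def)

lemma few_image: "few U A \<Longrightarrow> few U (f ` A)"
  unfolding few_def by (rule ordLeq_ordLess_trans[OF card_of_image])

lemma few_subset: "few U B \<Longrightarrow> A \<subseteq> B \<Longrightarrow> few U A"
  unfolding few_def by (rule ordLeq_ordLess_trans[OF card_of_mono1])

lemma isomorphic_refl:
  assumes "X \<in> Ob Pos" shows "isomorphic Pos X X"
proof -
  have i: "Idn Pos X \<in> hom Pos X X"
    using category_Pos assms unfolding category_def by blast
  then have "Cmp Pos (Idn Pos X) (Idn Pos (Dom Pos (Idn Pos X))) = Idn Pos X"
    using category_Pos unfolding category_def hom_def by blast
  then have "Cmp Pos (Idn Pos X) (Idn Pos X) = Idn Pos X"
    using i by (simp add: hom_def)
  with i show ?thesis unfolding isomorphic_def by blast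
qed

context
  assumes U: "universe TYPE('u)"
begin

lemma Cinfinite_universe: "Cinfinite |UNIV :: 'u set|"
proof
  have "natLeq \<le>o |UNIV :: 'u set|"
    using U unfolding universe_def by (blast intro: ordLess_imp_ordLeq)
  then show "cinfinite |UNIV :: 'u set|" by (rule cinfinite_mono) (rule natLeq_cinfinite)
qed (rule card_of_Card_order)

lemma few_countable: "countable A \<Longrightarrow> few TYPE('u) A"
proof -
  assume "countable A"
  then have "|A| \<le>o |UNIV :: nat set|"
    unfolding countable_def card_of_ordLeq[symmetric] by blast
  then have "|A| \<le>o natLeq" using card_of_nat by (rule ordLeq_ordIso_trans)
  then show ?thesis
    using U unfolding few_def universe_def by (blast intro: ordLeq_ordLess_trans)
qed

text \<open>Regularity of the cardinality of \<open>'u\<close> enters through this closure property.\<close>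

lemma few_UN: "few TYPE('u) I \<Longrightarrow> (\<And>i. i \<in> I \<Longrightarrow> few TYPE('u) (A i)) \<Longrightarrow> few TYPE('u) (\<Union>i\<in>I. A i)"
  using card_of_UNION_ordLess_infinite_Field_regularCard[of "|UNIV :: 'u set|" I A]
    Cinfinite_universe U unfolding few_def universe_def by auto

lemma few_Sigma:
  "few TYPE('u) I \<Longrightarrow> (\<And>i. i \<in> I \<Longrightarrow> few TYPE('u) (A i)) \<Longrightarrow> few TYPE('u) (SIGMA i:I. A i)"
  unfolding Sigma_def by (intro few_UN) (auto intro: few_countable)

text \<open>A function on a finite set is a finite tuple, so induction on the domain reduces the claim to
binary products.\<close>

lemma few_PiE:
  assumes "finite D" "few TYPE('u) A"
  shows "few TYPE('u) (D \<rightarrow>\<^sub>E A)"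
  using assms(1)
proof (induction D)
  case empty
  then show ?case by (simp add: few_countable)
next
  case (insert x D)
  have "(insert x D \<rightarrow>\<^sub>E A) = (\<lambda>(y, g). g(x := y)) ` (A \<times> (D \<rightarrow>\<^sub>E A))"
    by (rule PiE_insert_eq)
  then show ?case
    using insert assms(2) by (simp add: few_image few_Sigma)
qed

text \<open>A finite set is the image of some \<open>{..<n}\<close>.\<close>

lemma few_finite_subsets:
  assumes "few TYPE('u) A"
  shows "few TYPE('u) {s. s \<subseteq> A \<and> finite s}"
proof (rule few_subset)
  show "few TYPE('u) (\<Union>n::nat. (\<lambda>f. f ` {..<n}) ` ({..<n} \<rightarrow>\<^sub>E A))"
    by (rule few_UN, rule few_countable, simp, rule few_image, rule few_PiE, simp, rule assms)
  show "{s. s \<subseteq> A \<and> finite s} \<subseteq> (\<Union>n::nat. (\<lambda>f. f ` {..<n}) ` ({..<n} \<rightarrow>\<^sub>E A))"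
  proof clarify
    fix s assume s: "s \<subseteq> A" "finite s"
    obtain n :: nat and f where f: "s = f ` {i. i < n}"
      using finite_imp_nat_seg_image_inj_on[OF s(2)] by auto
    have "s = (restrict f {..<n}) ` {..<n}" "restrict f {..<n} \<in> {..<n} \<rightarrow>\<^sub>E A"
      using f s by (auto simp: lessThan_def)
    then show "s \<in> (\<Union>n::nat. (\<lambda>f. f ` {..<n}) ` ({..<n} \<rightarrow>\<^sub>E A))"
      by (intro UN_I[of n] image_eqI[of s _ "restrict f {..<n}"]) simp_all
  qed
qed

lemma few_code:
  assumes "few TYPE('u) A"
  obtains e :: "'b \<Rightarrow> 'u" where "inj_on e (A :: 'b set)"
proof -
  have "|A| \<le>o |UNIV :: 'u set|" using assms unfolding few_def by (rule ordLess_imp_ordLeq)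
  then show ?thesis using that card_of_ordLeq[of A "UNIV :: 'u set"] by blast
qed

text \<open>A context is determined by any of its copies on natural numbers, so there are only
  countably many of them.\<close>

lemma few_contexts:
  fixes P :: "'u rel set"
  assumes P: "contexts P"
  shows "few TYPE('u) P"
proof -
  have fin: "finite (Field \<Gamma>)" "\<Gamma> \<in> Ob Pos" if "\<Gamma> \<in> P" for \<Gamma>
    using P that by (auto simp: contexts_def)
  define cd :: "'u rel \<Rightarrow> 'u \<Rightarrow> nat" where "cd \<Gamma> = (SOME f. inj_on f (Field \<Gamma>))" for \<Gamma>
  have cd: "inj_on (cd \<Gamma>) (Field \<Gamma>)" if "\<Gamma> \<in> P" for \<Gamma>
  proof -
    have "\<exists>f :: 'u \<Rightarrow> nat. inj_on f (Field \<Gamma>)"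
      using finite_imp_inj_to_nat_seg[OF fin(1)[OF that]] by blast
    then show ?thesis unfolding cd_def by (rule someI_ex)
  qed
  define N where "N \<Gamma> = map_prod (cd \<Gamma>) (cd \<Gamma>) ` \<Gamma>" for \<Gamma> :: "'u rel"
  have img: "cd \<Gamma> ` Field \<Gamma> = Field (N \<Gamma>)" for \<Gamma>
    unfolding N_def Field_def by force
  \<comment> \<open>Equal copies give mutually inverse monotone maps, and isomorphic contexts are equal.\<close>
  have "inj_on N P"
  proof (rule inj_onI)
    fix \<Gamma> \<Delta> assume G: "\<Gamma> \<in> P" and D: "\<Delta> \<in> P" and eq: "N \<Gamma> = N \<Delta>"
    have iso: "\<exists>g. g \<in> monotone_maps \<Gamma> \<Delta> \<and> (\<forall>x\<in>Field \<Gamma>. cd \<Delta> (g x) = cd \<Gamma> x)"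
      if G: "\<Gamma> \<in> P" and D: "\<Delta> \<in> P" and eq: "N \<Gamma> = N \<Delta>" for \<Gamma> \<Delta>
    proof -
      have "\<forall>x\<in>Field \<Gamma>. \<exists>y\<in>Field \<Delta>. cd \<Delta> y = cd \<Gamma> x"
        using img[of \<Gamma>] img[of \<Delta>] eq by (metis image_iff)
      then obtain g where g: "\<forall>x\<in>Field \<Gamma>. g x \<in> Field \<Delta> \<and> cd \<Delta> (g x) = cd \<Gamma> x" by metis
      have "(g x, g y) \<in> \<Delta>" if "(x, y) \<in> \<Gamma>" for x y
      proof -
        have xy: "x \<in> Field \<Gamma>" "y \<in> Field \<Gamma>" using that by (auto intro: FieldI1 FieldI2)
        have "(cd \<Gamma> x, cd \<Gamma> y) \<in> N \<Delta>" using imageI[OF that, of "map_prod (cd \<Gamma>) (cd \<Gamma>)"] eq by (simp add: N_def)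
        then obtain a b where ab: "(a, b) \<in> \<Delta>" "cd \<Delta> a = cd \<Gamma> x" "cd \<Delta> b = cd \<Gamma> y"
          unfolding N_def by auto
        have ab': "a \<in> Field \<Delta>" "b \<in> Field \<Delta>" using ab(1) by (auto intro: FieldI1 FieldI2)
        have "a = g x" "b = g y"
          using ab ab' g xy inj_onD[OF cd[OF D], of a "g x"] inj_onD[OF cd[OF D], of b "g y"] by auto
        with ab show ?thesis by simp
      qed
      with g have "restrict g (Field \<Gamma>) \<in> monotone_maps \<Gamma> \<Delta>"
        by (auto simp: monotone_maps_def monotone_on_def)
      with g show ?thesis by (intro exI[of _ "restrict g (Field \<Gamma>)"]) auto
    qed
    obtain g where g: "g \<in> monotone_maps \<Gamma> \<Delta>" "\<forall>x\<in>Field \<Gamma>. cd \<Delta> (g x) = cd \<Gamma> x"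
      using iso[OF G D eq] by blast
    obtain h where h: "h \<in> monotone_maps \<Delta> \<Gamma>" "\<forall>x\<in>Field \<Delta>. cd \<Gamma> (h x) = cd \<Delta> x"
      using iso[OF D G eq[symmetric]] by blast
    have gF: "g x \<in> Field \<Delta>" if "x \<in> Field \<Gamma>" for x using g that by (auto simp: monotone_maps_def)
    have hF: "h x \<in> Field \<Gamma>" if "x \<in> Field \<Delta>" for x using h that by (auto simp: monotone_maps_def)
    have "h (g x) = x" if "x \<in> Field \<Gamma>" for x
      using g h gF hF that cd[OF G] by (metis inj_onD)
    moreover have "g (h x) = x" if "x \<in> Field \<Delta>" for x
      using g h gF hF that cd[OF D] by (metis inj_onD)
    ultimately have "isomorphic Pos \<Gamma> \<Delta>"
      unfolding isomorphic_def using fin[OF G] fin[OF D] g(1) h(1)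
      by (intro bexI[of _ "Arrow \<Gamma> \<Delta> g"] bexI[of _ "Arrow \<Delta> \<Gamma> h"])
        (auto simp: hom_def Pos_def compose_def restrict_def)
    moreover have "isomorphic Pos \<Gamma> \<Gamma>"
      using fin(2)[OF G] by (rule isomorphic_refl)
    moreover have "\<exists>!\<Theta>. \<Theta> \<in> P \<and> isomorphic Pos \<Gamma> \<Theta>"
      using P fin[OF G] unfolding contexts_def by blast
    ultimately show "\<Gamma> = \<Delta>" using G D by blast
  qed
  moreover have "finite (N \<Gamma>)" if "\<Gamma> \<in> P" for \<Gamma>
    unfolding N_def
  proof (rule finite_imageI, rule finite_subset)
    show "\<Gamma> \<subseteq> Field \<Gamma> \<times> Field \<Gamma>" by (auto intro: FieldI1 FieldI2)
    show "finite (Field \<Gamma> \<times> Field \<Gamma>)" using fin(1)[OF that] by simp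
  qed
  then have "N ` P \<subseteq> {s. finite s}" by auto
  then have "countable (N ` P)"
    by (rule countable_subset) (rule countable_Collect_finite)
  ultimately have "countable P" by (rule countable_image_inj_on[rotated])
  then show ?thesis by (rule few_countable)
qed

end

section \<open>Posets\<close>

lemma monotone_mapsI:
  "\<lbrakk>\<And>x. x \<in> Field X \<Longrightarrow> f x \<in> Field Y; \<And>x y. (x, y) \<in> X \<Longrightarrow> (f x, f y) \<in> Y;
    \<And>x. x \<notin> Field X \<Longrightarrow> f x = undefined\<rbrakk> \<Longrightarrow> f \<in> monotone_maps X Y"
  by (auto simp: monotone_maps_def monotone_on_def PiE_iff extensional_def)

lemma monotone_maps_mem: "f \<in> monotone_maps X Y \<Longrightarrow> x \<in> Field X \<Longrightarrow> f x \<in> Field Y"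
  by (auto simp: monotone_maps_def)

lemma monotone_maps_le: "f \<in> monotone_maps X Y \<Longrightarrow> (x, y) \<in> X \<Longrightarrow> (f x, f y) \<in> Y"
  by (auto simp: monotone_maps_def monotone_on_def FieldI1 FieldI2)

lemma monotone_maps_restrictI:
  "\<lbrakk>\<And>x. x \<in> Field X \<Longrightarrow> f x \<in> Field Y; \<And>x y. (x, y) \<in> X \<Longrightarrow> (f x, f y) \<in> Y\<rbrakk>
    \<Longrightarrow> restrict f (Field X) \<in> monotone_maps X Y"
  by (rule monotone_mapsI) (auto intro: FieldI1 FieldI2)

lemma monotone_maps_eqI:
  "\<lbrakk>f \<in> monotone_maps X Y; g \<in> monotone_maps X Z; \<And>x. x \<in> Field X \<Longrightarrow> f x = g x\<rbrakk> \<Longrightarrow> f = g"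
  unfolding monotone_maps_def by (rule extensionalityI[of _ "Field X"]) (auto simp: PiE_def)

lemma monotone_maps_compose:
  "f \<in> monotone_maps X Y \<Longrightarrow> g \<in> monotone_maps Y Z \<Longrightarrow> compose (Field X) g f \<in> monotone_maps X Z"
  unfolding compose_def
  by (rule monotone_maps_restrictI) (auto intro: monotone_maps_mem monotone_maps_le)

lemma compose_apply [simp]: "x \<in> A \<Longrightarrow> compose A g f x = g (f x)"
  by (simp add: compose_def)

lemma Ob_Pos: "X \<in> Ob Pos \<longleftrightarrow> Partial_order X \<and> small (Field X)"
  by (simp add: Pos_def)

lemma Pos_refl: "X \<in> Ob Pos \<Longrightarrow> x \<in> Field X \<Longrightarrow> (x, x) \<in> X"
  by (auto simp: Ob_Pos order_on_defs refl_on_def)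

lemma Pos_trans: "X \<in> Ob Pos \<Longrightarrow> (x, y) \<in> X \<Longrightarrow> (y, z) \<in> X \<Longrightarrow> (x, z) \<in> X"
  by (auto simp: Ob_Pos order_on_defs trans_def)

lemma Pos_antisym: "X \<in> Ob Pos \<Longrightarrow> (x, y) \<in> X \<Longrightarrow> (y, x) \<in> X \<Longrightarrow> x = y"
  by (auto simp: Ob_Pos order_on_defs antisym_def)

lemma hom_Pos:
  "f \<in> hom Pos X Y \<longleftrightarrow>
    X \<in> Ob Pos \<and> Y \<in> Ob Pos \<and> src f = X \<and> tgt f = Y \<and> fn f \<in> monotone_maps X Y"
  by (auto simp: hom_def Pos_def)

lemma Ar_Pos: "f \<in> Ar Pos \<longleftrightarrow> f \<in> hom Pos (src f) (tgt f)"
  by (auto simp: hom_Pos) (auto simp: Pos_def)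

lemma Pos_sel [simp]: "Dom Pos = src" "Cod Pos = tgt"
  by (simp_all add: Pos_def)

lemma Arrow_in_hom_Pos:
  "X \<in> Ob Pos \<Longrightarrow> Y \<in> Ob Pos \<Longrightarrow> f \<in> monotone_maps X Y \<Longrightarrow> Arrow X Y f \<in> hom Pos X Y"
  by (simp add: hom_Pos)

lemma hom_Pos_eqI:
  "\<lbrakk>f \<in> hom Pos X Y; g \<in> hom Pos X Y; \<And>x. x \<in> Field X \<Longrightarrow> fn f x = fn g x\<rbrakk> \<Longrightarrow> f = g"
  by (auto simp: hom_Pos intro!: arrow.expand intro: monotone_maps_eqI)

lemma hom_Pos_mem: "f \<in> hom Pos X Y \<Longrightarrow> x \<in> Field X \<Longrightarrow> fn f x \<in> Field Y"
  by (auto simp: hom_Pos intro: monotone_maps_mem)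

lemma hom_Pos_le: "f \<in> hom Pos X Y \<Longrightarrow> (x, y) \<in> X \<Longrightarrow> (fn f x, fn f y) \<in> Y"
  by (auto simp: hom_Pos intro: monotone_maps_le)

lemma Cmp_Pos_in: "f \<in> hom Pos X Y \<Longrightarrow> g \<in> hom Pos Y Z \<Longrightarrow> Cmp Pos g f \<in> hom Pos X Z"
  by (auto simp: hom_Pos) (auto simp: Pos_def intro: monotone_maps_compose)

lemma Cmp_Pos_apply: "f \<in> hom Pos X Y \<Longrightarrow> x \<in> Field X \<Longrightarrow> fn (Cmp Pos g f) x = fn g (fn f x)"
  by (auto simp: hom_Pos) (auto simp: Pos_def)

lemma fn_Cmp_Pos: "f \<in> hom Pos X Y \<Longrightarrow> fn (Cmp Pos g f) = compose (Field X) (fn g) (fn f)"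
  by (auto simp: hom_Pos) (auto simp: Pos_def)

lemma Idn_Pos_in: "X \<in> Ob Pos \<Longrightarrow> Idn Pos X \<in> hom Pos X X"
  using category_Pos unfolding category_def by blast

lemma Idn_Pos_apply: "x \<in> Field X \<Longrightarrow> fn (Idn Pos X) x = x"
  by (simp add: Pos_def)

text \<open>Colimits and free algebras first appear as preorders on other types than \<open>'u\<close>; the quotient map \<open>\<pi>\<close>
turns them into objects of \<open>Pos\<close>.\<close>

lemma preorder_to_poset:
  fixes W :: "'b set"
  assumes "few TYPE('u) W"
    and refl: "\<And>w. w \<in> W \<Longrightarrow> R w w"
    and trans: "\<And>u v w. \<lbrakk>u \<in> W; v \<in> W; w \<in> W; R u v; R v w\<rbrakk> \<Longrightarrow> R u w"
    and U: "universe TYPE('u)"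
  obtains Q :: "'u rel" and \<pi> where
    "Q \<in> Ob Pos" "Field Q = \<pi> ` W" "\<And>u v. u \<in> W \<Longrightarrow> v \<in> W \<Longrightarrow> (\<pi> u, \<pi> v) \<in> Q \<longleftrightarrow> R u v"
proof -
  obtain e :: "'b \<Rightarrow> 'u" where e: "inj_on e W" using few_code[OF U assms(1)] by blast
  \<comment> \<open>\<open>r\<close> chooses a representative of each class of the induced equivalence.\<close>
  define r where "r w = (SOME v. v \<in> W \<and> R w v \<and> R v w)" for w
  have r: "r w \<in> W" "R w (r w)" "R (r w) w" if "w \<in> W" for w
    using someI[of "\<lambda>v. v \<in> W \<and> R w v \<and> R v w" w] that refl[OF that] unfolding r_def[symmetric] by auto
  have r_eq: "r u = r v" if uv: "u \<in> W" "v \<in> W" "R u v" "R v u" for u v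
  proof -
    have "(x \<in> W \<and> R u x \<and> R x u) = (x \<in> W \<and> R v x \<and> R x v)" for x
      using uv trans[of u v x] trans[of v u x] trans[of x u v] trans[of x v u] by blast
    then show ?thesis unfolding r_def by simp
  qed
  define Q where "Q = {(e (r u), e (r v)) | u v. u \<in> W \<and> v \<in> W \<and> R u v}"
  have iff: "(e (r u), e (r v)) \<in> Q \<longleftrightarrow> R u v" if uv: "u \<in> W" "v \<in> W" for u v
  proof
    assume "(e (r u), e (r v)) \<in> Q"
    then obtain u' v' where *: "e (r u) = e (r u')" "e (r v) = e (r v')" "u' \<in> W" "v' \<in> W" "R u' v'"
      unfolding Q_def by auto
    have eq: "r u = r u'" "r v = r v'"
      using inj_onD[OF e *(1) r(1)[OF uv(1)] r(1)[OF *(3)]]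
        inj_onD[OF e *(2) r(1)[OF uv(2)] r(1)[OF *(4)]] by auto
    have "R u u'"
      using trans[of u "r u'" u'] r[OF uv(1)] r[OF *(3)] uv * unfolding eq by blast
    moreover have "R v' v"
      using trans[of v' "r v'" v] r[OF uv(2)] r[OF *(4)] uv * unfolding eq by blast
    ultimately show "R u v"
      using trans[of u u' v] trans[of u' v' v] uv * by blast
  qed (use uv in \<open>auto simp: Q_def\<close>)
  have F: "Field Q = (\<lambda>w. e (r w)) ` W"
    unfolding Field_def Q_def using refl by auto
  have "Partial_order Q"
    unfolding order_on_defs
  proof (intro conjI)
    show "refl_on (Field Q) Q"
      unfolding F by (rule refl_onI) (auto simp: iff refl)
    show "Q \<subseteq> Field Q \<times> Field Q" by (auto intro: FieldI1 FieldI2)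
    show "Relation.trans Q"
    proof (rule transI)
      fix x y z assume xy: "(x, y) \<in> Q" and yz: "(y, z) \<in> Q"
      then have "x \<in> Field Q" "y \<in> Field Q" "z \<in> Field Q" by (auto intro: FieldI1 FieldI2)
      with xy yz show "(x, z) \<in> Q" unfolding F by (auto simp: iff intro: trans)
    qed
    show "antisym Q"
    proof (rule antisymI)
      fix x y assume xy: "(x, y) \<in> Q" and yx: "(y, x) \<in> Q"
      then have "x \<in> Field Q" "y \<in> Field Q" by (auto intro: FieldI1 FieldI2)
      then obtain u v where uv: "u \<in> W" "v \<in> W" "x = e (r u)" "y = e (r v)" unfolding F by auto
      with xy yx have "r u = r v" by (intro r_eq) (simp_all add: iff)
      with uv show "x = y" by simp
    qed
  qed
  moreover have "small (Field Q)"
    unfolding small_iff_few F by (rule few_image[OF assms(1)])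
  ultimately have "Q \<in> Ob Pos" by (simp add: Ob_Pos)
  from this F iff show ?thesis by (rule that)
qed

section \<open>Filtered colimits of posets\<close>

text \<open>The description of a filtered colimit of posets as a quotient of the disjoint union of the stages.
Unlike the universal property it can be verified and used elementwise.\<close>

definition concrete_colimit ::
  "('i, 'j) cat \<Rightarrow> ('i, 'j, 'u rel, 'u pos_arrow) func \<Rightarrow> 'u rel \<Rightarrow> ('i \<Rightarrow> 'u pos_arrow) \<Rightarrow> bool" where
  "concrete_colimit I D X c \<longleftrightarrow>
     cocone I Pos D X c \<and>
     (\<forall>x\<in>Field X. \<exists>i\<in>Ob I. \<exists>a\<in>Field (on_ob D i). x = fn (c i) a) \<and>
     (\<forall>i\<in>Ob I. \<forall>j\<in>Ob I. \<forall>a\<in>Field (on_ob D i). \<forall>b\<in>Field (on_ob D j).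
        (fn (c i) a, fn (c j) b) \<in> X \<longrightarrow>
        (\<exists>k\<in>Ob I. \<exists>u\<in>hom I i k. \<exists>v\<in>hom I j k.
           (fn (on_ar D u) a, fn (on_ar D v) b) \<in> on_ob D k))"

locale filtered_diagram =
  fixes I :: "('i, 'j) cat" and D :: "('i, 'j, 'u rel, 'u pos_arrow) func"
  assumes U: "universe TYPE('u)"
    and filtered: "filtered I"
    and small_index: "few TYPE('u) (Ob I)"
    and diagram: "is_functor I Pos D"
begin

lemma index_category: "category I"
  using filtered by (simp add: filtered_def)

lemma comp_in: "u \<in> hom I i j \<Longrightarrow> v \<in> hom I j k \<Longrightarrow> Cmp I v u \<in> hom I i k"
  using index_category unfolding category_def hom_def by auto

lemma assoc_in: "\<lbrakk>u \<in> hom I i j; v \<in> hom I j k; w \<in> hom I k l\<rbrakk>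
    \<Longrightarrow> Cmp I w (Cmp I v u) = Cmp I (Cmp I w v) u"
  using index_category unfolding category_def hom_def by auto

lemma idn_in: "i \<in> Ob I \<Longrightarrow> Idn I i \<in> hom I i i"
  using index_category unfolding category_def by auto

lemma hom_ob: "u \<in> hom I i j \<Longrightarrow> i \<in> Ob I" "u \<in> hom I i j \<Longrightarrow> j \<in> Ob I"
  using index_category unfolding category_def hom_def by auto

lemma D_ob: "i \<in> Ob I \<Longrightarrow> on_ob D i \<in> Ob Pos"
  using diagram unfolding is_functor_def by blast

lemma D_ar: "u \<in> hom I i j \<Longrightarrow> on_ar D u \<in> hom Pos (on_ob D i) (on_ob D j)"
  using diagram unfolding is_functor_def hom_def[of I] by auto

lemma D_comp:
  assumes "u \<in> hom I i j" "v \<in> hom I j k" "a \<in> Field (on_ob D i)"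
  shows "fn (on_ar D (Cmp I v u)) a = fn (on_ar D v) (fn (on_ar D u) a)"
proof -
  have "on_ar D (Cmp I v u) = Cmp Pos (on_ar D v) (on_ar D u)"
    using diagram assms unfolding is_functor_def hom_def[of I] by auto
  then show ?thesis using Cmp_Pos_apply[OF D_ar[OF assms(1)] assms(3)] by simp
qed

lemma D_idn: "i \<in> Ob I \<Longrightarrow> a \<in> Field (on_ob D i) \<Longrightarrow> fn (on_ar D (Idn I i)) a = a"
  using diagram unfolding is_functor_def by (simp add: Idn_Pos_apply)

lemmas D_mem = hom_Pos_mem[OF D_ar]
lemmas D_le = hom_Pos_le[OF D_ar]

lemma upper_bound:
  assumes "i \<in> Ob I" "j \<in> Ob I"
  obtains k u v where "k \<in> Ob I" "u \<in> hom I i k" "v \<in> hom I j k"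
  using filtered assms unfolding filtered_def by blast

lemma coequalise:
  assumes "u \<in> hom I i j" "v \<in> hom I i j"
  obtains k w where "k \<in> Ob I" "w \<in> hom I j k" "Cmp I w u = Cmp I w v"
  using filtered assms hom_ob[OF assms(1)] unfolding filtered_def by blast

text \<open>Transitivity of the order on a colimit compares two stages that receive a common earlier one; this
commuting square is where they meet.\<close>

lemma amalgamate:
  assumes u: "u \<in> hom I i j" and v: "v \<in> hom I i k"
  obtains l p q where "l \<in> Ob I" "p \<in> hom I j l" "q \<in> hom I k l" "Cmp I p u = Cmp I q v"
proof -
  obtain m p q where pq: "p \<in> hom I j m" "q \<in> hom I k m"
    using upper_bound[OF hom_ob(2)[OF u] hom_ob(2)[OF v]] by blast
  obtain l w where w: "l \<in> Ob I" "w \<in> hom I m l" "Cmp I w (Cmp I p u) = Cmp I w (Cmp I q v)"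
    using coequalise[OF comp_in[OF u pq(1)] comp_in[OF v pq(2)]] by blast
  show ?thesis
    using that[OF w(1) comp_in[OF pq(1) w(2)] comp_in[OF pq(2) w(2)]]
      w(3) assoc_in[OF u pq(1) w(2)] assoc_in[OF v pq(2) w(2)] by simp
qed

lemma finite_upper_bound:
  assumes "finite F" "F \<subseteq> Ob I"
  shows "\<exists>k\<in>Ob I. \<forall>i\<in>F. hom I i k \<noteq> {}"
  using assms
proof (induction F)
  case empty
  then show ?case using filtered by (auto simp: filtered_def)
next
  case (insert j F)
  then obtain k where k: "k \<in> Ob I" "\<forall>i\<in>F. hom I i k \<noteq> {}" by auto
  obtain l u v where luv: "l \<in> Ob I" "u \<in> hom I j l" "v \<in> hom I k l"
    using upper_bound[of j k] insert.prems k by auto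
  have "hom I i l \<noteq> {}" if "i \<in> F" for i
    using k that comp_in[OF _ luv(3)] by blast
  with luv show ?case by blast
qed

lemma cocone_hom: "cocone I Pos D X c \<Longrightarrow> i \<in> Ob I \<Longrightarrow> c i \<in> hom Pos (on_ob D i) X"
  by (simp add: cocone_def)

lemma cocone_app:
  assumes "cocone I Pos D X c" "u \<in> hom I i j" "a \<in> Field (on_ob D i)"
  shows "fn (c j) (fn (on_ar D u) a) = fn (c i) a"
proof -
  have "Cmp Pos (c j) (on_ar D u) = c i"
    using assms(1,2) unfolding cocone_def hom_def[of I] by auto
  then show ?thesis using Cmp_Pos_apply[OF D_ar[OF assms(2)] assms(3), of "c j"] by simp
qed

lemma cocone_le:
  assumes c: "cocone I Pos D X c" and u: "u \<in> hom I i k" and v: "v \<in> hom I j k"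
    and a: "a \<in> Field (on_ob D i)" and b: "b \<in> Field (on_ob D j)"
    and le: "(fn (on_ar D u) a, fn (on_ar D v) b) \<in> on_ob D k"
  shows "(fn (c i) a, fn (c j) b) \<in> X"
  using hom_Pos_le[OF cocone_hom[OF c hom_ob(2)[OF u]] le]
    cocone_app[OF c u a] cocone_app[OF c v b] by simp

lemma concrete_colimit_le:
  assumes c: "concrete_colimit I D X c" and "i \<in> Ob I" "j \<in> Ob I"
    and a: "a \<in> Field (on_ob D i)" and b: "b \<in> Field (on_ob D j)"
    and le: "(fn (c i) a, fn (c j) b) \<in> X"
  obtains k u v where "k \<in> Ob I" "u \<in> hom I i k" "v \<in> hom I j k"
    "(fn (on_ar D u) a, fn (on_ar D v) b) \<in> on_ob D k"
  using assms unfolding concrete_colimit_def by blast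

lemma concrete_colimit_cocone: "concrete_colimit I D X c \<Longrightarrow> cocone I Pos D X c"
  by (simp add: concrete_colimit_def)

lemma concrete_colimit_surj:
  assumes "concrete_colimit I D X c" "x \<in> Field X"
  obtains i a where "i \<in> Ob I" "a \<in> Field (on_ob D i)" "x = fn (c i) a"
  using assms unfolding concrete_colimit_def by blast

text \<open>Pairs of a stage and an element of it are preordered by comparison at a common later stage; the
colimit is the quotient poset.\<close>

lemma concrete_colimit_exists: "\<exists>X c. concrete_colimit I D X c"
proof -
  define W where "W = (SIGMA i:Ob I. Field (on_ob D i))"
  define R where "R = (\<lambda>(i, a) (j, b). \<exists>k\<in>Ob I. \<exists>u\<in>hom I i k. \<exists>v\<in>hom I j k.
    (fn (on_ar D u) a, fn (on_ar D v) b) \<in> on_ob D k)"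
  have few: "few TYPE('u) W"
    unfolding W_def using D_ob by (intro few_Sigma U small_index) (simp add: Ob_Pos small_iff_few)
  have refl: "R w w" if "w \<in> W" for w
    using that unfolding W_def R_def
    by (force intro: idn_in bexI[of _ "Idn I (fst w)"] Pos_refl D_ob simp: D_idn)
  have trans: "R w1 w3" if h: "w1 \<in> W" "w2 \<in> W" "w3 \<in> W" "R w1 w2" "R w2 w3" for w1 w2 w3
  proof -
    obtain i a j b l d where w: "w1 = (i, a)" "w2 = (j, b)" "w3 = (l, d)" by (cases w1, cases w2, cases w3)
    note mem = h(1-3)[unfolded w W_def, simplified]
    obtain k u v where 1: "u \<in> hom I i k" "v \<in> hom I j k"
      "(fn (on_ar D u) a, fn (on_ar D v) b) \<in> on_ob D k"
      using h(4) unfolding w R_def by auto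
    obtain m s t where 2: "s \<in> hom I j m" "t \<in> hom I l m"
      "(fn (on_ar D s) b, fn (on_ar D t) d) \<in> on_ob D m"
      using h(5) unfolding w R_def by auto
    obtain n p q where 3: "n \<in> Ob I" "p \<in> hom I k n" "q \<in> hom I m n" "Cmp I p v = Cmp I q s"
      using amalgamate[OF 1(2) 2(1)] by blast
    have eq: "fn (on_ar D p) (fn (on_ar D v) b) = fn (on_ar D q) (fn (on_ar D s) b)"
      using D_comp[OF 1(2) 3(2), of b] D_comp[OF 2(1) 3(3), of b] mem 3(4) by simp
    have "(fn (on_ar D p) (fn (on_ar D u) a), fn (on_ar D q) (fn (on_ar D t) d)) \<in> on_ob D n"
      using Pos_trans[OF D_ob[OF 3(1)]] D_le[OF 3(2) 1(3)] D_le[OF 3(3) 2(3)] unfolding eq by blast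
    then have "(fn (on_ar D (Cmp I p u)) a, fn (on_ar D (Cmp I q t)) d) \<in> on_ob D n"
      using D_comp[OF 1(1) 3(2), of a] D_comp[OF 2(2) 3(3), of d] mem by simp
    then show ?thesis
      unfolding w R_def using 3(1) comp_in[OF 1(1) 3(2)] comp_in[OF 2(2) 3(3)] by auto
  qed
  obtain Q :: "'u rel" and \<pi> where Q: "Q \<in> Ob Pos" "Field Q = \<pi> ` W"
    and le: "\<And>u v. u \<in> W \<Longrightarrow> v \<in> W \<Longrightarrow> (\<pi> u, \<pi> v) \<in> Q \<longleftrightarrow> R u v"
    by (rule preorder_to_poset[where W = W and R = R, OF few]) (erule refl, erule (4) trans, rule U, rule that)
  define c where "c i = Arrow (on_ob D i) Q (\<lambda>a\<in>Field (on_ob D i). \<pi> (i, a))" for i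
  have app: "fn (c i) a = \<pi> (i, a)" if "a \<in> Field (on_ob D i)" for i a
    using that by (simp add: c_def)
  have leI: "(\<pi> (i, a), \<pi> (j, b)) \<in> Q"
    if "u \<in> hom I i k" "v \<in> hom I j k" "a \<in> Field (on_ob D i)" "b \<in> Field (on_ob D j)"
      "(fn (on_ar D u) a, fn (on_ar D v) b) \<in> on_ob D k" for i j k u v a b
    using that hom_ob[OF that(1)] hom_ob[OF that(2)] by (subst le) (auto simp: W_def R_def)
  have chom: "c i \<in> hom Pos (on_ob D i) Q" if i: "i \<in> Ob I" for i
    unfolding c_def
  proof (rule Arrow_in_hom_Pos[OF D_ob[OF i] Q(1)], rule monotone_maps_restrictI)
    show "\<pi> (i, a) \<in> Field Q" if "a \<in> Field (on_ob D i)" for a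
      using that i by (auto simp: Q(2) W_def)
    show "(\<pi> (i, a), \<pi> (i, b)) \<in> Q" if "(a, b) \<in> on_ob D i" for a b
      using that i leI[OF idn_in[OF i] idn_in[OF i], of a b]
      by (simp add: D_idn FieldI1 FieldI2)
  qed
  have "cocone I Pos D Q c"
    unfolding cocone_def
  proof (intro conjI ballI)
    fix u assume "u \<in> Ar I"
    then have u: "u \<in> hom I (Dom I u) (Cod I u)" by (simp add: hom_def)
    let ?i = "Dom I u" and ?j = "Cod I u"
    note ij = hom_ob[OF u]
    show "Cmp Pos (c ?j) (on_ar D u) = c ?i"
    proof (rule hom_Pos_eqI[OF Cmp_Pos_in[OF D_ar[OF u] chom[OF ij(2)]] chom[OF ij(1)]])
      fix a assume a: "a \<in> Field (on_ob D ?i)"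
      note a' = D_mem[OF u a]
      have r: "(fn (on_ar D u) a, fn (on_ar D u) a) \<in> on_ob D ?j"
        by (rule Pos_refl[OF D_ob[OF ij(2)] a'])
      have "\<pi> (?j, fn (on_ar D u) a) = \<pi> (?i, a)"
        using leI[OF idn_in[OF ij(2)] u a' a] leI[OF u idn_in[OF ij(2)] a a'] r
        by (intro Pos_antisym[OF Q(1)]) (simp_all add: D_idn[OF ij(2) a'])
      then show "fn (Cmp Pos (c ?j) (on_ar D u)) a = fn (c ?i) a"
        by (simp add: Cmp_Pos_apply[OF D_ar[OF u] a] app[OF a] app[OF a'])
    qed
  qed (use Q chom in auto)
  moreover have "\<exists>i\<in>Ob I. \<exists>a\<in>Field (on_ob D i). x = fn (c i) a" if "x \<in> Field Q" for x
    using that by (auto simp: Q(2) W_def app)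
  moreover have "\<exists>k\<in>Ob I. \<exists>u\<in>hom I i k. \<exists>v\<in>hom I j k.
           (fn (on_ar D u) a, fn (on_ar D v) b) \<in> on_ob D k"
    if "i \<in> Ob I" "j \<in> Ob I" "a \<in> Field (on_ob D i)" "b \<in> Field (on_ob D j)"
      "(fn (c i) a, fn (c j) b) \<in> Q" for i j a b
    using that le[of "(i, a)" "(j, b)"] by (simp add: app W_def R_def)
  ultimately have "concrete_colimit I D Q c" unfolding concrete_colimit_def by blast
  then show ?thesis by blast
qed

text \<open>A cocone \<open>d\<close> factors through \<open>c\<close> by evaluating \<open>d\<close> at any preimage under \<open>c\<close>. Because
inequalities are reflected at a later stage, the value is independent of the preimage and monotone.\<close>

lemma concrete_colimit_is_colimit:
  assumes c: "concrete_colimit I D X c"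
  shows "colimit I Pos D X c"
  unfolding colimit_def
proof (intro conjI allI impI)
  note cc = concrete_colimit_cocone[OF c]
  show "cocone I Pos D X c" by (rule cc)
  have X: "X \<in> Ob Pos" using cc by (simp add: cocone_def)
  fix Y d assume d: "cocone I Pos D Y d"
  have Y: "Y \<in> Ob Pos" using d by (simp add: cocone_def)
  define rep where "rep x = (SOME p. fst p \<in> Ob I \<and> snd p \<in> Field (on_ob D (fst p)) \<and>
    x = fn (c (fst p)) (snd p))" for x
  have rep: "fst (rep x) \<in> Ob I" "snd (rep x) \<in> Field (on_ob D (fst (rep x)))"
    "fn (c (fst (rep x))) (snd (rep x)) = x" if "x \<in> Field X" for x
  proof -
    have "\<exists>p. fst p \<in> Ob I \<and> snd p \<in> Field (on_ob D (fst p)) \<and> x = fn (c (fst p)) (snd p)"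
      using concrete_colimit_surj[OF c that] by (metis fst_conv snd_conv)
    from someI_ex[OF this] show "fst (rep x) \<in> Ob I" "snd (rep x) \<in> Field (on_ob D (fst (rep x)))"
      "fn (c (fst (rep x))) (snd (rep x)) = x" unfolding rep_def[symmetric] by auto
  qed
  define h where "h x = fn (d (fst (rep x))) (snd (rep x))" for x
  have le: "(fn (d i) a, fn (d j) b) \<in> Y"
    if ij: "i \<in> Ob I" "j \<in> Ob I" "a \<in> Field (on_ob D i)" "b \<in> Field (on_ob D j)"
      "(fn (c i) a, fn (c j) b) \<in> X" for i j a b
  proof -
    obtain k u v where "u \<in> hom I i k" "v \<in> hom I j k"
      "(fn (on_ar D u) a, fn (on_ar D v) b) \<in> on_ob D k"
      by (rule concrete_colimit_le[OF c ij])
    then show ?thesis using ij by (intro cocone_le[OF d])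
  qed
  have hc: "h (fn (c i) a) = fn (d i) a" if i: "i \<in> Ob I" and a: "a \<in> Field (on_ob D i)" for i a
  proof -
    have x: "fn (c i) a \<in> Field X" by (rule hom_Pos_mem[OF cocone_hom[OF cc i] a])
    show ?thesis unfolding h_def
      using le[OF i rep(1)[OF x] a rep(2)[OF x]] le[OF rep(1)[OF x] i rep(2)[OF x] a]
        Pos_refl[OF X x] rep(3)[OF x] by (intro Pos_antisym[OF Y]) simp_all
  qed
  have hm: "restrict h (Field X) \<in> monotone_maps X Y"
  proof (rule monotone_maps_restrictI)
    show "h x \<in> Field Y" if "x \<in> Field X" for x
      unfolding h_def by (rule hom_Pos_mem[OF cocone_hom[OF d]]) (use rep[OF that] in auto)
    show "(h x, h y) \<in> Y" if xy: "(x, y) \<in> X" for x y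
    proof -
      have F: "x \<in> Field X" "y \<in> Field X" using xy by (auto intro: FieldI1 FieldI2)
      show ?thesis
        unfolding h_def using le[OF rep(1)[OF F(1)] rep(1)[OF F(2)] rep(2)[OF F(1)] rep(2)[OF F(2)]]
          rep(3)[OF F(1)] rep(3)[OF F(2)] xy by simp
    qed
  qed
  show "\<exists>!h. h \<in> hom Pos X Y \<and> (\<forall>i\<in>Ob I. Cmp Pos h (c i) = d i)"
  proof (rule ex1I[of _ "Arrow X Y (restrict h (Field X))"])
    have H: "Arrow X Y (restrict h (Field X)) \<in> hom Pos X Y" by (rule Arrow_in_hom_Pos[OF X Y hm])
    have "Cmp Pos (Arrow X Y (restrict h (Field X))) (c i) = d i" if i: "i \<in> Ob I" for i
    proof (rule hom_Pos_eqI[OF Cmp_Pos_in[OF cocone_hom[OF cc i] H] cocone_hom[OF d i]])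
      fix a assume a: "a \<in> Field (on_ob D i)"
      then show "fn (Cmp Pos (Arrow X Y (restrict h (Field X))) (c i)) a = fn (d i) a"
        using hc[OF i a] hom_Pos_mem[OF cocone_hom[OF cc i] a]
        by (simp add: Cmp_Pos_apply[OF cocone_hom[OF cc i] a])
    qed
    with H show "Arrow X Y (restrict h (Field X)) \<in> hom Pos X Y \<and>
      (\<forall>i\<in>Ob I. Cmp Pos (Arrow X Y (restrict h (Field X))) (c i) = d i)" by blast
    fix g assume g: "g \<in> hom Pos X Y \<and> (\<forall>i\<in>Ob I. Cmp Pos g (c i) = d i)"
    show "g = Arrow X Y (restrict h (Field X))"
    proof (rule hom_Pos_eqI[OF conjunct1[OF g] H])
      fix x assume x: "x \<in> Field X"
      then obtain i a where ia: "i \<in> Ob I" "a \<in> Field (on_ob D i)" "x = fn (c i) a"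
        by (rule concrete_colimit_surj[OF c])
      then show "fn g x = fn (Arrow X Y (restrict h (Field X))) x"
        using g x hc[OF ia(1,2)] Cmp_Pos_apply[OF cocone_hom[OF cc ia(1)] ia(2), of g] by simp
    qed
  qed
qed

text \<open>Colimits are unique up to isomorphism, so every colimit has the two concrete properties of
  the quotient construction.\<close>

lemma colimit_is_concrete:
  assumes X: "colimit I Pos D X c"
  shows "concrete_colimit I D X c"
proof -
  obtain Q q where Q: "concrete_colimit I D Q q" using concrete_colimit_exists by blast
  note Q' = concrete_colimit_is_colimit[OF Q] and qc = concrete_colimit_cocone[OF Q]
  have xc: "cocone I Pos D X c" using X by (simp add: colimit_def)
  have Xo: "X \<in> Ob Pos" using xc by (simp add: cocone_def)
  obtain h where h: "h \<in> hom Pos X Q" "\<forall>i\<in>Ob I. Cmp Pos h (c i) = q i"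
    using X qc unfolding colimit_def by blast
  obtain g where g: "g \<in> hom Pos Q X" "\<forall>i\<in>Ob I. Cmp Pos g (q i) = c i"
    using Q' xc unfolding colimit_def by blast
  have hc: "fn h (fn (c i) a) = fn (q i) a" if "i \<in> Ob I" "a \<in> Field (on_ob D i)" for i a
    using h(2) that Cmp_Pos_apply[OF cocone_hom[OF xc that(1)] that(2), of h] by simp
  have gq: "fn g (fn (q i) a) = fn (c i) a" if "i \<in> Ob I" "a \<in> Field (on_ob D i)" for i a
    using g(2) that Cmp_Pos_apply[OF cocone_hom[OF qc that(1)] that(2), of g] by simp
  have "\<exists>!k. k \<in> hom Pos X X \<and> (\<forall>i\<in>Ob I. Cmp Pos k (c i) = c i)"
    using X xc unfolding colimit_def by blast
  moreover have "Cmp Pos (Cmp Pos g h) (c i) = c i" if i: "i \<in> Ob I" for i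
    by (rule hom_Pos_eqI[OF Cmp_Pos_in[OF cocone_hom[OF xc i] Cmp_Pos_in[OF h(1) g(1)]] cocone_hom[OF xc i]])
      (simp add: Cmp_Pos_apply[OF cocone_hom[OF xc i]] Cmp_Pos_apply[OF h(1)]
        hom_Pos_mem[OF cocone_hom[OF xc i]] hc gq i)
  moreover have "Cmp Pos (Idn Pos X) (c i) = c i" if i: "i \<in> Ob I" for i
    by (rule hom_Pos_eqI[OF Cmp_Pos_in[OF cocone_hom[OF xc i] Idn_Pos_in[OF Xo]] cocone_hom[OF xc i]])
      (simp add: Cmp_Pos_apply[OF cocone_hom[OF xc i]] hom_Pos_mem[OF cocone_hom[OF xc i]] Idn_Pos_apply)
  ultimately have gh: "Cmp Pos g h = Idn Pos X"
    using Cmp_Pos_in[OF h(1) g(1)] Idn_Pos_in[OF Xo] by blast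
  have "\<exists>i\<in>Ob I. \<exists>a\<in>Field (on_ob D i). x = fn (c i) a" if x: "x \<in> Field X" for x
  proof -
    obtain i a where ia: "i \<in> Ob I" "a \<in> Field (on_ob D i)" "fn h x = fn (q i) a"
      using concrete_colimit_surj[OF Q hom_Pos_mem[OF h(1) x]] by metis
    have "x = fn g (fn h x)"
      using gh Cmp_Pos_apply[OF h(1) x, of g] Idn_Pos_apply[OF x] by simp
    with ia gq show ?thesis by auto
  qed
  moreover have "\<exists>k\<in>Ob I. \<exists>u\<in>hom I i k. \<exists>v\<in>hom I j k.
           (fn (on_ar D u) a, fn (on_ar D v) b) \<in> on_ob D k"
    if ij: "i \<in> Ob I" "j \<in> Ob I" "a \<in> Field (on_ob D i)" "b \<in> Field (on_ob D j)"
      "(fn (c i) a, fn (c j) b) \<in> X" for i j a b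
    using concrete_colimit_le[OF Q ij(1-4)] hom_Pos_le[OF h(1) ij(5)] ij hc by (metis (no_types, lifting))
  ultimately show ?thesis unfolding concrete_colimit_def using xc by blast
qed

text \<open>A single later stage serves finitely many inequalities: one more inequality yields two parallel
maps into a later stage, and these are coequalised.\<close>

lemma reflect_finite:
  assumes c: "concrete_colimit I D X c" and k: "k \<in> Ob I"
    and "finite R" "R \<subseteq> Field (on_ob D k) \<times> Field (on_ob D k)"
      "\<forall>(a, b)\<in>R. (fn (c k) a, fn (c k) b) \<in> X"
  shows "\<exists>l\<in>Ob I. \<exists>w\<in>hom I k l. \<forall>(a, b)\<in>R. (fn (on_ar D w) a, fn (on_ar D w) b) \<in> on_ob D l"
  using assms(3-5)
proof (induction R)
  case empty
  then show ?case using k idn_in[OF k] by blast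
next
  case (insert p R)
  obtain a b where p: "p = (a, b)" by (cases p)
  note ab = insert.prems[unfolded p, simplified]
  obtain l w where w: "w \<in> hom I k l" "\<forall>(a, b)\<in>R. (fn (on_ar D w) a, fn (on_ar D w) b) \<in> on_ob D l"
    using insert.IH insert.prems by auto
  have l: "l \<in> Ob I" by (rule hom_ob[OF w(1)])
  have mem: "fn (on_ar D w) a \<in> Field (on_ob D l)" "fn (on_ar D w) b \<in> Field (on_ob D l)"
    using D_mem[OF w(1)] ab by auto
  have "(fn (c l) (fn (on_ar D w) a), fn (c l) (fn (on_ar D w) b)) \<in> X"
    using ab cocone_app[OF concrete_colimit_cocone[OF c] w(1)] by simp
  from concrete_colimit_le[OF c l l mem this] obtain m u v where uv: "u \<in> hom I l m" "v \<in> hom I l m"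
    "(fn (on_ar D u) (fn (on_ar D w) a), fn (on_ar D v) (fn (on_ar D w) b)) \<in> on_ob D m" by blast
  obtain n z where z: "n \<in> Ob I" "z \<in> hom I m n" "Cmp I z u = Cmp I z v"
    using coequalise[OF uv(1,2)] by blast
  define y where "y = Cmp I (Cmp I z u) w"
  have zu: "Cmp I z u \<in> hom I l n" by (rule comp_in[OF uv(1) z(2)])
  have y: "y \<in> hom I k n" unfolding y_def by (rule comp_in[OF w(1) zu])
  have "(fn (on_ar D y) a', fn (on_ar D y) b') \<in> on_ob D n" if "(a', b') \<in> R" for a' b'
  proof -
    have m': "a' \<in> Field (on_ob D k)" "b' \<in> Field (on_ob D k)" using that insert.prems by auto
    have "(fn (on_ar D w) a', fn (on_ar D w) b') \<in> on_ob D l" using w(2) that by auto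
    from D_le[OF zu this] show ?thesis
      unfolding y_def by (simp add: D_comp[OF w(1) zu] m')
  qed
  moreover have "(fn (on_ar D y) a, fn (on_ar D y) b) \<in> on_ob D n"
    using D_le[OF z(2) uv(3)] unfolding y_def
    by (simp add: D_comp[OF w(1) zu] ab D_comp[OF uv(1) z(2) mem(1)])
      (simp add: z(3) D_comp[OF uv(2) z(2) mem(2)])
  ultimately show ?case using z(1) y p by auto
qed

text \<open>Finite posets are finitely presentable: the finitely many values come from one stage, and the
finitely many inequalities between them hold at a later one.\<close>

lemma factor_finite:
  assumes c: "concrete_colimit I D X c" and \<Gamma>: "\<Gamma> \<in> Ob Pos" "finite (Field \<Gamma>)"
    and f: "f \<in> monotone_maps \<Gamma> X"
  obtains k g where "k \<in> Ob I" "g \<in> monotone_maps \<Gamma> (on_ob D k)"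
    "\<And>x. x \<in> Field \<Gamma> \<Longrightarrow> f x = fn (c k) (g x)"
proof -
  note cc = concrete_colimit_cocone[OF c]
  have "\<forall>x\<in>Field \<Gamma>. \<exists>i a. i \<in> Ob I \<and> a \<in> Field (on_ob D i) \<and> f x = fn (c i) a"
    using concrete_colimit_surj[OF c monotone_maps_mem[OF f]] by metis
  then obtain i a where ia: "\<And>x. x \<in> Field \<Gamma> \<Longrightarrow> i x \<in> Ob I"
      "\<And>x. x \<in> Field \<Gamma> \<Longrightarrow> a x \<in> Field (on_ob D (i x))"
      "\<And>x. x \<in> Field \<Gamma> \<Longrightarrow> f x = fn (c (i x)) (a x)" by metis
  obtain j where j: "j \<in> Ob I" "\<forall>x\<in>Field \<Gamma>. hom I (i x) j \<noteq> {}"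
    using finite_upper_bound[of "i ` Field \<Gamma>"] \<Gamma>(2) ia(1) by auto
  then have "\<forall>x\<in>Field \<Gamma>. \<exists>u. u \<in> hom I (i x) j" by blast
  then obtain u where u: "\<And>x. x \<in> Field \<Gamma> \<Longrightarrow> u x \<in> hom I (i x) j" by metis
  define b where "b x = fn (on_ar D (u x)) (a x)" for x
  have b: "b x \<in> Field (on_ob D j)" "fn (c j) (b x) = f x" if "x \<in> Field \<Gamma>" for x
    using D_mem[OF u[OF that] ia(2)[OF that]] cocone_app[OF cc u[OF that] ia(2)[OF that]] ia(3)[OF that]
    by (simp_all add: b_def)
  have fin: "finite \<Gamma>"
    by (rule finite_subset[of _ "Field \<Gamma> \<times> Field \<Gamma>"]) (use \<Gamma>(2) in \<open>auto intro: FieldI1 FieldI2\<close>)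
  have "\<exists>l\<in>Ob I. \<exists>w\<in>hom I j l. \<forall>(p, q)\<in>map_prod b b ` \<Gamma>.
      (fn (on_ar D w) p, fn (on_ar D w) q) \<in> on_ob D l"
  proof (rule reflect_finite[OF c j(1)])
    show "finite (map_prod b b ` \<Gamma>)" using fin by simp
    show "map_prod b b ` \<Gamma> \<subseteq> Field (on_ob D j) \<times> Field (on_ob D j)"
      using b(1) by (auto intro: FieldI1 FieldI2)
    show "\<forall>(p, q)\<in>map_prod b b ` \<Gamma>. (fn (c j) p, fn (c j) q) \<in> X"
      using b(2) monotone_maps_le[OF f] by (auto simp: FieldI1 FieldI2)
  qed
  then obtain l w where l: "l \<in> Ob I" and w: "w \<in> hom I j l"
    and le: "\<And>x y. (x, y) \<in> \<Gamma> \<Longrightarrow> (fn (on_ar D w) (b x), fn (on_ar D w) (b y)) \<in> on_ob D l" by fastforce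
  show ?thesis
  proof (rule that[OF l, of "\<lambda>x\<in>Field \<Gamma>. fn (on_ar D w) (b x)"])
    show "(\<lambda>x\<in>Field \<Gamma>. fn (on_ar D w) (b x)) \<in> monotone_maps \<Gamma> (on_ob D l)"
      by (rule monotone_maps_restrictI) (auto intro: D_mem[OF w] b le)
    show "f x = fn (c l) ((\<lambda>x\<in>Field \<Gamma>. fn (on_ar D w) (b x)) x)" if "x \<in> Field \<Gamma>" for x
      using that b[OF that] cocone_app[OF cc w] by simp
  qed
qed

lemma factor_finite_le:
  assumes c: "concrete_colimit I D X c" and \<Gamma>: "finite (Field \<Gamma>)"
    and k: "i \<in> Ob I" "j \<in> Ob I"
    and f: "f \<in> monotone_maps \<Gamma> (on_ob D i)" and g: "g \<in> monotone_maps \<Gamma> (on_ob D j)"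
    and le: "\<And>x. x \<in> Field \<Gamma> \<Longrightarrow> (fn (c i) (f x), fn (c j) (g x)) \<in> X"
  obtains k u v where "k \<in> Ob I" "u \<in> hom I i k" "v \<in> hom I j k"
    "\<And>x. x \<in> Field \<Gamma> \<Longrightarrow> (fn (on_ar D u) (f x), fn (on_ar D v) (g x)) \<in> on_ob D k"
proof -
  note cc = concrete_colimit_cocone[OF c]
  obtain l u v where l: "l \<in> Ob I" and u: "u \<in> hom I i l" and v: "v \<in> hom I j l"
    using upper_bound[OF k] by blast
  let ?R = "(\<lambda>x. (fn (on_ar D u) (f x), fn (on_ar D v) (g x))) ` Field \<Gamma>"
  have "\<exists>m\<in>Ob I. \<exists>w\<in>hom I l m. \<forall>(p, q)\<in>?R. (fn (on_ar D w) p, fn (on_ar D w) q) \<in> on_ob D m"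
  proof (rule reflect_finite[OF c l])
    show "finite ?R" using \<Gamma> by simp
    show "?R \<subseteq> Field (on_ob D l) \<times> Field (on_ob D l)"
      using D_mem[OF u monotone_maps_mem[OF f]] D_mem[OF v monotone_maps_mem[OF g]] by auto
    show "\<forall>(p, q)\<in>?R. (fn (c l) p, fn (c l) q) \<in> X"
      using le by (auto simp: cocone_app[OF cc u] cocone_app[OF cc v] monotone_maps_mem[OF f]
          monotone_maps_mem[OF g])
  qed
  then obtain m w where m: "m \<in> Ob I" and w: "w \<in> hom I l m" and wle: "\<And>x. x \<in> Field \<Gamma> \<Longrightarrow>
      (fn (on_ar D w) (fn (on_ar D u) (f x)), fn (on_ar D w) (fn (on_ar D v) (g x))) \<in> on_ob D m"
    by auto
  show ?thesis
    by (rule that[OF m comp_in[OF u w] comp_in[OF v w]])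
      (simp add: D_comp[OF u w] D_comp[OF v w] monotone_maps_mem[OF f] monotone_maps_mem[OF g] wle)
qed

end

section \<open>Models of a variety\<close>

definition models :: "'u rel set \<Rightarrow> 'u signature \<Rightarrow> 'u inequation set \<Rightarrow> 'u algebra set" where
  "models P S E = {A. coherent_algebra P S A \<and> (\<forall>e\<in>E. satisfies A e)}"

lemma models_coherent: "A \<in> models P S E \<Longrightarrow> coherent_algebra P S A"
  by (simp add: models_def)

lemma coherent_poset: "coherent_algebra P S A \<Longrightarrow> poset A \<in> Ob Pos"
  by (simp add: coherent_algebra_def)

lemma models_poset: "A \<in> models P S E \<Longrightarrow> poset A \<in> Ob Pos"
  by (rule coherent_poset[OF models_coherent])

lemma oper_mem:
  "\<lbrakk>coherent_algebra P S A; \<Delta> \<in> P; \<sigma> \<in> S \<Delta>; f \<in> monotone_maps \<Delta> (poset A)\<rbrakk>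
    \<Longrightarrow> oper A \<Delta> \<sigma> f \<in> Field (poset A)"
  by (simp add: coherent_algebra_def)

lemma oper_le:
  "\<lbrakk>coherent_algebra P S A; \<Delta> \<in> P; \<sigma> \<in> S \<Delta>; f \<in> monotone_maps \<Delta> (poset A);
    g \<in> monotone_maps \<Delta> (poset A); \<And>i. i \<in> Field \<Delta> \<Longrightarrow> (f i, g i) \<in> poset A\<rbrakk>
    \<Longrightarrow> (oper A \<Delta> \<sigma> f, oper A \<Delta> \<sigma> g) \<in> poset A"
  by (simp add: coherent_algebra_def pointwise_le_def)

lemma homomorphism_monotone: "h \<in> homomorphisms P S A B \<Longrightarrow> h \<in> monotone_maps (poset A) (poset B)"
  by (simp add: homomorphisms_def)

lemma homomorphism_oper:
  "\<lbrakk>h \<in> homomorphisms P S A B; \<Delta> \<in> P; \<sigma> \<in> S \<Delta>; f \<in> monotone_maps \<Delta> (poset A)\<rbrakk>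
    \<Longrightarrow> h (oper A \<Delta> \<sigma> f) = oper B \<Delta> \<sigma> (compose (Field \<Delta>) h f)"
  by (simp add: homomorphisms_def)

lemmas homomorphism_mem = monotone_maps_mem[OF homomorphism_monotone]
lemmas homomorphism_le = monotone_maps_le[OF homomorphism_monotone]

lemma compose_assoc_monotone:
  "f \<in> monotone_maps X Y \<Longrightarrow>
    compose (Field X) (compose (Field Y) h g) f = compose (Field X) h (compose (Field X) g f)"
  by (auto simp: compose_def fun_eq_iff restrict_def monotone_maps_mem)

lemma homomorphism_compose:
  assumes h: "h \<in> homomorphisms P S A B" and k: "k \<in> homomorphisms P S B C"
    and A: "coherent_algebra P S A"
  shows "compose (Field (poset A)) k h \<in> homomorphisms P S A C"
  unfolding homomorphisms_def
proof (intro CollectI conjI ballI)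
  show "compose (Field (poset A)) k h \<in> monotone_maps (poset A) (poset C)"
    by (rule monotone_maps_compose[OF homomorphism_monotone[OF h] homomorphism_monotone[OF k]])
  fix \<Gamma> \<sigma> f assume *: "\<Gamma> \<in> P" "\<sigma> \<in> S \<Gamma>" "f \<in> monotone_maps \<Gamma> (poset A)"
  show "compose (Field (poset A)) k h (oper A \<Gamma> \<sigma> f) =
      oper C \<Gamma> \<sigma> (compose (Field \<Gamma>) (compose (Field (poset A)) k h) f)"
    using oper_mem[OF A *] homomorphism_oper[OF h *]
      homomorphism_oper[OF k *(1,2) monotone_maps_compose[OF *(3) homomorphism_monotone[OF h]]]
      compose_assoc_monotone[OF *(3), of k h] by simp
qed

lemma homomorphism_id:
  assumes "coherent_algebra P S A"
  shows "(\<lambda>x\<in>Field (poset A). x) \<in> homomorphisms P S A A"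
  unfolding homomorphisms_def
proof (intro CollectI conjI ballI)
  show "(\<lambda>x\<in>Field (poset A). x) \<in> monotone_maps (poset A) (poset A)"
    by (rule monotone_maps_restrictI)
  fix \<Gamma> \<sigma> f assume *: "\<Gamma> \<in> P" "\<sigma> \<in> S \<Gamma>" "f \<in> monotone_maps \<Gamma> (poset A)"
  have "compose (Field \<Gamma>) (\<lambda>x\<in>Field (poset A). x) f = f"
    by (rule monotone_maps_eqI[OF monotone_maps_compose[OF *(3)] *(3)])
      (auto intro!: monotone_maps_restrictI simp: monotone_maps_mem[OF *(3)])
  then show "(\<lambda>x\<in>Field (poset A). x) (oper A \<Gamma> \<sigma> f) =
      oper A \<Gamma> \<sigma> (compose (Field \<Gamma>) (\<lambda>x\<in>Field (poset A). x) f)"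
    using oper_mem[OF assms *] by simp
qed

lemma homomorphism_eqI:
  "\<lbrakk>h \<in> homomorphisms P S A B; k \<in> homomorphisms P S A C; \<And>x. x \<in> Field (poset A) \<Longrightarrow> h x = k x\<rbrakk>
    \<Longrightarrow> h = k"
  by (rule monotone_maps_eqI[OF homomorphism_monotone homomorphism_monotone])

lemma Ob_variety: "Ob (variety P S E) = models P S E"
  by (auto simp: variety_def full_subcat_def Alg_def models_def)

lemma variety_sel [simp]:
  "Dom (variety P S E) = src" "Cod (variety P S E) = tgt"
  by (simp_all add: variety_def full_subcat_def Alg_def)

lemma hom_variety:
  "h \<in> hom (variety P S E) A B \<longleftrightarrow>
    A \<in> models P S E \<and> B \<in> models P S E \<and> src h = A \<and> tgt h = B \<and> fn h \<in> homomorphisms P S A B"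
  by (auto simp: hom_def variety_def full_subcat_def Alg_def models_def)

lemma Ar_variety: "h \<in> Ar (variety P S E) \<longleftrightarrow> h \<in> hom (variety P S E) (src h) (tgt h)"
  by (simp add: hom_variety) (auto simp: variety_def full_subcat_def Alg_def models_def)

lemma Cmp_variety:
  "Cmp (variety P S E) k h = Arrow (src h) (tgt k) (compose (Field (poset (src h))) (fn k) (fn h))"
  by (simp add: variety_def full_subcat_def Alg_def)

lemma Idn_variety: "Idn (variety P S E) A = Arrow A A (\<lambda>x\<in>Field (poset A). x)"
  by (simp add: variety_def full_subcat_def Alg_def)

lemma variety_eqI:
  "\<lbrakk>h \<in> hom (variety P S E) A B; k \<in> hom (variety P S E) A B;
    \<And>x. x \<in> Field (poset A) \<Longrightarrow> fn h x = fn k x\<rbrakk> \<Longrightarrow> h = k"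
  by (auto simp: hom_variety intro!: arrow.expand intro: homomorphism_eqI)

lemma Cmp_variety_in:
  "h \<in> hom (variety P S E) A B \<Longrightarrow> k \<in> hom (variety P S E) B C \<Longrightarrow> Cmp (variety P S E) k h \<in> hom (variety P S E) A C"
  by (auto simp: hom_variety Cmp_variety intro: homomorphism_compose models_coherent)

lemma Cmp_variety_apply:
  "h \<in> hom (variety P S E) A B \<Longrightarrow> x \<in> Field (poset A) \<Longrightarrow> fn (Cmp (variety P S E) k h) x = fn k (fn h x)"
  by (auto simp: hom_variety Cmp_variety)

lemma Idn_variety_in: "A \<in> models P S E \<Longrightarrow> Idn (variety P S E) A \<in> hom (variety P S E) A A"
  by (auto simp: hom_variety Idn_variety intro: homomorphism_id models_coherent)

lemma hom_variety_mem: "h \<in> hom (variety P S E) A B \<Longrightarrow> x \<in> Field (poset A) \<Longrightarrow> fn h x \<in> Field (poset B)"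
  by (auto simp: hom_variety intro: homomorphism_mem)

lemma forget_hom: "h \<in> hom (variety P S E) A B \<Longrightarrow> on_ar forget h \<in> hom Pos (poset A) (poset B)"
  by (auto simp: hom_variety hom_Pos forget_def intro: models_poset homomorphism_monotone)

lemma forget_fn [simp]: "fn (on_ar forget h) = fn h" "on_ob forget = poset"
  by (simp_all add: forget_def)

lemma forget_functor: "is_functor (variety P S E) Pos forget"
  unfolding is_functor_def
proof (intro conjI ballI impI)
  let ?V = "variety P S E"
  fix f assume f: "f \<in> Ar ?V"
  then show "on_ar forget f \<in> hom Pos (on_ob forget (Dom ?V f)) (on_ob forget (Cod ?V f))"
    unfolding Ar_variety by (simp add: forget_hom)
  fix g assume g: "g \<in> Ar ?V" "Cod ?V f = Dom ?V g"
  then show "on_ar forget (Cmp ?V g f) = Cmp Pos (on_ar forget g) (on_ar forget f)"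
    by (simp add: forget_def Cmp_variety) (simp add: Pos_def)
next
  fix A assume "A \<in> Ob (variety P S E)"
  then show "on_ar forget (Idn (variety P S E) A) = Idn Pos (on_ob forget A)"
    by (simp add: forget_def Idn_variety) (simp add: Pos_def)
qed (auto simp: Ob_variety models_poset)

section \<open>Evaluation of terms\<close>

locale signature =
  fixes P :: "'u rel set" and S :: "'u signature"
  assumes U: "universe TYPE('u)"
    and contexts: "contexts P"
    and signature: "is_signature P S"
begin

lemma context_Ob: "\<Delta> \<in> P \<Longrightarrow> \<Delta> \<in> Ob Pos"
  and context_finite: "\<Delta> \<in> P \<Longrightarrow> finite (Field \<Delta>)"
  using contexts by (auto simp: contexts_def)

text \<open>Homomorphisms are monotone, so they preserve the order conditions under which a term is defined.\<close>

lemma evaluate_hom: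
  assumes h: "h \<in> homomorphisms P S A B" and A: "coherent_algebra P S A"
    and f: "f \<in> monotone_maps \<Gamma> (poset A)" and t: "t \<in> terms P S \<Gamma>"
    and "evaluate A f t = Some a"
  shows "a \<in> Field (poset A) \<and> evaluate B (compose (Field \<Gamma>) h f) t = Some (h a)"
  using t assms(5)
proof (induction arbitrary: a)
  case (var x)
  then show ?case using monotone_maps_mem[OF f] by auto
next
  case (op \<Delta> \<sigma> g)
  let ?v = "\<lambda>i. the (evaluate A f (g i))"
  have def: "evaluate A f (g i) = Some (?v i)" if "i \<in> Field \<Delta>" for i
    using op.prems that by (auto split: if_splits)
  have le: "(?v i, ?v j) \<in> poset A" if "(i, j) \<in> \<Delta>" for i j
    using op.prems that by (auto split: if_splits)
  have a: "a = oper A \<Delta> \<sigma> (restrict ?v (Field \<Delta>))"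
    using op.prems by (auto split: if_splits)
  have IH: "?v i \<in> Field (poset A)" "evaluate B (compose (Field \<Gamma>) h f) (g i) = Some (h (?v i))"
    if "i \<in> Field \<Delta>" for i
    using op.IH def that by auto
  have mm: "restrict ?v (Field \<Delta>) \<in> monotone_maps \<Delta> (poset A)"
    using IH(1) le by (rule monotone_maps_restrictI)
  have "evaluate B (compose (Field \<Gamma>) h f) (Op \<Delta> \<sigma> g) =
      Some (oper B \<Delta> \<sigma> (\<lambda>i\<in>Field \<Delta>. the (evaluate B (compose (Field \<Gamma>) h f) (g i))))"
    using IH(2) homomorphism_le[OF h le] by (auto simp: FieldI1 FieldI2)
  also have "(\<lambda>i\<in>Field \<Delta>. the (evaluate B (compose (Field \<Gamma>) h f) (g i))) =
      compose (Field \<Delta>) h (restrict ?v (Field \<Delta>))"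
    using IH(2) by (auto simp: compose_def fun_eq_iff restrict_def)
  also have "oper B \<Delta> \<sigma> \<dots> = h a"
    unfolding a using homomorphism_oper[OF h op.hyps(1,2) mm] by simp
  finally show ?case using a oper_mem[OF A op.hyps(1,2) mm] by simp
qed

text \<open>Definedness of a term is a conjunction of inequalities between values of its subterms.\<close>

lemma evaluate_reflect:
  assumes A: "coherent_algebra P S A"
    and H: "\<And>B h. (B, h) \<in> H \<Longrightarrow> h \<in> homomorphisms P S A B"
    and reflect: "\<And>a b. \<lbrakk>a \<in> Field (poset A); b \<in> Field (poset A);
      \<And>B h. (B, h) \<in> H \<Longrightarrow> (h a, h b) \<in> poset B\<rbrakk> \<Longrightarrow> (a, b) \<in> poset A"
    and f: "f \<in> monotone_maps \<Gamma> (poset A)" and t: "t \<in> terms P S \<Gamma>"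
    and "\<And>B h. (B, h) \<in> H \<Longrightarrow> evaluate B (compose (Field \<Gamma>) h f) t \<noteq> None"
  shows "evaluate A f t \<noteq> None"
  using t assms(6)
proof induction
  case (var x)
  then show ?case by simp
next
  case (op \<Delta> \<sigma> g)
  let ?v = "\<lambda>i. the (evaluate A f (g i))"
  have def: "evaluate A f (g i) = Some (?v i)" if "i \<in> Field \<Delta>" for i
  proof -
    have "evaluate B (compose (Field \<Gamma>) h f) (g i) \<noteq> None" if "(B, h) \<in> H" for B h
      using op.prems[OF that] \<open>i \<in> Field \<Delta>\<close> by (auto split: if_splits)
    then show ?thesis using op.IH that by auto
  qed
  have "(?v i, ?v j) \<in> poset A" if ij: "(i, j) \<in> \<Delta>" for i j
  proof -
    have F: "i \<in> Field \<Delta>" "j \<in> Field \<Delta>" using ij by (auto intro: FieldI1 FieldI2)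
    show ?thesis
    proof (rule reflect)
      fix B h assume Bh: "(B, h) \<in> H"
      have "evaluate B (compose (Field \<Gamma>) h f) (g k) = Some (h (?v k))" if "k \<in> Field \<Delta>" for k
        using evaluate_hom[OF H[OF Bh] A f _ def[OF that]] op.IH that by blast
      moreover have "(the (evaluate B (compose (Field \<Gamma>) h f) (g i)),
          the (evaluate B (compose (Field \<Gamma>) h f) (g j))) \<in> poset B"
        using op.prems[OF Bh] ij by (auto split: if_splits)
      ultimately show "(h (?v i), h (?v j)) \<in> poset B" using F by simp
    next
      show "?v i \<in> Field (poset A)" "?v j \<in> Field (poset A)"
        using evaluate_hom[OF homomorphism_id[OF A] A f _ def[OF F(1)]]
          evaluate_hom[OF homomorphism_id[OF A] A f _ def[OF F(2)]] op.IH F by auto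
    qed
  qed
  then show ?case using def by auto
qed

end

locale coherent_variety = signature P S
  for P :: "'u rel set" and S :: "'u signature" +
  fixes E :: "'u inequation set"
  assumes inequations: "E \<subseteq> inequations P S"
begin

text \<open>The criterion by which a subalgebra of a product of models is a model: apply it to the projections.\<close>

lemma models_reflect:
  assumes A: "coherent_algebra P S A"
    and H: "\<And>B h. (B, h) \<in> H \<Longrightarrow> h \<in> homomorphisms P S A B \<and> B \<in> models P S E"
    and reflect: "\<And>a b. \<lbrakk>a \<in> Field (poset A); b \<in> Field (poset A);
      \<And>B h. (B, h) \<in> H \<Longrightarrow> (h a, h b) \<in> poset B\<rbrakk> \<Longrightarrow> (a, b) \<in> poset A"
  shows "A \<in> models P S E"
proof -
  have "satisfies A (\<Gamma>, s, t)" if e: "(\<Gamma>, s, t) \<in> E" for \<Gamma> s t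
    unfolding satisfies.simps
  proof
    have st: "s \<in> terms P S \<Gamma>" "t \<in> terms P S \<Gamma>" using e inequations by (auto simp: inequations_def)
    fix f assume f: "f \<in> monotone_maps \<Gamma> (poset A)"
    have B: "\<exists>a b. evaluate B (compose (Field \<Gamma>) h f) s = Some a \<and>
        evaluate B (compose (Field \<Gamma>) h f) t = Some b \<and> (a, b) \<in> poset B" if "(B, h) \<in> H" for B h
    proof -
      have "satisfies B (\<Gamma>, s, t)" using H[OF that] e by (auto simp: models_def)
      moreover have "compose (Field \<Gamma>) h f \<in> monotone_maps \<Gamma> (poset B)"
        using H[OF that] f homomorphism_monotone by (blast intro: monotone_maps_compose)
      ultimately show ?thesis by auto
    qed
    have "evaluate A f s \<noteq> None"
    proof (rule evaluate_reflect[OF A _ _ f st(1), of H])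
      show "evaluate B (compose (Field \<Gamma>) h f) s \<noteq> None" if "(B, h) \<in> H" for B h using B[OF that] by auto
    qed (use H reflect in auto)
    moreover have "evaluate A f t \<noteq> None"
    proof (rule evaluate_reflect[OF A _ _ f st(2), of H])
      show "evaluate B (compose (Field \<Gamma>) h f) t \<noteq> None" if "(B, h) \<in> H" for B h using B[OF that] by auto
    qed (use H reflect in auto)
    ultimately obtain a b where ab: "evaluate A f s = Some a" "evaluate A f t = Some b" by auto
    note idh = homomorphism_id[OF A]
    have "(a, b) \<in> poset A"
    proof (rule reflect)
      show "a \<in> Field (poset A)" "b \<in> Field (poset A)"
        using evaluate_hom[OF idh A f st(1) ab(1)] evaluate_hom[OF idh A f st(2) ab(2)] by auto
      show "(h a, h b) \<in> poset B" if "(B, h) \<in> H" for B h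
        using B[OF that] H[OF that] evaluate_hom[OF _ A f st(1) ab(1), of h B]
          evaluate_hom[OF _ A f st(2) ab(2), of h B] by auto
    qed
    with ab show "\<exists>a b. evaluate A f s = Some a \<and> evaluate A f t = Some b \<and> (a, b) \<in> poset A" by blast
  qed
  with A show ?thesis by (auto simp: models_def)
qed

text \<open>An inequation concerns one assignment of its context at a time, so it holds in \<open>A\<close> once every
assignment lifts along a homomorphism from a model.\<close>

lemma models_factor:
  assumes A: "coherent_algebra P S A"
    and factor: "\<And>\<Gamma> f. \<lbrakk>\<Gamma> \<in> P; f \<in> monotone_maps \<Gamma> (poset A)\<rbrakk> \<Longrightarrow>
      \<exists>B h g. B \<in> models P S E \<and> h \<in> homomorphisms P S B A \<and> g \<in> monotone_maps \<Gamma> (poset B) \<and>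
        f = compose (Field \<Gamma>) h g"
  shows "A \<in> models P S E"
proof -
  have "satisfies A (\<Gamma>, s, t)" if e: "(\<Gamma>, s, t) \<in> E" for \<Gamma> s t
    unfolding satisfies.simps
  proof
    have st: "\<Gamma> \<in> P" "s \<in> terms P S \<Gamma>" "t \<in> terms P S \<Gamma>" using e inequations by (auto simp: inequations_def)
    fix f assume f: "f \<in> monotone_maps \<Gamma> (poset A)"
    obtain B h g where B: "B \<in> models P S E" "h \<in> homomorphisms P S B A"
      "g \<in> monotone_maps \<Gamma> (poset B)" "f = compose (Field \<Gamma>) h g"
      using factor[OF st(1) f] by blast
    have "satisfies B (\<Gamma>, s, t)" using B(1) e by (auto simp: models_def)
    then obtain a b where ab: "evaluate B g s = Some a" "evaluate B g t = Some b" "(a, b) \<in> poset B"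
      using B(3) by auto
    note Bc = models_coherent[OF B(1)]
    show "\<exists>a b. evaluate A f s = Some a \<and> evaluate A f t = Some b \<and> (a, b) \<in> poset A"
      using evaluate_hom[OF B(2) Bc B(3) st(2) ab(1)] evaluate_hom[OF B(2) Bc B(3) st(3) ab(2)]
        homomorphism_le[OF B(2) ab(3)] B(4) by auto
  qed
  with A show ?thesis by (auto simp: models_def)
qed

end

section \<open>Free algebras\<close>

definition free_algebra ::
  "'u rel set \<Rightarrow> 'u signature \<Rightarrow> 'u inequation set \<Rightarrow> 'u rel \<Rightarrow> 'u algebra \<Rightarrow> ('u \<Rightarrow> 'u) \<Rightarrow> bool" where
  "free_algebra P S E X A e \<longleftrightarrow>
     A \<in> models P S E \<and> e \<in> monotone_maps X (poset A) \<and>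
     (\<forall>B\<in>models P S E. \<forall>f\<in>monotone_maps X (poset B).
        \<exists>!h. h \<in> homomorphisms P S A B \<and> (\<forall>x\<in>Field X. h (e x) = f x))"

lemma free_algebra_model: "free_algebra P S E X A e \<Longrightarrow> A \<in> models P S E"
  and free_algebra_unit: "free_algebra P S E X A e \<Longrightarrow> e \<in> monotone_maps X (poset A)"
  by (simp_all add: free_algebra_def)

lemma free_algebra_extend:
  assumes "free_algebra P S E X A e" "B \<in> models P S E" "f \<in> monotone_maps X (poset B)"
  obtains h where "h \<in> homomorphisms P S A B" "\<And>x. x \<in> Field X \<Longrightarrow> h (e x) = f x"
  using assms unfolding free_algebra_def by blast

lemma free_algebra_unique:
  assumes "free_algebra P S E X A e" and B: "B \<in> models P S E"
    and h: "h \<in> homomorphisms P S A B" and k: "k \<in> homomorphisms P S A B"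
    and eq: "\<And>x. x \<in> Field X \<Longrightarrow> h (e x) = k (e x)"
  shows "h = k"
proof -
  have e: "e \<in> monotone_maps X (poset A)" using assms(1) by (rule free_algebra_unit)
  have "compose (Field X) h e \<in> monotone_maps X (poset B)"
    by (rule monotone_maps_compose[OF e homomorphism_monotone[OF h]])
  then have "\<exists>!g. g \<in> homomorphisms P S A B \<and> (\<forall>x\<in>Field X. g (e x) = compose (Field X) h e x)"
    using assms(1) B unfolding free_algebra_def by blast
  then show ?thesis using h k eq by auto
qed

definition algebra_generated :: "'u rel set \<Rightarrow> 'u signature \<Rightarrow> 'u rel \<Rightarrow> 'u algebra \<Rightarrow> ('u \<Rightarrow> 'u) \<Rightarrow> bool" where
  "algebra_generated P S X A e \<longleftrightarrow>
     (\<forall>Z. (\<forall>x\<in>Field X. e x \<in> Z) \<and>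
          (\<forall>\<Delta>\<in>P. \<forall>\<sigma>\<in>S \<Delta>. \<forall>f\<in>monotone_maps \<Delta> (poset A).
             (\<forall>i\<in>Field \<Delta>. f i \<in> Z) \<longrightarrow> oper A \<Delta> \<sigma> f \<in> Z) \<longrightarrow>
          Field (poset A) \<subseteq> Z)"

text \<open>The part, generated by the projections, of the product of the algebras \<open>fst j\<close> over \<open>j \<in> J\<close>. For
\<open>J\<close> the set of all monotone maps from \<open>X\<close> to models, two elements of this part coincide exactly if
the terms that build them have equal values in every model under every monotone assignment of \<open>X\<close>.\<close>

inductive_set generated ::
  "'u rel set \<Rightarrow> 'u signature \<Rightarrow> ('u algebra \<times> ('u \<Rightarrow> 'u)) set \<Rightarrow> 'u rel \<Rightarrow>
     ('u algebra \<times> ('u \<Rightarrow> 'u) \<Rightarrow> 'u) set"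
  for P :: "'u rel set" and S :: "'u signature"
    and J :: "('u algebra \<times> ('u \<Rightarrow> 'u)) set" and X :: "'u rel" where
  gen: "x \<in> Field X \<Longrightarrow> (\<lambda>j\<in>J. snd j x) \<in> generated P S J X"
| op: "\<Delta> \<in> P \<Longrightarrow> \<sigma> \<in> S \<Delta> \<Longrightarrow> (\<forall>i\<in>Field \<Delta>. g i \<in> generated P S J X) \<Longrightarrow> g \<in> extensional (Field \<Delta>)
    \<Longrightarrow> (\<forall>i k. (i, k) \<in> \<Delta> \<longrightarrow> (\<forall>j\<in>J. (g i j, g k j) \<in> poset (fst j)))
    \<Longrightarrow> (\<lambda>j\<in>J. oper (fst j) \<Delta> \<sigma> (\<lambda>i\<in>Field \<Delta>. g i j)) \<in> generated P S J X"

context signature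
begin

text \<open>Each stage adds one layer of operations. Since arities are finite, countably many stages exhaust the
generated subalgebra.\<close>

lemma few_generated:
  assumes X: "X \<in> Ob Pos"
  shows "few TYPE('u) (generated P S J X)"
proof (rule few_subset)
  define step where "step Y = Y \<union> (\<Union>(\<Delta>, \<sigma>)\<in>(SIGMA \<Delta>:P. S \<Delta>).
    (\<lambda>g. \<lambda>j\<in>J. oper (fst j) \<Delta> \<sigma> (\<lambda>i\<in>Field \<Delta>. g i j)) ` (Field \<Delta> \<rightarrow>\<^sub>E Y))"
    for Y :: "('u algebra \<times> ('u \<Rightarrow> 'u) \<Rightarrow> 'u) set"
  define stage where "stage n = (step ^^ n) ((\<lambda>x. \<lambda>j\<in>J. snd j x) ` Field X)" for n
  have stage_Suc: "stage (Suc n) = step (stage n)" for n by (simp add: stage_def)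
  have few_sig: "few TYPE('u) (SIGMA \<Delta>:P. S \<Delta>)"
    using signature by (intro few_Sigma few_contexts U contexts) (simp add: is_signature_def small_iff_few)
  have few_Un: "few TYPE('u) (A \<union> B)" if A: "few TYPE('u) A" and B: "few TYPE('u) B" for A B :: "'z set"
  proof -
    have "few TYPE('u) (\<Union>b\<in>{True, False}. if b then A else B)"
      by (rule few_UN[OF U few_countable[OF U]]) (use A B in auto)
    moreover have "(\<Union>b\<in>{True, False}. if b then A else B) = A \<union> B" by auto
    ultimately show ?thesis by metis
  qed
  have few_step: "few TYPE('u) (step Y)" if Y: "few TYPE('u) Y" for Y
    unfolding step_def
  proof (rule few_Un[OF Y], rule few_UN[OF U few_sig])
    fix p assume "p \<in> (SIGMA \<Delta>:P. S \<Delta>)"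
    then obtain \<Delta> \<sigma> where p: "p = (\<Delta>, \<sigma>)" "\<Delta> \<in> P" by auto
    have "few TYPE('u) (Field \<Delta> \<rightarrow>\<^sub>E Y)"
      by (rule few_PiE[OF U context_finite[OF p(2)] Y])
    then show "few TYPE('u) (case p of (\<Delta>, \<sigma>) \<Rightarrow>
      (\<lambda>g. \<lambda>j\<in>J. oper (fst j) \<Delta> \<sigma> (\<lambda>i\<in>Field \<Delta>. g i j)) ` (Field \<Delta> \<rightarrow>\<^sub>E Y))"
      unfolding p(1) prod.case by (rule few_image)
  qed
  have "few TYPE('u) (stage n)" for n
  proof (induction n)
    case 0
    have "few TYPE('u) (Field X)" using X by (simp add: Ob_Pos small_iff_few)
    then show ?case by (simp add: stage_def few_image)
  next
    case (Suc n)
    then show ?case unfolding stage_Suc by (rule few_step)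
  qed
  then show "few TYPE('u) (\<Union>n. stage n)"
    by (intro few_UN[OF U few_countable[OF U]]) auto
  have mono: "stage m \<subseteq> stage n" if "m \<le> n" for m n
    by (rule lift_Suc_mono_le[OF _ that]) (simp add: stage_Suc step_def)
  show "generated P S J X \<subseteq> (\<Union>n. stage n)"
  proof
    fix p assume "p \<in> generated P S J X"
    then show "p \<in> (\<Union>n. stage n)"
    proof induction
      case (gen x)
      then have "(\<lambda>j\<in>J. snd j x) \<in> stage 0" by (simp add: stage_def)
      then show ?case by blast
    next
      case (op \<Delta> \<sigma> g)
      then have "\<forall>i\<in>Field \<Delta>. \<exists>n. g i \<in> stage n" by blast
      then obtain n where n: "\<And>i. i \<in> Field \<Delta> \<Longrightarrow> g i \<in> stage (n i)" by metis
      define N where "N = Max (insert 0 (n ` Field \<Delta>))"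
      have "n i \<le> N" if "i \<in> Field \<Delta>" for i
        unfolding N_def using context_finite[OF op.hyps(1)] that by (intro Max_ge) auto
      then have "g i \<in> stage N" if "i \<in> Field \<Delta>" for i using n[OF that] mono that by blast
      then have "g \<in> Field \<Delta> \<rightarrow>\<^sub>E stage N" using op.hyps(3) by (simp add: PiE_iff)
      then have "(\<lambda>j\<in>J. oper (fst j) \<Delta> \<sigma> (\<lambda>i\<in>Field \<Delta>. g i j)) \<in> stage (Suc N)"
        unfolding stage_Suc step_def using op.hyps(1,2) by (intro UnI2 UN_I[of "(\<Delta>, \<sigma>)"]) auto
      then show ?case by blast
    qed
  qed
qed

end

context coherent_variety
begin

text \<open>The extension of \<open>f : X \<rightarrow> B\<close> to the generated subalgebra is the projection with index \<open>(B, f)\<close>. The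
projections jointly reflect the order, so \<open>models_reflect\<close> applies.\<close>

lemma free_algebra_exists:
  assumes X: "X \<in> Ob Pos"
  shows "\<exists>A e. free_algebra P S E X A e \<and> algebra_generated P S X A e"
proof -
  define J where "J = {j. fst j \<in> models P S E \<and> snd j \<in> monotone_maps X (poset (fst j))}"
  define W where "W = generated P S J X"
  define R where "R p q \<longleftrightarrow> (\<forall>j\<in>J. (p j, q j) \<in> poset (fst j))" for p q :: "'u algebra \<times> ('u \<Rightarrow> 'u) \<Rightarrow> 'u"
  have Jm: "fst j \<in> models P S E" "coherent_algebra P S (fst j)" "poset (fst j) \<in> Ob Pos"
    "snd j \<in> monotone_maps X (poset (fst j))" if "j \<in> J" for j
    using that models_coherent models_poset by (auto simp: J_def)
  have Wm: "(\<forall>j\<in>J. p j \<in> Field (poset (fst j))) \<and> p \<in> extensional J" if "p \<in> W" for p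
    using that unfolding W_def
  proof induction
    case (gen x)
    then show ?case using Jm(4) monotone_maps_mem by fastforce
  next
    case (op \<Delta> \<sigma> g)
    have "oper (fst j) \<Delta> \<sigma> (\<lambda>i\<in>Field \<Delta>. g i j) \<in> Field (poset (fst j))" if j: "j \<in> J" for j
      using op.hyps op.IH j by (intro oper_mem[OF Jm(2)[OF j]] monotone_maps_restrictI) auto
    then show ?case by (simp add: extensional_def)
  qed
  have refl: "R p p" if "p \<in> W" for p
    unfolding R_def using Wm[OF that] Pos_refl[OF Jm(3)] by blast
  have trans: "R p r" if "R p q" "R q r" for p q r
    using that Pos_trans[OF Jm(3)] unfolding R_def by blast
  have antisym: "p = q" if "p \<in> W" "q \<in> W" "R p q" "R q p" for p q
    using that Wm Pos_antisym[OF Jm(3)] unfolding R_def by (intro extensionalityI[of p J q]) auto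
  have few: "few TYPE('u) W" unfolding W_def by (rule few_generated[OF X])
  obtain Q :: "'u rel" and \<pi> where Q: "Q \<in> Ob Pos" "Field Q = \<pi> ` W"
    and le: "\<And>p q. p \<in> W \<Longrightarrow> q \<in> W \<Longrightarrow> (\<pi> p, \<pi> q) \<in> Q \<longleftrightarrow> R p q"
    by (rule preorder_to_poset[where W = W and R = R, OF few]) (erule refl, erule (1) trans, rule U, rule that)
  have inj: "inj_on \<pi> W"
  proof (rule inj_onI)
    fix p q assume pq: "p \<in> W" "q \<in> W" "\<pi> p = \<pi> q"
    then have "(\<pi> p, \<pi> q) \<in> Q" "(\<pi> q, \<pi> p) \<in> Q" using le[of p p] refl by auto
    then show "p = q" using le pq antisym by blast
  qed
  define \<rho> where "\<rho> = inv_into W \<pi>"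
  have \<rho>\<pi>: "\<rho> (\<pi> p) = p" if "p \<in> W" for p unfolding \<rho>_def by (rule inv_into_f_f[OF inj that])
  have \<rho>: "\<rho> y \<in> W" "\<pi> (\<rho> y) = y" if "y \<in> Field Q" for y
    using that by (auto simp: Q(2) \<rho>\<pi>)
  have \<rho>_le: "(\<rho> x j, \<rho> y j) \<in> poset (fst j)" if "(x, y) \<in> Q" "j \<in> J" for x y j
  proof -
    have "x \<in> Field Q" "y \<in> Field Q" using that by (auto intro: FieldI1 FieldI2)
    then show ?thesis using le[of "\<rho> x" "\<rho> y"] that \<rho> unfolding R_def by auto
  qed
  define val where "val \<Delta> \<sigma> f = (\<lambda>j\<in>J. oper (fst j) \<Delta> \<sigma> (\<lambda>i\<in>Field \<Delta>. \<rho> (f i) j))" for \<Delta> \<sigma> f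
  define A where "A = \<lparr>poset = Q, oper = (\<lambda>\<Delta> \<sigma> f.
    if \<Delta> \<in> P \<and> \<sigma> \<in> S \<Delta> \<and> f \<in> monotone_maps \<Delta> Q then \<pi> (val \<Delta> \<sigma> f) else undefined)\<rparr>"
  have A: "poset A = Q" by (simp add: A_def)
  have opA: "oper A \<Delta> \<sigma> f = \<pi> (val \<Delta> \<sigma> f)" if "\<Delta> \<in> P" "\<sigma> \<in> S \<Delta>" "f \<in> monotone_maps \<Delta> Q" for \<Delta> \<sigma> f
    using that by (simp add: A_def)
  have comp_mm: "(\<lambda>i\<in>Field \<Delta>. \<rho> (f i) j) \<in> monotone_maps \<Delta> (poset (fst j))"
    if "f \<in> monotone_maps \<Delta> Q" "j \<in> J" for \<Delta> f j
    using that Wm \<rho>(1) \<rho>_le by (intro monotone_maps_restrictI) (blast dest: monotone_maps_mem monotone_maps_le)+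
  have val_W: "val \<Delta> \<sigma> f \<in> W" if f: "\<Delta> \<in> P" "\<sigma> \<in> S \<Delta>" "f \<in> monotone_maps \<Delta> Q" for \<Delta> \<sigma> f
  proof -
    let ?g = "\<lambda>i\<in>Field \<Delta>. \<rho> (f i)"
    have "(\<lambda>j\<in>J. oper (fst j) \<Delta> \<sigma> (\<lambda>i\<in>Field \<Delta>. ?g i j)) \<in> W"
      unfolding W_def
    proof (rule generated.op[where \<Delta> = \<Delta> and \<sigma> = \<sigma> and g = ?g])
      show "\<forall>i\<in>Field \<Delta>. ?g i \<in> generated P S J X"
        using \<rho>(1) monotone_maps_mem[OF f(3)] by (simp add: W_def)
      show "\<forall>i k. (i, k) \<in> \<Delta> \<longrightarrow> (\<forall>j\<in>J. (?g i j, ?g k j) \<in> poset (fst j))"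
        using \<rho>_le monotone_maps_le[OF f(3)] by (auto simp: FieldI1 FieldI2)
    qed (use f in simp_all)
    moreover have "(\<lambda>i\<in>Field \<Delta>. ?g i j) = (\<lambda>i\<in>Field \<Delta>. \<rho> (f i) j)" for j by (rule ext) simp
    ultimately show ?thesis unfolding val_def by simp
  qed
  have coh: "coherent_algebra P S A"
    unfolding coherent_algebra_def A
  proof (intro conjI ballI allI impI)
    fix \<Delta> \<sigma> f assume f: "\<Delta> \<in> P" "\<sigma> \<in> S \<Delta>" "f \<in> monotone_maps \<Delta> Q"
    show "oper A \<Delta> \<sigma> f \<in> Field Q" using val_W[OF f] by (simp add: opA[OF f] Q(2))
    fix g assume g: "g \<in> monotone_maps \<Delta> Q" "pointwise_le \<Delta> Q f g"
    have "R (val \<Delta> \<sigma> f) (val \<Delta> \<sigma> g)"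
      unfolding R_def
    proof
      fix j assume j: "j \<in> J"
      have "(oper (fst j) \<Delta> \<sigma> (\<lambda>i\<in>Field \<Delta>. \<rho> (f i) j), oper (fst j) \<Delta> \<sigma> (\<lambda>i\<in>Field \<Delta>. \<rho> (g i) j)) \<in> poset (fst j)"
        using g(2) \<rho>_le[OF _ j] by (intro oper_le[OF Jm(2)[OF j] f(1,2)] comp_mm[OF f(3) j] comp_mm[OF g(1) j])
          (simp add: pointwise_le_def)
      then show "(val \<Delta> \<sigma> f j, val \<Delta> \<sigma> g j) \<in> poset (fst j)" using j by (simp add: val_def)
    qed
    then show "(oper A \<Delta> \<sigma> f, oper A \<Delta> \<sigma> g) \<in> Q"
      by (simp add: opA[OF f] opA[OF f(1,2) g(1)] le val_W[OF f] val_W[OF f(1,2) g(1)])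
  qed (use Q in \<open>auto simp: A_def\<close>)
  define pr where "pr j = (\<lambda>y\<in>Field Q. \<rho> y j)" for j
  have pr: "pr j \<in> homomorphisms P S A (fst j)" if j: "j \<in> J" for j
    unfolding homomorphisms_def A
  proof (intro CollectI conjI ballI)
    show "pr j \<in> monotone_maps Q (poset (fst j))"
      unfolding pr_def using \<rho>(1) Wm j \<rho>_le[OF _ j] by (intro monotone_maps_restrictI) auto
    fix \<Delta> \<sigma> f assume f: "\<Delta> \<in> P" "\<sigma> \<in> S \<Delta>" "f \<in> monotone_maps \<Delta> Q"
    have "compose (Field \<Delta>) (pr j) f = (\<lambda>i\<in>Field \<Delta>. \<rho> (f i) j)"
      using monotone_maps_mem[OF f(3)] by (auto simp: compose_def pr_def fun_eq_iff restrict_def)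
    then show "pr j (oper A \<Delta> \<sigma> f) = oper (fst j) \<Delta> \<sigma> (compose (Field \<Delta>) (pr j) f)"
      using val_W[OF f] j by (simp add: opA[OF f] pr_def Q(2) \<rho>\<pi>) (simp add: val_def)
  qed
  have mod: "A \<in> models P S E"
  proof (rule models_reflect[OF coh, where H = "{(fst j, pr j) | j. j \<in> J}"])
    show "h \<in> homomorphisms P S A B \<and> B \<in> models P S E" if "(B, h) \<in> {(fst j, pr j) | j. j \<in> J}" for B h
      using that pr Jm by auto
    fix a b assume ab: "a \<in> Field (poset A)" "b \<in> Field (poset A)"
      "\<And>B h. (B, h) \<in> {(fst j, pr j) | j. j \<in> J} \<Longrightarrow> (h a, h b) \<in> poset B"
    then have "R (\<rho> a) (\<rho> b)" unfolding R_def A by (force simp: pr_def)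
    then show "(a, b) \<in> poset A"
      using le[of "\<rho> a" "\<rho> b"] \<rho> ab(1,2) unfolding A by simp
  qed
  define e where "e = (\<lambda>x\<in>Field X. \<pi> (\<lambda>j\<in>J. snd j x))"
  have gW: "(\<lambda>j\<in>J. snd j x) \<in> W" if "x \<in> Field X" for x
    unfolding W_def by (rule generated.gen[OF that])
  have e: "e \<in> monotone_maps X (poset A)"
    unfolding A e_def
  proof (rule monotone_maps_restrictI)
    show "\<pi> (\<lambda>j\<in>J. snd j x) \<in> Field Q" if "x \<in> Field X" for x using gW[OF that] by (simp add: Q(2))
    show "(\<pi> (\<lambda>j\<in>J. snd j x), \<pi> (\<lambda>j\<in>J. snd j y)) \<in> Q" if xy: "(x, y) \<in> X" for x y
      using monotone_maps_le[OF Jm(4) xy] xy by (subst le) (auto simp: R_def intro: gW FieldI1 FieldI2)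
  qed
  have gen: "algebra_generated P S X A e"
    unfolding algebra_generated_def
  proof (intro allI impI)
    fix Z
    assume Z: "(\<forall>x\<in>Field X. e x \<in> Z) \<and> (\<forall>\<Delta>\<in>P. \<forall>\<sigma>\<in>S \<Delta>. \<forall>f\<in>monotone_maps \<Delta> (poset A).
      (\<forall>i\<in>Field \<Delta>. f i \<in> Z) \<longrightarrow> oper A \<Delta> \<sigma> f \<in> Z)"
    have "\<pi> p \<in> Z" if "p \<in> W" for p
      using that unfolding W_def
    proof induction
      case (gen x)
      then have "e x = \<pi> (\<lambda>j\<in>J. snd j x)" "e x \<in> Z" using Z by (auto simp: e_def)
      then show ?case by (simp only:)
    next
      case (op \<Delta> \<sigma> g)
      let ?f = "\<lambda>i\<in>Field \<Delta>. \<pi> (g i)"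
      have gW: "g i \<in> W" if "i \<in> Field \<Delta>" for i using op.hyps(3) op.IH that by (auto simp: W_def)
      have f: "?f \<in> monotone_maps \<Delta> (poset A)"
        unfolding A
      proof (rule monotone_maps_restrictI)
        show "\<pi> (g i) \<in> Field Q" if "i \<in> Field \<Delta>" for i using gW[OF that] by (simp add: Q(2))
        show "(\<pi> (g i), \<pi> (g k)) \<in> Q" if ik: "(i, k) \<in> \<Delta>" for i k
          using op.hyps ik by (subst le) (auto simp: R_def intro: gW FieldI1 FieldI2)
      qed
      have "oper A \<Delta> \<sigma> ?f \<in> Z" using Z f op.hyps(1,2) op.IH by auto
      moreover have "(\<lambda>i\<in>Field \<Delta>. \<rho> (?f i) j) = (\<lambda>i\<in>Field \<Delta>. g i j)" for j
        using gW by (auto simp: fun_eq_iff restrict_def \<rho>\<pi>)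
      then have "oper A \<Delta> \<sigma> ?f = \<pi> (\<lambda>j\<in>J. oper (fst j) \<Delta> \<sigma> (\<lambda>i\<in>Field \<Delta>. g i j))"
        using opA[OF op.hyps(1,2), of ?f] f by (simp add: A val_def)
      ultimately show ?case by (simp only:)
    qed
    then show "Field (poset A) \<subseteq> Z" unfolding A Q(2) by blast
  qed
  have "free_algebra P S E X A e"
    unfolding free_algebra_def
  proof (intro conjI ballI mod e)
    fix B f assume B: "B \<in> models P S E" and f: "f \<in> monotone_maps X (poset B)"
    have j: "(B, f) \<in> J" using B f by (simp add: J_def)
    show "\<exists>!h. h \<in> homomorphisms P S A B \<and> (\<forall>x\<in>Field X. h (e x) = f x)"
    proof (rule ex1I[of _ "pr (B, f)"])
      have "pr (B, f) (e x) = f x" if x: "x \<in> Field X" for x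
        using x gW[OF x] j by (simp add: pr_def e_def Q(2) \<rho>\<pi>)
      then show "pr (B, f) \<in> homomorphisms P S A B \<and> (\<forall>x\<in>Field X. pr (B, f) (e x) = f x)"
        using pr[OF j] by simp
      fix h assume h: "h \<in> homomorphisms P S A B \<and> (\<forall>x\<in>Field X. h (e x) = f x)"
      have p: "pr (B, f) \<in> homomorphisms P S A B" using pr[OF j] by simp
      let ?Z = "{y. h y = pr (B, f) y}"
      have "Field (poset A) \<subseteq> ?Z"
      proof (rule gen[unfolded algebra_generated_def, rule_format], intro conjI ballI impI)
        show "e x \<in> ?Z" if "x \<in> Field X" for x
          using h \<open>\<And>x. x \<in> Field X \<Longrightarrow> pr (B, f) (e x) = f x\<close> that by simp
        fix \<Delta> \<sigma> g assume g: "\<Delta> \<in> P" "\<sigma> \<in> S \<Delta>" "g \<in> monotone_maps \<Delta> (poset A)" "\<forall>i\<in>Field \<Delta>. g i \<in> ?Z"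
        then have "compose (Field \<Delta>) h g = compose (Field \<Delta>) (pr (B, f)) g"
          by (auto simp: compose_def fun_eq_iff restrict_def)
        then show "oper A \<Delta> \<sigma> g \<in> ?Z"
          using homomorphism_oper[OF conjunct1[OF h] g(1-3)] homomorphism_oper[OF p g(1-3)] by simp
      qed
      then show "h = pr (B, f)"
        by (intro homomorphism_eqI[OF conjunct1[OF h] p]) auto
    qed
  qed
  with gen show ?thesis by blast
qed

text \<open>Generation is invariant under isomorphism, so it holds for every free algebra.\<close>

lemma free_algebra_induct:
  assumes X: "X \<in> Ob Pos" and A: "free_algebra P S E X A e"
    and gen: "\<And>x. x \<in> Field X \<Longrightarrow> e x \<in> Z"
    and op: "\<And>\<Delta> \<sigma> f. \<lbrakk>\<Delta> \<in> P; \<sigma> \<in> S \<Delta>; f \<in> monotone_maps \<Delta> (poset A); \<And>i. i \<in> Field \<Delta> \<Longrightarrow> f i \<in> Z\<rbrakk>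
      \<Longrightarrow> oper A \<Delta> \<sigma> f \<in> Z"
    and a: "a \<in> Field (poset A)"
  shows "a \<in> Z"
proof -
  obtain F d where F: "free_algebra P S E X F d" and gF: "algebra_generated P S X F d"
    using free_algebra_exists[OF X] by blast
  note Am = free_algebra_model[OF A] and Fm = free_algebra_model[OF F]
  obtain h where h: "h \<in> homomorphisms P S F A" "\<And>x. x \<in> Field X \<Longrightarrow> h (d x) = e x"
    using free_algebra_extend[OF F Am free_algebra_unit[OF A]] by blast
  obtain k where k: "k \<in> homomorphisms P S A F" "\<And>x. x \<in> Field X \<Longrightarrow> k (e x) = d x"
    using free_algebra_extend[OF A Fm free_algebra_unit[OF F]] by blast
  have "compose (Field (poset A)) h k = (\<lambda>x\<in>Field (poset A). x)"
  proof (rule free_algebra_unique[OF A Am])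
    show "compose (Field (poset A)) h k \<in> homomorphisms P S A A"
      by (rule homomorphism_compose[OF k(1) h(1) models_coherent[OF Am]])
    show "(\<lambda>x\<in>Field (poset A). x) \<in> homomorphisms P S A A"
      by (rule homomorphism_id[OF models_coherent[OF Am]])
    show "compose (Field (poset A)) h k (e x) = (\<lambda>x\<in>Field (poset A). x) (e x)" if "x \<in> Field X" for x
      using that h k monotone_maps_mem[OF free_algebra_unit[OF A] that] by simp
  qed
  from fun_cong[OF this, of a] have ha: "h (k a) = a" using a by simp
  have "Field (poset F) \<subseteq> {y. h y \<in> Z}"
  proof (rule gF[unfolded algebra_generated_def, rule_format], intro conjI ballI impI)
    show "d x \<in> {y. h y \<in> Z}" if "x \<in> Field X" for x using h(2)[OF that] gen[OF that] by simp
    fix \<Delta> \<sigma> f assume f: "\<Delta> \<in> P" "\<sigma> \<in> S \<Delta>" "f \<in> monotone_maps \<Delta> (poset F)"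
      "\<forall>i\<in>Field \<Delta>. f i \<in> {y. h y \<in> Z}"
    then show "oper F \<Delta> \<sigma> f \<in> {y. h y \<in> Z}"
      using op[OF f(1,2) monotone_maps_compose[OF f(3) homomorphism_monotone[OF h(1)]]]
        homomorphism_oper[OF h(1) f(1-3)] by simp
  qed
  then show ?thesis using homomorphism_mem[OF k(1) a] ha by auto
qed

end

section \<open>The monad of free algebras\<close>

text \<open>Adjunctions are used only through this elementwise description: free algebras \<open>F X\<close> together with
the requirement that the action on maps and the multiplication are homomorphisms with the expected
values on generators. Equations between such maps are proved by comparing values on generators.\<close>

locale free_monad = coherent_variety P S E
  for P :: "'u rel set" and S :: "'u signature" and E :: "'u inequation set" +
  fixes M :: "'u pos_monad" and F :: "'u rel \<Rightarrow> 'u algebra"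
  assumes free: "X \<in> Ob Pos \<Longrightarrow> free_algebra P S E X (F X) (fn (unit M X))"
    and on_ob: "X \<in> Ob Pos \<Longrightarrow> on_ob (mfun M) X = poset (F X)"
    and unit_hom: "X \<in> Ob Pos \<Longrightarrow> unit M X \<in> hom Pos X (poset (F X))"
    and map_hom: "f \<in> hom Pos X Y \<Longrightarrow> on_ar (mfun M) f \<in> hom Pos (poset (F X)) (poset (F Y))"
    and map_homomorphism: "f \<in> hom Pos X Y \<Longrightarrow> fn (on_ar (mfun M) f) \<in> homomorphisms P S (F X) (F Y)"
    and map_unit: "f \<in> hom Pos X Y \<Longrightarrow> x \<in> Field X \<Longrightarrow>
      fn (on_ar (mfun M) f) (fn (unit M X) x) = fn (unit M Y) (fn f x)"
    and mult_hom: "X \<in> Ob Pos \<Longrightarrow> mult M X \<in> hom Pos (poset (F (poset (F X)))) (poset (F X))"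
    and mult_homomorphism: "X \<in> Ob Pos \<Longrightarrow> fn (mult M X) \<in> homomorphisms P S (F (poset (F X))) (F X)"
    and mult_unit: "X \<in> Ob Pos \<Longrightarrow> y \<in> Field (poset (F X)) \<Longrightarrow>
      fn (mult M X) (fn (unit M (poset (F X))) y) = y"
begin

lemma F_model: "X \<in> Ob Pos \<Longrightarrow> F X \<in> models P S E"
  using free free_algebra_model by blast

lemma F_coherent: "X \<in> Ob Pos \<Longrightarrow> coherent_algebra P S (F X)"
  using F_model models_coherent by blast

lemma F_Ob: "X \<in> Ob Pos \<Longrightarrow> poset (F X) \<in> Ob Pos"
  using F_model models_poset by blast

lemma hom_ext:
  assumes "X \<in> Ob Pos" "B \<in> models P S E" "h \<in> homomorphisms P S (F X) B" "k \<in> homomorphisms P S (F X) B"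
    and "\<And>x. x \<in> Field X \<Longrightarrow> h (fn (unit M X) x) = k (fn (unit M X) x)"
  shows "h = k"
  using free_algebra_unique[OF free[OF assms(1)] assms(2-5)] by blast

lemma unit_mem: "X \<in> Ob Pos \<Longrightarrow> x \<in> Field X \<Longrightarrow> fn (unit M X) x \<in> Field (poset (F X))"
  by (rule hom_Pos_mem[OF unit_hom])

lemma arrow_ext:
  assumes "X \<in> Ob Pos" "B \<in> models P S E" "h \<in> hom Pos (poset (F X)) (poset B)" "k \<in> hom Pos (poset (F X)) (poset B)"
    "fn h \<in> homomorphisms P S (F X) B" "fn k \<in> homomorphisms P S (F X) B"
    and "\<And>x. x \<in> Field X \<Longrightarrow> fn h (fn (unit M X) x) = fn k (fn (unit M X) x)"
  shows "h = k"
  using hom_ext[OF assms(1,2,5,6,7)] by (intro hom_Pos_eqI[OF assms(3,4)]) simp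

lemma Cmp_homomorphism:
  assumes "h \<in> hom Pos (poset A) (poset B)" "fn h \<in> homomorphisms P S A B" "fn k \<in> homomorphisms P S B C"
    "coherent_algebra P S A"
  shows "fn (Cmp Pos k h) \<in> homomorphisms P S A C"
  using homomorphism_compose[OF assms(2-4)] by (simp add: fn_Cmp_Pos[OF assms(1)])

lemma Idn_homomorphism: "coherent_algebra P S A \<Longrightarrow> fn (Idn Pos (poset A)) \<in> homomorphisms P S A A"
  using homomorphism_id by (simp add: Pos_def)

text \<open>Naturality of the unit and the first unit law hold by assumption on elements; every other law
equates two homomorphisms out of a free algebra that agree on generators.\<close>

lemma is_monad: "is_monad Pos M"
proof -
  let ?T = "mfun M"
  have ar: "f \<in> hom Pos (src f) (tgt f)" "src f \<in> Ob Pos" "tgt f \<in> Ob Pos" if "f \<in> Ar Pos" for f :: "'u pos_arrow"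
    using that unfolding Ar_Pos by (auto simp: hom_Pos)
  have functorial: "is_functor Pos Pos ?T"
    unfolding is_functor_def Pos_sel
  proof (intro conjI ballI impI)
    fix X :: "'u rel" assume X: "X \<in> Ob Pos"
    show "on_ob ?T X \<in> Ob Pos" using X by (simp add: on_ob F_Ob)
    show "on_ar ?T (Idn Pos X) = Idn Pos (on_ob ?T X)"
      unfolding on_ob[OF X]
    proof (rule arrow_ext[OF X F_model[OF X] map_hom[OF Idn_Pos_in[OF X]] Idn_Pos_in[OF F_Ob[OF X]]
          map_homomorphism[OF Idn_Pos_in[OF X]] Idn_homomorphism[OF F_coherent[OF X]]])
      show "fn (on_ar ?T (Idn Pos X)) (fn (unit M X) x) = fn (Idn Pos (poset (F X))) (fn (unit M X) x)"
        if x: "x \<in> Field X" for x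
        by (simp add: map_unit[OF Idn_Pos_in[OF X] x] Idn_Pos_apply[OF x] Idn_Pos_apply[OF unit_mem[OF X x]])
    qed
  next
    fix f :: "'u pos_arrow" assume f: "f \<in> Ar Pos"
    note f' = ar[OF f]
    show "on_ar ?T f \<in> hom Pos (on_ob ?T (src f)) (on_ob ?T (tgt f))"
      using map_hom[OF f'(1)] f' by (simp add: on_ob)
    fix g :: "'u pos_arrow" assume g: "g \<in> Ar Pos" "tgt f = src g"
    note g' = ar[OF g(1), folded g(2)]
    show "on_ar ?T (Cmp Pos g f) = Cmp Pos (on_ar ?T g) (on_ar ?T f)"
    proof (rule arrow_ext[OF f'(2) F_model[OF g'(3)]])
      note gf = Cmp_Pos_in[OF f'(1) g'(1)]
      show "on_ar ?T (Cmp Pos g f) \<in> hom Pos (poset (F (src f))) (poset (F (tgt g)))" by (rule map_hom[OF gf])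
      show "Cmp Pos (on_ar ?T g) (on_ar ?T f) \<in> hom Pos (poset (F (src f))) (poset (F (tgt g)))"
        by (rule Cmp_Pos_in[OF map_hom[OF f'(1)] map_hom[OF g'(1)]])
      show "fn (on_ar ?T (Cmp Pos g f)) \<in> homomorphisms P S (F (src f)) (F (tgt g))"
        by (rule map_homomorphism[OF gf])
      show "fn (Cmp Pos (on_ar ?T g) (on_ar ?T f)) \<in> homomorphisms P S (F (src f)) (F (tgt g))"
        by (rule Cmp_homomorphism[OF map_hom[OF f'(1)] map_homomorphism[OF f'(1)] map_homomorphism[OF g'(1)]
              F_coherent[OF f'(2)]])
      fix x assume x: "x \<in> Field (src f)"
      show "fn (on_ar ?T (Cmp Pos g f)) (fn (unit M (src f)) x) =
          fn (Cmp Pos (on_ar ?T g) (on_ar ?T f)) (fn (unit M (src f)) x)"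
        by (simp add: map_unit[OF gf x] Cmp_Pos_apply[OF f'(1) x] map_unit[OF f'(1) x]
            Cmp_Pos_apply[OF map_hom[OF f'(1)] unit_mem[OF f'(2) x]]
            map_unit[OF g'(1) hom_Pos_mem[OF f'(1) x]])
    qed
  qed
  have unit: "nat_trans Pos Pos id_func ?T (unit M)"
    unfolding nat_trans_def id_func_def func.simps Pos_sel
  proof (intro conjI ballI)
    show "unit M X \<in> hom Pos X (on_ob ?T X)" if "X \<in> Ob Pos" for X
      using that by (simp add: on_ob unit_hom)
    fix f :: "'u pos_arrow" assume f: "f \<in> Ar Pos"
    note f' = ar[OF f]
    show "Cmp Pos (unit M (tgt f)) f = Cmp Pos (on_ar ?T f) (unit M (src f))"
      by (rule hom_Pos_eqI[OF Cmp_Pos_in[OF f'(1) unit_hom[OF f'(3)]] Cmp_Pos_in[OF unit_hom[OF f'(2)] map_hom[OF f'(1)]]])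
        (simp add: Cmp_Pos_apply[OF f'(1)] Cmp_Pos_apply[OF unit_hom[OF f'(2)]] map_unit[OF f'(1)])
  qed
  have mult: "nat_trans Pos Pos (comp_func ?T ?T) ?T (mult M)"
    unfolding nat_trans_def comp_func_def func.simps Pos_sel comp_def
  proof (intro conjI ballI)
    show "mult M X \<in> hom Pos (on_ob ?T (on_ob ?T X)) (on_ob ?T X)" if "X \<in> Ob Pos" for X
      using that by (simp add: on_ob F_Ob mult_hom)
    fix f :: "'u pos_arrow" assume f: "f \<in> Ar Pos"
    note f' = ar[OF f] and TX = F_Ob[OF ar(2)[OF f]] and TY = F_Ob[OF ar(3)[OF f]]
    note Tf = map_hom[OF f'(1)] and TTf = map_hom[OF map_hom[OF f'(1)]]
    note m = mult_hom[OF f'(2)] mult_hom[OF f'(3)]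
    show "Cmp Pos (mult M (tgt f)) (on_ar ?T (on_ar ?T f)) = Cmp Pos (on_ar ?T f) (mult M (src f))"
    proof (rule arrow_ext[OF TX F_model[OF f'(3)] Cmp_Pos_in[OF TTf m(2)] Cmp_Pos_in[OF m(1) Tf]])
      show "fn (Cmp Pos (mult M (tgt f)) (on_ar ?T (on_ar ?T f))) \<in> homomorphisms P S (F (poset (F (src f)))) (F (tgt f))"
        by (rule Cmp_homomorphism[OF TTf map_homomorphism[OF Tf] mult_homomorphism[OF f'(3)] F_coherent[OF TX]])
      show "fn (Cmp Pos (on_ar ?T f) (mult M (src f))) \<in> homomorphisms P S (F (poset (F (src f)))) (F (tgt f))"
        by (rule Cmp_homomorphism[OF m(1) mult_homomorphism[OF f'(2)] map_homomorphism[OF f'(1)] F_coherent[OF TX]])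
      fix x assume x: "x \<in> Field (poset (F (src f)))"
      show "fn (Cmp Pos (mult M (tgt f)) (on_ar ?T (on_ar ?T f))) (fn (unit M (poset (F (src f)))) x) =
          fn (Cmp Pos (on_ar ?T f) (mult M (src f))) (fn (unit M (poset (F (src f)))) x)"
        by (simp add: Cmp_Pos_apply[OF TTf unit_mem[OF TX x]] Cmp_Pos_apply[OF m(1) unit_mem[OF TX x]]
            map_unit[OF Tf x] mult_unit[OF f'(2) x] mult_unit[OF f'(3) hom_Pos_mem[OF Tf x]])
    qed
  qed
  have laws: "Cmp Pos (mult M X) (unit M (on_ob ?T X)) = Idn Pos (on_ob ?T X) \<and>
      Cmp Pos (mult M X) (on_ar ?T (unit M X)) = Idn Pos (on_ob ?T X) \<and>
      Cmp Pos (mult M X) (mult M (on_ob ?T X)) = Cmp Pos (mult M X) (on_ar ?T (mult M X))"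
    if X: "X \<in> Ob Pos" for X
    unfolding on_ob[OF X]
  proof (intro conjI)
    note TX = F_Ob[OF X] and TTX = F_Ob[OF F_Ob[OF X]]
    note u = unit_hom[OF X] and uT = unit_hom[OF TX] and m = mult_hom[OF X] and mT = mult_hom[OF TX]
    note Tu = map_hom[OF u] and Tm = map_hom[OF m]
    show "Cmp Pos (mult M X) (unit M (poset (F X))) = Idn Pos (poset (F X))"
      by (rule hom_Pos_eqI[OF Cmp_Pos_in[OF uT m] Idn_Pos_in[OF TX]])
        (simp add: Cmp_Pos_apply[OF uT] mult_unit[OF X] Idn_Pos_apply)
    show "Cmp Pos (mult M X) (on_ar ?T (unit M X)) = Idn Pos (poset (F X))"
    proof (rule arrow_ext[OF X F_model[OF X] Cmp_Pos_in[OF Tu m] Idn_Pos_in[OF TX]])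
      show "fn (Cmp Pos (mult M X) (on_ar ?T (unit M X))) \<in> homomorphisms P S (F X) (F X)"
        by (rule Cmp_homomorphism[OF Tu map_homomorphism[OF u] mult_homomorphism[OF X] F_coherent[OF X]])
      show "fn (Idn Pos (poset (F X))) \<in> homomorphisms P S (F X) (F X)"
        by (rule Idn_homomorphism[OF F_coherent[OF X]])
      show "fn (Cmp Pos (mult M X) (on_ar ?T (unit M X))) (fn (unit M X) x) =
          fn (Idn Pos (poset (F X))) (fn (unit M X) x)" if x: "x \<in> Field X" for x
        by (simp add: Cmp_Pos_apply[OF Tu unit_mem[OF X x]] map_unit[OF u x] mult_unit[OF X unit_mem[OF X x]]
            Idn_Pos_apply[OF unit_mem[OF X x]])
    qed
    show "Cmp Pos (mult M X) (mult M (poset (F X))) = Cmp Pos (mult M X) (on_ar ?T (mult M X))"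
    proof (rule arrow_ext[OF TTX F_model[OF X] Cmp_Pos_in[OF mT m] Cmp_Pos_in[OF Tm m]])
      show "fn (Cmp Pos (mult M X) (mult M (poset (F X)))) \<in> homomorphisms P S (F (poset (F (poset (F X))))) (F X)"
        by (rule Cmp_homomorphism[OF mT mult_homomorphism[OF TX] mult_homomorphism[OF X] F_coherent[OF TTX]])
      show "fn (Cmp Pos (mult M X) (on_ar ?T (mult M X))) \<in> homomorphisms P S (F (poset (F (poset (F X))))) (F X)"
        by (rule Cmp_homomorphism[OF Tm map_homomorphism[OF m] mult_homomorphism[OF X] F_coherent[OF TTX]])
      fix x assume x: "x \<in> Field (poset (F (poset (F X))))"
      show "fn (Cmp Pos (mult M X) (mult M (poset (F X)))) (fn (unit M (poset (F (poset (F X))))) x) =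
         fn (Cmp Pos (mult M X) (on_ar ?T (mult M X))) (fn (unit M (poset (F (poset (F X))))) x)"
        by (simp add: Cmp_Pos_apply[OF mT unit_mem[OF TTX x]] Cmp_Pos_apply[OF Tm unit_mem[OF TTX x]]
            mult_unit[OF TX x] map_unit[OF m x] mult_unit[OF X hom_Pos_mem[OF m x]])
    qed
  qed
  show ?thesis unfolding is_monad_def using functorial unit mult laws by blast
qed

text \<open>The elements \<open>a\<close> with \<open>T f a \<le> T g a\<close> include the generators and are closed under the operations,
because these are monotone.\<close>

lemma enriched: "enriched M"
  unfolding enriched_def
proof (intro ballI impI)
  fix X Y :: "'u rel" and f g
  assume X: "X \<in> Ob Pos" and Y: "Y \<in> Ob Pos" and f: "f \<in> hom Pos X Y" and g: "g \<in> hom Pos X Y"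
    and le: "pointwise_le X Y (fn f) (fn g)"
  let ?f = "fn (on_ar (mfun M) f)" and ?g = "fn (on_ar (mfun M) g)"
  note hf = map_homomorphism[OF f] and hg = map_homomorphism[OF g]
  have "a \<in> {a. (?f a, ?g a) \<in> poset (F Y)}" if a: "a \<in> Field (poset (F X))" for a
  proof (rule free_algebra_induct[OF X free[OF X] _ _ a])
    show "fn (unit M X) x \<in> {a. (?f a, ?g a) \<in> poset (F Y)}" if x: "x \<in> Field X" for x
      using le x hom_Pos_le[OF unit_hom[OF Y]] by (simp add: map_unit[OF f x] map_unit[OF g x] pointwise_le_def)
    fix \<Delta> \<sigma> k assume k: "\<Delta> \<in> P" "\<sigma> \<in> S \<Delta>" "k \<in> monotone_maps \<Delta> (poset (F X))"
      "\<And>i. i \<in> Field \<Delta> \<Longrightarrow> k i \<in> {a. (?f a, ?g a) \<in> poset (F Y)}"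
    then have "(oper (F Y) \<Delta> \<sigma> (compose (Field \<Delta>) ?f k), oper (F Y) \<Delta> \<sigma> (compose (Field \<Delta>) ?g k)) \<in> poset (F Y)"
      by (intro oper_le[OF F_coherent[OF Y]] monotone_maps_compose[OF k(3)] homomorphism_monotone[OF hf]
          homomorphism_monotone[OF hg]) auto
    then show "oper (F X) \<Delta> \<sigma> k \<in> {a. (?f a, ?g a) \<in> poset (F Y)}"
      by (simp add: homomorphism_oper[OF hf k(1-3)] homomorphism_oper[OF hg k(1-3)])
  qed
  then show "pointwise_le (on_ob (mfun M) X) (on_ob (mfun M) Y) ?f ?g"
    by (simp add: on_ob X Y pointwise_le_def)
qed

text \<open>The counit at an algebra extends the identity map of its poset.\<close>

definition counit :: "'u algebra \<Rightarrow> 'u \<Rightarrow> 'u" where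
  "counit A = (THE h. h \<in> homomorphisms P S (F (poset A)) A \<and>
     (\<forall>a\<in>Field (poset A). h (fn (unit M (poset A)) a) = a))"

lemma counit:
  assumes A: "A \<in> models P S E"
  shows "counit A \<in> homomorphisms P S (F (poset A)) A"
    and "a \<in> Field (poset A) \<Longrightarrow> counit A (fn (unit M (poset A)) a) = a"
proof -
  have "(\<lambda>x\<in>Field (poset A). x) \<in> monotone_maps (poset A) (poset A)"
    by (rule monotone_maps_restrictI)
  then have "\<exists>!h. h \<in> homomorphisms P S (F (poset A)) A \<and>
      (\<forall>a\<in>Field (poset A). h (fn (unit M (poset A)) a) = (\<lambda>x\<in>Field (poset A). x) a)"
    using free[OF models_poset[OF A]] A unfolding free_algebra_def by blast
  then have "\<exists>!h. h \<in> homomorphisms P S (F (poset A)) A \<and>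
      (\<forall>a\<in>Field (poset A). h (fn (unit M (poset A)) a) = a)" by simp
  from theI'[OF this] show "counit A \<in> homomorphisms P S (F (poset A)) A"
    and "a \<in> Field (poset A) \<Longrightarrow> counit A (fn (unit M (poset A)) a) = a"
    unfolding counit_def[symmetric] by auto
qed

text \<open>The adjunction built here induces a monad that coincides with \<open>M\<close> on \<open>Pos\<close>. Only its existence is
recorded, because monads described by free algebras of one variety are isomorphic to each other.\<close>

lemma free_algebra_monad_exists: "\<exists>N. free_algebra_monad (variety P S E) N"
proof -
  let ?V = "variety P S E" and ?T = "on_ar (mfun M)"
  define G :: "('u rel, 'u pos_arrow, 'u algebra, 'u alg_arrow) func" where
    "G = \<lparr>on_ob = F, on_ar = (\<lambda>f. Arrow (F (src f)) (F (tgt f)) (fn (?T f)))\<rparr>"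
  have G: "on_ob G = F" "on_ar G f = Arrow (F (src f)) (F (tgt f)) (fn (?T f))" for f
    by (simp_all add: G_def)
  have G_hom: "on_ar G f \<in> hom ?V (F X) (F Y)" if f: "f \<in> hom Pos X Y" for f X Y
    using f map_homomorphism[OF f] by (auto simp: G hom_variety F_model hom_Pos)
  have fnG: "fn (on_ar G f) = fn (?T f)" for f by (simp add: G)
  define ce where "ce A = Arrow (F (poset A)) A (counit A)" for A
  have ce_hom: "ce A \<in> hom ?V (F (poset A)) A" if A: "A \<in> models P S E" for A
    using A counit(1)[OF A] by (auto simp: ce_def hom_variety F_model models_poset)
  have V_ext: "h = k" if "X \<in> Ob Pos" "h \<in> hom ?V (F X) B" "k \<in> hom ?V (F X) B"
    "\<And>x. x \<in> Field X \<Longrightarrow> fn h (fn (unit M X) x) = fn k (fn (unit M X) x)" for h k X B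
    using that hom_ext[of X B "fn h" "fn k"] by (auto simp: hom_variety intro!: arrow.expand)
  have ar: "f \<in> hom Pos (src f) (tgt f)" "src f \<in> Ob Pos" "tgt f \<in> Ob Pos" if "f \<in> Ar Pos" for f :: "'u pos_arrow"
    using that unfolding Ar_Pos by (auto simp: hom_Pos)
  have arV: "h \<in> hom ?V (src h) (tgt h)" "src h \<in> models P S E" "tgt h \<in> models P S E" if "h \<in> Ar ?V" for h
    using that unfolding Ar_variety by (auto simp: hom_variety)
  have functorial: "is_functor Pos ?V G"
    unfolding is_functor_def Pos_sel variety_sel
  proof (intro conjI ballI impI)
    fix X :: "'u rel" assume X: "X \<in> Ob Pos"
    show "on_ob G X \<in> Ob ?V" by (simp add: G Ob_variety F_model X)
    have i: "Idn ?V (F X) \<in> hom ?V (F X) (F X)" by (rule Idn_variety_in[OF F_model[OF X]])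
    show "on_ar G (Idn Pos X) = Idn ?V (on_ob G X)"
      unfolding G(1)
    proof (rule V_ext[OF X G_hom[OF Idn_Pos_in[OF X]] i])
      fix x assume x: "x \<in> Field X"
      show "fn (on_ar G (Idn Pos X)) (fn (unit M X) x) = fn (Idn ?V (F X)) (fn (unit M X) x)"
        using map_unit[OF Idn_Pos_in[OF X] x] unit_mem[OF X x] x by (simp add: fnG Idn_variety Idn_Pos_apply)
    qed
  next
    fix f :: "'u pos_arrow" assume f: "f \<in> Ar Pos"
    note f' = ar[OF f]
    show "on_ar G f \<in> hom ?V (on_ob G (src f)) (on_ob G (tgt f))"
      unfolding G(1) by (rule G_hom[OF f'(1)])
    fix g :: "'u pos_arrow" assume g: "g \<in> Ar Pos" "tgt f = src g"
    note g' = ar[OF g(1), folded g(2)]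
    have "?T (Cmp Pos g f) = Cmp Pos (?T g) (?T f)"
      using is_monad f g unfolding is_monad_def is_functor_def by simp
    then have "fn (?T (Cmp Pos g f)) x = fn (?T g) (fn (?T f) x)" if "x \<in> Field (poset (F (src f)))" for x
      using Cmp_Pos_apply[OF map_hom[OF f'(1)] that] by simp
    then show "on_ar G (Cmp Pos g f) = Cmp ?V (on_ar G g) (on_ar G f)"
      using f'(1)
      by (intro variety_eqI[OF G_hom[OF Cmp_Pos_in[OF f'(1) g'(1)]] Cmp_variety_in[OF G_hom[OF f'(1)] G_hom[OF g'(1)]]])
        (simp add: Cmp_variety_apply[OF G_hom[OF f'(1)]] fnG)
  qed
  have nat_unit: "nat_trans Pos Pos id_func (comp_func forget G) (unit M)"
    unfolding nat_trans_def id_func_def comp_func_def func.simps Pos_sel comp_def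
  proof (intro conjI ballI)
    show "unit M X \<in> hom Pos X (on_ob forget (on_ob G X))" if "X \<in> Ob Pos" for X
      using unit_hom[OF that] by (simp add: G)
    fix f :: "'u pos_arrow" assume f: "f \<in> Ar Pos"
    note f' = ar[OF f]
    show "Cmp Pos (unit M (tgt f)) f = Cmp Pos (on_ar forget (on_ar G f)) (unit M (src f))"
      by (rule hom_Pos_eqI[OF Cmp_Pos_in[OF f'(1) unit_hom[OF f'(3)]]
            Cmp_Pos_in[OF unit_hom[OF f'(2)] forget_hom[OF G_hom[OF f'(1)]]]])
        (simp add: Cmp_Pos_apply[OF f'(1)] Cmp_Pos_apply[OF unit_hom[OF f'(2)]] fnG map_unit[OF f'(1)])
  qed
  have nat_counit: "nat_trans ?V ?V (comp_func G forget) id_func ce"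
    unfolding nat_trans_def id_func_def comp_func_def func.simps variety_sel comp_def Ob_variety
  proof (intro conjI ballI)
    show "ce A \<in> hom ?V (on_ob G (on_ob forget A)) A" if "A \<in> models P S E" for A
      using ce_hom[OF that] by (simp add: G)
    fix h assume h: "h \<in> Ar ?V"
    note h' = arV[OF h] and Gh = G_hom[OF forget_hom[OF arV(1)[OF h]]]
    note c = ce_hom[OF h'(2)] ce_hom[OF h'(3)]
    note O = models_poset[OF h'(2)] models_poset[OF h'(3)]
    show "Cmp ?V (ce (tgt h)) (on_ar G (on_ar forget h)) = Cmp ?V h (ce (src h))"
    proof (rule V_ext[OF O(1) Cmp_variety_in[OF Gh c(2)] Cmp_variety_in[OF c(1) h'(1)]])
      fix x assume x: "x \<in> Field (poset (src h))"
      show "fn (Cmp ?V (ce (tgt h)) (on_ar G (on_ar forget h))) (fn (unit M (poset (src h))) x) =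
         fn (Cmp ?V h (ce (src h))) (fn (unit M (poset (src h))) x)"
        using map_unit[OF forget_hom[OF h'(1)] x]
        by (simp add: Cmp_variety_apply[OF Gh unit_mem[OF O(1) x]] Cmp_variety_apply[OF c(1) unit_mem[OF O(1) x]] fnG)
          (simp add: ce_def counit(2)[OF h'(2) x] counit(2)[OF h'(3) hom_variety_mem[OF h'(1) x]])
    qed
  qed
  have tri1: "Cmp ?V (ce (on_ob G X)) (on_ar G (unit M X)) = Idn ?V (on_ob G X)" if X: "X \<in> Ob Pos" for X
    unfolding G(1)
  proof -
    note Gu = G_hom[OF unit_hom[OF X]] and m = F_model[OF X]
    note c = ce_hom[OF m]
    show "Cmp ?V (ce (F X)) (on_ar G (unit M X)) = Idn ?V (F X)"
    proof (rule V_ext[OF X Cmp_variety_in[OF Gu c] Idn_variety_in[OF m]])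
      show "fn (Cmp ?V (ce (F X)) (on_ar G (unit M X))) (fn (unit M X) x) = fn (Idn ?V (F X)) (fn (unit M X) x)"
        if x: "x \<in> Field X" for x
        using unit_mem[OF X x]
        by (simp add: Cmp_variety_apply[OF Gu] fnG map_unit[OF unit_hom[OF X] x])
          (simp add: ce_def counit(2)[OF m] Idn_variety)
    qed
  qed
  have tri2: "Cmp Pos (on_ar forget (ce A)) (unit M (on_ob forget A)) = Idn Pos (on_ob forget A)"
    if "A \<in> Ob ?V" for A
  proof -
    have A: "A \<in> models P S E" using that by (simp add: Ob_variety)
    note O = models_poset[OF A]
    have "Cmp Pos (on_ar forget (ce A)) (unit M (poset A)) = Idn Pos (poset A)"
      by (rule hom_Pos_eqI[OF Cmp_Pos_in[OF unit_hom[OF O] forget_hom[OF ce_hom[OF A]]] Idn_Pos_in[OF O]])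
        (simp add: Cmp_Pos_apply[OF unit_hom[OF O]] Idn_Pos_apply ce_def counit(2)[OF A])
    then show ?thesis by simp
  qed
  have "adjunction Pos ?V G forget (unit M) ce"
    unfolding adjunction_def using functorial forget_functor nat_unit nat_counit tri1 tri2 by blast
  then show ?thesis unfolding free_algebra_monad_def by blast
qed

end

context coherent_variety
begin

text \<open>The extension of \<open>f : X \<rightarrow> B\<close> is the transpose \<open>\<epsilon> B \<circ> F f\<close>. It is unique by the first triangle
identity, which recovers a homomorphism from its restriction along the unit.\<close>

lemma free_monad_of_adjunction:
  assumes "free_algebra_monad (variety P S E) M"
  shows "\<exists>F. free_monad P S E M F"
proof -
  let ?V = "variety P S E"
  obtain G \<eta> \<epsilon> where adj: "adjunction Pos ?V G forget \<eta> \<epsilon>" and M: "M = monad_of_adjunction G forget \<eta> \<epsilon>"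
    using assms unfolding free_algebra_monad_def by blast
  have sel: "unit M = \<eta>" "on_ob (mfun M) X = poset (on_ob G X)" "on_ar (mfun M) f = on_ar forget (on_ar G f)"
    "mult M X = on_ar forget (\<epsilon> (on_ob G X))" for X f
    by (simp_all add: M monad_of_adjunction_def comp_func_def)
  have G_ob: "on_ob G X \<in> models P S E" if "X \<in> Ob Pos" for X
    using adj that unfolding adjunction_def is_functor_def Ob_variety by blast
  have G_hom: "on_ar G f \<in> hom ?V (on_ob G X) (on_ob G Y)" if "f \<in> hom Pos X Y" for f X Y
    using adj that unfolding adjunction_def is_functor_def by (auto simp: hom_def)
  have G_comp: "on_ar G (Cmp Pos g f) = Cmp ?V (on_ar G g) (on_ar G f)"
    if "f \<in> hom Pos X Y" "g \<in> hom Pos Y Z" for f g X Y Z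
    using adj that unfolding adjunction_def is_functor_def by (auto simp: hom_def)
  have \<eta>: "\<eta> X \<in> hom Pos X (poset (on_ob G X))" if "X \<in> Ob Pos" for X
    using adj that unfolding adjunction_def nat_trans_def by (auto simp: id_func_def comp_func_def)
  have \<eta>_nat: "fn (on_ar G f) (fn (\<eta> X) x) = fn (\<eta> Y) (fn f x)" if f: "f \<in> hom Pos X Y" and x: "x \<in> Field X" for f X Y x
  proof -
    have X: "X \<in> Ob Pos" and s: "src f = X" "tgt f = Y" using f by (auto simp: hom_Pos)
    have "f \<in> Ar Pos" using f by (simp add: Ar_Pos s)
    then have "Cmp Pos (\<eta> Y) f = Cmp Pos (on_ar forget (on_ar G f)) (\<eta> X)"
      using adj s unfolding adjunction_def nat_trans_def by (auto simp: id_func_def comp_func_def)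
    from arg_cong[OF this, of "\<lambda>h. fn h x"] show ?thesis
      by (simp add: Cmp_Pos_apply[OF f x] Cmp_Pos_apply[OF \<eta>[OF X] x])
  qed
  have \<epsilon>: "\<epsilon> A \<in> hom ?V (on_ob G (poset A)) A" if "A \<in> models P S E" for A
    using adj that unfolding adjunction_def nat_trans_def Ob_variety by (auto simp: id_func_def comp_func_def)
  have \<epsilon>_nat: "Cmp ?V (\<epsilon> B) (on_ar G (on_ar forget h)) = Cmp ?V h (\<epsilon> A)" if h: "h \<in> hom ?V A B" for h A B
  proof -
    have s: "src h = A" "tgt h = B" using h by (auto simp: hom_variety)
    have "h \<in> Ar ?V" using h by (simp add: Ar_variety s)
    then show ?thesis
      using adj s unfolding adjunction_def nat_trans_def by (auto simp: id_func_def comp_func_def)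
  qed
  have tri1: "Cmp ?V (\<epsilon> (on_ob G X)) (on_ar G (\<eta> X)) = Idn ?V (on_ob G X)" if "X \<in> Ob Pos" for X
    using adj that unfolding adjunction_def by blast
  have tri2: "fn (\<epsilon> A) (fn (\<eta> (poset A)) a) = a" if A: "A \<in> models P S E" and a: "a \<in> Field (poset A)" for A a
  proof -
    have "Cmp Pos (on_ar forget (\<epsilon> A)) (\<eta> (poset A)) = Idn Pos (poset A)"
      using adj A unfolding adjunction_def Ob_variety by simp
    from arg_cong[OF this, of "\<lambda>h. fn h a"] show ?thesis
      by (simp add: Cmp_Pos_apply[OF \<eta>[OF models_poset[OF A]] a] Idn_Pos_apply[OF a])
  qed
  have free: "free_algebra P S E X (on_ob G X) (fn (\<eta> X))" if X: "X \<in> Ob Pos" for X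
    unfolding free_algebra_def
  proof (intro conjI ballI)
    show "on_ob G X \<in> models P S E" by (rule G_ob[OF X])
    show "fn (\<eta> X) \<in> monotone_maps X (poset (on_ob G X))" using \<eta>[OF X] by (simp add: hom_Pos)
    fix B f assume B: "B \<in> models P S E" and f: "f \<in> monotone_maps X (poset B)"
    define a where "a = Arrow X (poset B) f"
    have a: "a \<in> hom Pos X (poset B)" unfolding a_def by (rule Arrow_in_hom_Pos[OF X models_poset[OF B] f])
    define h where "h = Cmp ?V (\<epsilon> B) (on_ar G a)"
    have h: "h \<in> hom ?V (on_ob G X) B" unfolding h_def by (rule Cmp_variety_in[OF G_hom[OF a] \<epsilon>[OF B]])
    show "\<exists>!h. h \<in> homomorphisms P S (on_ob G X) B \<and> (\<forall>x\<in>Field X. h (fn (\<eta> X) x) = f x)"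
    proof (rule ex1I[of _ "fn h"])
      have "fn h (fn (\<eta> X) x) = f x" if x: "x \<in> Field X" for x
        using tri2[OF B hom_Pos_mem[OF a x]]
        by (simp add: h_def Cmp_variety_apply[OF G_hom[OF a] hom_Pos_mem[OF \<eta>[OF X] x]] \<eta>_nat[OF a x])
          (simp add: a_def)
      then show "fn h \<in> homomorphisms P S (on_ob G X) B \<and> (\<forall>x\<in>Field X. fn h (fn (\<eta> X) x) = f x)"
        using h by (simp add: hom_variety)
      fix k assume k: "k \<in> homomorphisms P S (on_ob G X) B \<and> (\<forall>x\<in>Field X. k (fn (\<eta> X) x) = f x)"
      define k' where "k' = Arrow (on_ob G X) B k"
      have k': "k' \<in> hom ?V (on_ob G X) B" using k G_ob[OF X] B by (simp add: k'_def hom_variety)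
      note Uk = forget_hom[OF k']
      have eq: "Cmp Pos (on_ar forget k') (\<eta> X) = a"
        by (rule hom_Pos_eqI[OF Cmp_Pos_in[OF \<eta>[OF X] Uk] a])
          (simp add: Cmp_Pos_apply[OF \<eta>[OF X]], simp add: k'_def a_def k)
      note e1 = \<epsilon>[OF G_ob[OF X]] and g1 = G_hom[OF \<eta>[OF X]] and g2 = G_hom[OF Uk]
      have "fn h y = k y" if y: "y \<in> Field (poset (on_ob G X))" for y
      proof -
        have "fn h y = fn (\<epsilon> B) (fn (on_ar G (Cmp Pos (on_ar forget k') (\<eta> X))) y)"
          unfolding h_def eq by (rule Cmp_variety_apply[OF G_hom[OF a] y])
        also have "\<dots> = fn (\<epsilon> B) (fn (on_ar G (on_ar forget k')) (fn (on_ar G (\<eta> X)) y))"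
          by (simp add: G_comp[OF \<eta>[OF X] Uk] Cmp_variety_apply[OF g1 y])
        also have "\<dots> = fn k' (fn (\<epsilon> (on_ob G X)) (fn (on_ar G (\<eta> X)) y))"
          using arg_cong[OF \<epsilon>_nat[OF k'], of "\<lambda>h. fn h (fn (on_ar G (\<eta> X)) y)"] hom_variety_mem[OF g1 y]
          by (simp add: Cmp_variety_apply[OF g2] Cmp_variety_apply[OF e1])
        also have "fn (\<epsilon> (on_ob G X)) (fn (on_ar G (\<eta> X)) y) = y"
          using arg_cong[OF tri1[OF X], of "\<lambda>h. fn h y"] y by (simp add: Cmp_variety_apply[OF g1 y] Idn_variety)
        finally show ?thesis by (simp add: k'_def)
      qed
      then show "k = fn h"
        using h k by (intro homomorphism_eqI[of k P S "on_ob G X" B _ B]) (auto simp: hom_variety)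
    qed
  qed
  have "free_monad P S E M (on_ob G)"
  proof (unfold_locales, unfold sel)
    fix X :: "'u rel" assume X: "X \<in> Ob Pos"
    note TX = models_poset[OF G_ob[OF X]]
    show "free_algebra P S E X (on_ob G X) (fn (\<eta> X))" by (rule free[OF X])
    show "\<eta> X \<in> hom Pos X (poset (on_ob G X))" by (rule \<eta>[OF X])
    show "on_ar forget (\<epsilon> (on_ob G X)) \<in> hom Pos (poset (on_ob G (poset (on_ob G X)))) (poset (on_ob G X))"
      by (rule forget_hom[OF \<epsilon>[OF G_ob[OF X]]])
    show "fn (on_ar forget (\<epsilon> (on_ob G X))) \<in> homomorphisms P S (on_ob G (poset (on_ob G X))) (on_ob G X)"
      using \<epsilon>[OF G_ob[OF X]] by (simp add: hom_variety)
    show "fn (on_ar forget (\<epsilon> (on_ob G X))) (fn (\<eta> (poset (on_ob G X))) y) = y"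
      if "y \<in> Field (poset (on_ob G X))" for y
      using tri2[OF G_ob[OF X] that] by simp
  next
    fix X Y :: "'u rel" and f assume f: "f \<in> hom Pos X Y"
    show "on_ar forget (on_ar G f) \<in> hom Pos (poset (on_ob G X)) (poset (on_ob G Y))"
      by (rule forget_hom[OF G_hom[OF f]])
    show "fn (on_ar forget (on_ar G f)) \<in> homomorphisms P S (on_ob G X) (on_ob G Y)"
      using G_hom[OF f] by (simp add: hom_variety)
    show "fn (on_ar forget (on_ar G f)) (fn (\<eta> X) x) = fn (\<eta> Y) (fn f x)" if "x \<in> Field X" for x
      using \<eta>_nat[OF f that] by simp
  qed (rule refl)
  then show ?thesis by blast
qed

lemma free_monad_exists: "\<exists>M F. free_monad P S E M F"
proof -
  have "\<forall>X. \<exists>A e. X \<in> Ob Pos \<longrightarrow> free_algebra P S E X A e"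
    using free_algebra_exists by blast
  then obtain F e where free: "X \<in> Ob Pos \<Longrightarrow> free_algebra P S E X (F X) (e X)" for X by metis
  have "\<forall>B f X. \<exists>h. X \<in> Ob Pos \<and> B \<in> models P S E \<and> f \<in> monotone_maps X (poset B) \<longrightarrow>
      h \<in> homomorphisms P S (F X) B \<and> (\<forall>x\<in>Field X. h (e X x) = f x)"
    using free free_algebra_extend by (metis (no_types, lifting))
  then obtain ext where ext: "\<And>B f X. X \<in> Ob Pos \<Longrightarrow> B \<in> models P S E \<Longrightarrow> f \<in> monotone_maps X (poset B) \<Longrightarrow>
      ext B f X \<in> homomorphisms P S (F X) B \<and> (\<forall>x\<in>Field X. ext B f X (e X x) = f x)" by metis
  define M :: "'u pos_monad" where "M = \<lparr>mfun = \<lparr>on_ob = (\<lambda>X. poset (F X)),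
      on_ar = (\<lambda>f. Arrow (poset (F (src f))) (poset (F (tgt f)))
        (ext (F (tgt f)) (compose (Field (src f)) (e (tgt f)) (fn f)) (src f)))\<rparr>,
    unit = (\<lambda>X. Arrow X (poset (F X)) (e X)),
    mult = (\<lambda>X. Arrow (poset (F (poset (F X)))) (poset (F X))
      (ext (F X) (\<lambda>x\<in>Field (poset (F X)). x) (poset (F X))))\<rparr>"
  have m: "F X \<in> models P S E" "poset (F X) \<in> Ob Pos" "e X \<in> monotone_maps X (poset (F X))" if "X \<in> Ob Pos" for X
    using free_algebra_model[OF free[OF that]] models_poset free_algebra_unit[OF free[OF that]] by auto
  have extf: "ext (F Y) (compose (Field X) (e Y) (fn f)) X \<in> homomorphisms P S (F X) (F Y)"
    "x \<in> Field X \<Longrightarrow> ext (F Y) (compose (Field X) (e Y) (fn f)) X (e X x) = e Y (fn f x)"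
    if "f \<in> hom Pos X Y" for f X Y x
    using ext[of X "F Y" "compose (Field X) (e Y) (fn f)"] m that
    by (auto simp: hom_Pos intro!: monotone_maps_compose)
  have extm: "ext (F X) (\<lambda>x\<in>Field (poset (F X)). x) (poset (F X)) \<in> homomorphisms P S (F (poset (F X))) (F X)"
    "y \<in> Field (poset (F X)) \<Longrightarrow> ext (F X) (\<lambda>x\<in>Field (poset (F X)). x) (poset (F X)) (e (poset (F X)) y) = y"
    if "X \<in> Ob Pos" for X y
    using ext[OF m(2)[OF that] m(1)[OF that] monotone_maps_restrictI[of "poset (F X)" "\<lambda>x. x"]] by auto
  have "free_monad P S E M F"
    by unfold_locales
      (auto simp: M_def free hom_Pos m extm extf intro: homomorphism_monotone[OF extm(1)]
        homomorphism_monotone[OF extf(1)] elim!: extf[unfolded hom_Pos, simplified])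
  then show ?thesis by blast
qed

end

section \<open>Free-algebra monads are finitary\<close>

context coherent_variety
begin

text \<open>An operation on the colimit is computed at a stage through which its finite family of arguments
factors.\<close>

lemma filtered_colimit_of_models:
  fixes I :: "('i, 'j) cat" and D :: "('i, 'j, 'u rel, 'u pos_arrow) func"
  assumes "filtered_diagram I D"
    and A: "\<And>i. i \<in> Ob I \<Longrightarrow> A i \<in> models P S E" "\<And>i. i \<in> Ob I \<Longrightarrow> on_ob D i = poset (A i)"
    and D_hom: "\<And>i j u. u \<in> hom I i j \<Longrightarrow> fn (on_ar D u) \<in> homomorphisms P S (A i) (A j)"
    and q: "concrete_colimit I D Q q"
  shows "\<exists>B\<in>models P S E. poset B = Q \<and> (\<forall>i\<in>Ob I. fn (q i) \<in> homomorphisms P S (A i) B)"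
proof -
  interpret D: filtered_diagram I D by (rule assms(1))
  note qc = D.concrete_colimit_cocone[OF q]
  have Q: "Q \<in> Ob Pos" using qc by (simp add: cocone_def)
  have q_mm: "fn (q i) \<in> monotone_maps (poset (A i)) Q" if "i \<in> Ob I" for i
    using D.cocone_hom[OF qc that] A(2)[OF that] by (simp add: hom_Pos)
  note Ac = models_coherent[OF A(1)]
  \<comment> \<open>The value of an operation depends monotonically on its arguments, whatever stages are chosen.\<close>
  have key: "(fn (q i) (oper (A i) \<Delta> \<sigma> f), fn (q j) (oper (A j) \<Delta> \<sigma> g)) \<in> Q"
    if i: "i \<in> Ob I" and j: "j \<in> Ob I" and op: "\<Delta> \<in> P" "\<sigma> \<in> S \<Delta>"
      and f: "f \<in> monotone_maps \<Delta> (poset (A i))" and g: "g \<in> monotone_maps \<Delta> (poset (A j))"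
      and le: "\<And>x. x \<in> Field \<Delta> \<Longrightarrow> (fn (q i) (f x), fn (q j) (g x)) \<in> Q" for i j \<Delta> \<sigma> f g
  proof -
    obtain k u v where k: "k \<in> Ob I" and u: "u \<in> hom I i k" and v: "v \<in> hom I j k"
      and uv: "\<And>x. x \<in> Field \<Delta> \<Longrightarrow> (fn (on_ar D u) (f x), fn (on_ar D v) (g x)) \<in> on_ob D k"
      using D.factor_finite_le[OF q context_finite[OF op(1)] i j f[folded A(2)[OF i]] g[folded A(2)[OF j]] le]
      by blast
    note hu = D_hom[OF u] and hv = D_hom[OF v]
    have "(oper (A k) \<Delta> \<sigma> (compose (Field \<Delta>) (fn (on_ar D u)) f),
        oper (A k) \<Delta> \<sigma> (compose (Field \<Delta>) (fn (on_ar D v)) g)) \<in> poset (A k)"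
      using uv A(2)[OF k] by (intro oper_le[OF Ac[OF k] op] monotone_maps_compose[OF f homomorphism_monotone[OF hu]]
        monotone_maps_compose[OF g homomorphism_monotone[OF hv]]) simp
    then have "(fn (on_ar D u) (oper (A i) \<Delta> \<sigma> f), fn (on_ar D v) (oper (A j) \<Delta> \<sigma> g)) \<in> on_ob D k"
      by (simp add: homomorphism_oper[OF hu op f] homomorphism_oper[OF hv op g] A(2)[OF k])
    then show ?thesis
      by (intro D.cocone_le[OF qc u v]) (simp_all add: A(2) i j oper_mem[OF Ac op] f g)
  qed
  have fac: "\<exists>p. fst p \<in> Ob I \<and> snd p \<in> monotone_maps \<Delta> (poset (A (fst p))) \<and>
      f = compose (Field \<Delta>) (fn (q (fst p))) (snd p)"
    if \<Delta>: "\<Delta> \<in> P" and f: "f \<in> monotone_maps \<Delta> Q" for \<Delta> f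
  proof -
    obtain k g where k: "k \<in> Ob I" "g \<in> monotone_maps \<Delta> (on_ob D k)"
      "\<And>x. x \<in> Field \<Delta> \<Longrightarrow> f x = fn (q k) (g x)"
      using D.factor_finite[OF q context_Ob[OF \<Delta>] context_finite[OF \<Delta>] f] by blast
    have "f = compose (Field \<Delta>) (fn (q k)) g"
      by (rule monotone_maps_eqI[OF f monotone_maps_compose[OF k(2)[unfolded A(2)[OF k(1)]] q_mm[OF k(1)]]])
        (simp add: k(3))
    with k A(2)[OF k(1)] show ?thesis by (intro exI[of _ "(k, g)"]) simp
  qed
  define pt where "pt \<Delta> f = (SOME p. fst p \<in> Ob I \<and> snd p \<in> monotone_maps \<Delta> (poset (A (fst p))) \<and>
      f = compose (Field \<Delta>) (fn (q (fst p))) (snd p))" for \<Delta> f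
  have pt: "fst (pt \<Delta> f) \<in> Ob I" "snd (pt \<Delta> f) \<in> monotone_maps \<Delta> (poset (A (fst (pt \<Delta> f))))"
    "f = compose (Field \<Delta>) (fn (q (fst (pt \<Delta> f)))) (snd (pt \<Delta> f))"
    if "\<Delta> \<in> P" "f \<in> monotone_maps \<Delta> Q" for \<Delta> f
    using someI_ex[OF fac[OF that]] unfolding pt_def[symmetric] by auto
  define B where "B = \<lparr>poset = Q, oper = (\<lambda>\<Delta> \<sigma> f. if \<Delta> \<in> P \<and> \<sigma> \<in> S \<Delta> \<and> f \<in> monotone_maps \<Delta> Q
    then fn (q (fst (pt \<Delta> f))) (oper (A (fst (pt \<Delta> f))) \<Delta> \<sigma> (snd (pt \<Delta> f))) else undefined)\<rparr>"
  have B: "poset B = Q" by (simp add: B_def)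
  have opB: "oper B \<Delta> \<sigma> f = fn (q (fst (pt \<Delta> f))) (oper (A (fst (pt \<Delta> f))) \<Delta> \<sigma> (snd (pt \<Delta> f)))"
    if "\<Delta> \<in> P" "\<sigma> \<in> S \<Delta>" "f \<in> monotone_maps \<Delta> Q" for \<Delta> \<sigma> f
    using that by (simp add: B_def)
  have pt_app: "fn (q (fst (pt \<Delta> f))) (snd (pt \<Delta> f) x) = f x"
    if "\<Delta> \<in> P" "f \<in> monotone_maps \<Delta> Q" "x \<in> Field \<Delta>" for \<Delta> f x
    using fun_cong[OF pt(3)[OF that(1,2)], of x] that(3) by simp
  have opB_le: "(oper B \<Delta> \<sigma> f, oper B \<Delta> \<sigma> g) \<in> Q"
    if op: "\<Delta> \<in> P" "\<sigma> \<in> S \<Delta>" and f: "f \<in> monotone_maps \<Delta> Q" and g: "g \<in> monotone_maps \<Delta> Q"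
      and le: "\<And>x. x \<in> Field \<Delta> \<Longrightarrow> (f x, g x) \<in> Q" for \<Delta> \<sigma> f g
    unfolding opB[OF op f] opB[OF op g]
    using le by (intro key pt op f g) (simp add: pt_app op f g)
  have op_mem: "oper B \<Delta> \<sigma> f \<in> Field Q" if op: "\<Delta> \<in> P" "\<sigma> \<in> S \<Delta>" and f: "f \<in> monotone_maps \<Delta> Q" for \<Delta> \<sigma> f
    unfolding opB[OF op f]
    by (rule monotone_maps_mem[OF q_mm[OF pt(1)[OF op(1) f]] oper_mem[OF Ac[OF pt(1)[OF op(1) f]] op pt(2)[OF op(1) f]]])
  have coh: "coherent_algebra P S B"
    unfolding coherent_algebra_def B pointwise_le_def
    using Q op_mem opB_le by (auto simp: B_def)
  have hom: "fn (q i) \<in> homomorphisms P S (A i) B" if i: "i \<in> Ob I" for i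
    unfolding homomorphisms_def B
  proof (intro CollectI conjI ballI q_mm[OF i])
    fix \<Delta> \<sigma> f assume op: "\<Delta> \<in> P" "\<sigma> \<in> S \<Delta>" and f: "f \<in> monotone_maps \<Delta> (poset (A i))"
    let ?f = "compose (Field \<Delta>) (fn (q i)) f"
    have qf: "?f \<in> monotone_maps \<Delta> Q" by (rule monotone_maps_compose[OF f q_mm[OF i]])
    have qx: "(fn (q i) (f x), fn (q i) (f x)) \<in> Q" if "x \<in> Field \<Delta>" for x
      using Pos_refl[OF Q monotone_maps_mem[OF q_mm[OF i] monotone_maps_mem[OF f that]]] .
    show "fn (q i) (oper (A i) \<Delta> \<sigma> f) = oper B \<Delta> \<sigma> ?f"
      unfolding opB[OF op qf]
      by (rule Pos_antisym[OF Q]; rule key) (use pt[OF op(1) qf] op i f qx pt_app[OF op(1) qf] in simp_all)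
  qed
  have "B \<in> models P S E"
  proof (rule models_factor[OF coh])
    fix \<Gamma> f assume "\<Gamma> \<in> P" "f \<in> monotone_maps \<Gamma> (poset B)"
    then obtain p where "fst p \<in> Ob I" "snd p \<in> monotone_maps \<Gamma> (poset (A (fst p)))"
      "f = compose (Field \<Gamma>) (fn (q (fst p))) (snd p)"
      using fac unfolding B by blast
    then show "\<exists>B' h g. B' \<in> models P S E \<and> h \<in> homomorphisms P S B' B \<and> g \<in> monotone_maps \<Gamma> (poset B') \<and>
        f = compose (Field \<Gamma>) h g"
      using hom A(1) by blast
  qed
  with B hom show ?thesis by blast
qed

end

lemma comp_functor:
  "is_functor C C' F \<Longrightarrow> is_functor C' C'' G \<Longrightarrow> is_functor C C'' (comp_func G F)"
  unfolding is_functor_def comp_func_def hom_def by auto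

context free_monad
begin

lemma functor_T: "is_functor Pos Pos (mfun M)"
  using is_monad by (simp add: is_monad_def)

text \<open>Let \<open>X\<close> be the colimit of \<open>D i\<close>, and let \<open>Q\<close> be the colimit of the posets \<open>T (D i)\<close>, which carries
a model \<open>B\<close>. The map \<open>X \<rightarrow> Q\<close> induced by the units extends to a homomorphism \<open>\<phi> : F X \<rightarrow> B\<close> that
sends the cocone \<open>T (c i)\<close> to the cocone \<open>q i\<close>. Along \<open>\<phi>\<close> the inequalities of \<open>T X\<close> are
reflected at a stage as those of \<open>Q\<close> are, and the union of the images of the \<open>T (c i)\<close> is all of
\<open>T X\<close> since it contains the generators and is closed under the operations.\<close>

lemma finitary: "finitary M"
  unfolding finitary_def preserves_filtered_colimits_def
proof (intro allI impI)
  fix I :: "('u, 'u) cat" and D :: "('u, 'u, 'u rel, 'u pos_arrow) func" and X c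
  assume *: "filtered I \<and> small (Ob I) \<and> small (Ar I) \<and> is_functor I Pos D \<and> colimit I Pos D X c"
  define TD where "TD = comp_func (mfun M) D"
  interpret D: filtered_diagram I D using * U by unfold_locales (auto simp: small_iff_few)
  interpret TD: filtered_diagram I TD
    using * U comp_functor[OF _ functor_T, of I D] by unfold_locales (auto simp: small_iff_few TD_def)
  have c: "concrete_colimit I D X c" using * by (blast intro: D.colimit_is_concrete)
  note cc = D.concrete_colimit_cocone[OF c] and c_hom = D.cocone_hom[OF D.concrete_colimit_cocone[OF c]]
  have X: "X \<in> Ob Pos" using cc by (simp add: cocone_def)
  note XX = F_model[OF X]
  let ?A = "\<lambda>i. F (on_ob D i)" and ?u = "\<lambda>i. unit M (on_ob D i)" and ?T = "on_ar (mfun M)"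
  have TD_ob: "on_ob TD i = poset (?A i)" if "i \<in> Ob I" for i
    using on_ob[OF D.D_ob[OF that]] by (simp add: TD_def comp_func_def)
  have TD_ar: "on_ar TD u = ?T (on_ar D u)" for u by (simp add: TD_def comp_func_def)
  have Am: "?A i \<in> models P S E" if "i \<in> Ob I" for i by (rule F_model[OF D.D_ob[OF that]])
  obtain Q q where q: "concrete_colimit I TD Q q" using TD.concrete_colimit_exists by blast
  note qc = TD.concrete_colimit_cocone[OF q]
  have TD_hom: "fn (on_ar TD u) \<in> homomorphisms P S (?A i) (?A j)" if "u \<in> hom I i j" for i j u
    unfolding TD_ar by (rule map_homomorphism[OF D.D_ar[OF that]])
  obtain B where B: "B \<in> models P S E" "poset B = Q" and qh: "\<And>i. i \<in> Ob I \<Longrightarrow> fn (q i) \<in> homomorphisms P S (?A i) B"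
    using filtered_colimit_of_models[OF TD.filtered_diagram_axioms, of ?A Q q, OF Am TD_ob TD_hom q] by blast
  have q_hom: "q i \<in> hom Pos (poset (?A i)) Q" if "i \<in> Ob I" for i
    using TD.cocone_hom[OF qc that] by (simp add: TD_ob[OF that])
  have u_hom: "?u i \<in> hom Pos (on_ob D i) (poset (?A i))" if "i \<in> Ob I" for i by (rule unit_hom[OF D.D_ob[OF that]])
  have qu: "Cmp Pos (q i) (?u i) \<in> hom Pos (on_ob D i) Q" if "i \<in> Ob I" for i
    by (rule Cmp_Pos_in[OF u_hom[OF that] q_hom[OF that]])
  have Qo: "Q \<in> Ob Pos" using qc by (simp add: cocone_def)
  have "cocone I Pos D Q (\<lambda>i. Cmp Pos (q i) (?u i))"
    unfolding cocone_def
  proof (intro conjI ballI Qo qu)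
    fix u assume "u \<in> Ar I"
    then have u: "u \<in> hom I (Dom I u) (Cod I u)" by (simp add: hom_def)
    note i = D.hom_ob[OF u] and Du = D.D_ar[OF u]
    show "Cmp Pos (Cmp Pos (q (Cod I u)) (?u (Cod I u))) (on_ar D u) = Cmp Pos (q (Dom I u)) (?u (Dom I u))"
    proof (rule hom_Pos_eqI[OF Cmp_Pos_in[OF Du qu[OF i(2)]] qu[OF i(1)]])
      fix x assume x: "x \<in> Field (on_ob D (Dom I u))"
      show "fn (Cmp Pos (Cmp Pos (q (Cod I u)) (?u (Cod I u))) (on_ar D u)) x =
          fn (Cmp Pos (q (Dom I u)) (?u (Dom I u))) x"
        using TD.cocone_app[OF qc u, of "fn (?u (Dom I u)) x"] hom_Pos_mem[OF u_hom[OF i(1)] x]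
        by (simp add: Cmp_Pos_apply[OF Du x] Cmp_Pos_apply[OF u_hom[OF i(2)] hom_Pos_mem[OF Du x]]
            Cmp_Pos_apply[OF u_hom[OF i(1)] x] map_unit[OF Du x, symmetric] TD_ob[OF i(1)] TD_ar)
    qed
  qed
  then obtain e where e: "e \<in> hom Pos X Q" "\<And>i. i \<in> Ob I \<Longrightarrow> Cmp Pos e (c i) = Cmp Pos (q i) (?u i)"
    using * unfolding colimit_def by blast
  have e_app: "fn e (fn (c i) y) = fn (q i) (fn (?u i) y)" if i: "i \<in> Ob I" and y: "y \<in> Field (on_ob D i)" for i y
    using arg_cong[OF e(2)[OF i], of "\<lambda>h. fn h y"] by (simp add: Cmp_Pos_apply[OF c_hom[OF i] y] Cmp_Pos_apply[OF u_hom[OF i] y])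
  have "fn e \<in> monotone_maps X (poset B)" using e(1) by (simp add: hom_Pos B(2))
  then obtain \<phi> where \<phi>: "\<phi> \<in> homomorphisms P S (F X) B" "\<And>x. x \<in> Field X \<Longrightarrow> \<phi> (fn (unit M X) x) = fn e x"
    using free_algebra_extend[OF free[OF X] B(1)] by blast
  define Tc where "Tc = ?T \<circ> c"
  have Tc_hom: "Tc i \<in> hom Pos (poset (?A i)) (poset (F X))" if "i \<in> Ob I" for i
    unfolding Tc_def comp_def by (rule map_hom[OF c_hom[OF that]])
  have Tc_h: "fn (Tc i) \<in> homomorphisms P S (?A i) (F X)" if "i \<in> Ob I" for i
    unfolding Tc_def comp_def by (rule map_homomorphism[OF c_hom[OF that]])
  have Tc_u: "fn (Tc i) (fn (?u i) y) = fn (unit M X) (fn (c i) y)" if "i \<in> Ob I" "y \<in> Field (on_ob D i)" for i y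
    unfolding Tc_def comp_def by (rule map_unit[OF c_hom[OF that(1)] that(2)])
  have Tcc: "cocone I Pos TD (poset (F X)) Tc"
    unfolding cocone_def
  proof (intro conjI ballI)
    show "Tc i \<in> hom Pos (on_ob TD i) (poset (F X))" if "i \<in> Ob I" for i using Tc_hom[OF that] TD_ob[OF that] by simp
    fix u assume "u \<in> Ar I"
    then have u: "u \<in> hom I (Dom I u) (Cod I u)" by (simp add: hom_def)
    note i = D.hom_ob[OF u] and Du = D.D_ar[OF u]
    have "Cmp Pos (c (Cod I u)) (on_ar D u) = c (Dom I u)" using cc \<open>u \<in> Ar I\<close> by (simp add: cocone_def)
    moreover have "?T (Cmp Pos (c (Cod I u)) (on_ar D u)) = Cmp Pos (?T (c (Cod I u))) (?T (on_ar D u))"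
      using functor_T Du c_hom[OF i(2)] unfolding is_functor_def by (auto simp: hom_def)
    ultimately show "Cmp Pos (Tc (Cod I u)) (on_ar TD u) = Tc (Dom I u)" by (simp add: Tc_def TD_ar)
  qed (rule F_Ob[OF X])
  have \<phi>Tc: "\<phi> (fn (Tc i) a) = fn (q i) a" if i: "i \<in> Ob I" and a: "a \<in> Field (poset (?A i))" for i a
  proof -
    have "compose (Field (poset (?A i))) \<phi> (fn (Tc i)) = fn (q i)"
    proof (rule hom_ext[OF D.D_ob[OF i] B(1) homomorphism_compose[OF Tc_h[OF i] \<phi>(1) models_coherent[OF Am[OF i]]] qh[OF i]])
      show "compose (Field (poset (?A i))) \<phi> (fn (Tc i)) (fn (?u i) y) = fn (q i) (fn (?u i) y)"
        if y: "y \<in> Field (on_ob D i)" for y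
        using hom_Pos_mem[OF u_hom[OF i] y] by (simp add: Tc_u[OF i y] \<phi>(2) hom_Pos_mem[OF c_hom[OF i] y] e_app[OF i y])
    qed
    from fun_cong[OF this, of a] a show ?thesis by simp
  qed
  have Tc_le: "(fn (Tc i) a, fn (Tc j) b) \<in> poset (F X)" if i: "i \<in> Ob I" "j \<in> Ob I"
    "a \<in> Field (poset (?A i))" "b \<in> Field (poset (?A j))" "(fn (q i) a, fn (q j) b) \<in> Q" for i j a b
  proof -
    have ab: "a \<in> Field (on_ob TD i)" "b \<in> Field (on_ob TD j)" using i TD_ob by auto
    show ?thesis
      by (rule TD.concrete_colimit_le[OF q i(1,2) ab i(5)]) (rule TD.cocone_le[OF Tcc _ _ ab])
  qed
  have "y \<in> {y. \<exists>i\<in>Ob I. \<exists>a\<in>Field (poset (?A i)). y = fn (Tc i) a}" (is "_ \<in> ?Z") if y: "y \<in> Field (poset (F X))" for y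
  proof (rule free_algebra_induct[OF X free[OF X] _ _ y])
    show "fn (unit M X) x \<in> ?Z" if x: "x \<in> Field X" for x
    proof -
      obtain i a where ia: "i \<in> Ob I" "a \<in> Field (on_ob D i)" "x = fn (c i) a" by (rule D.concrete_colimit_surj[OF c x])
      then have "fn (unit M X) x = fn (Tc i) (fn (?u i) a)" by (simp add: Tc_u)
      with ia hom_Pos_mem[OF u_hom[OF ia(1)] ia(2)] show ?thesis by blast
    qed
    fix \<Delta> \<sigma> f assume op: "\<Delta> \<in> P" "\<sigma> \<in> S \<Delta>" and f: "f \<in> monotone_maps \<Delta> (poset (F X))"
      and fZ: "\<And>x. x \<in> Field \<Delta> \<Longrightarrow> f x \<in> ?Z"
    have "compose (Field \<Delta>) \<phi> f \<in> monotone_maps \<Delta> Q"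
      using monotone_maps_compose[OF f homomorphism_monotone[OF \<phi>(1)]] B(2) by simp
    then obtain k g where k: "k \<in> Ob I" and g0: "g \<in> monotone_maps \<Delta> (on_ob TD k)"
      and fg: "\<And>x. x \<in> Field \<Delta> \<Longrightarrow> compose (Field \<Delta>) \<phi> f x = fn (q k) (g x)"
      using TD.factor_finite[OF q context_Ob[OF op(1)] context_finite[OF op(1)]] by metis
    have g: "g \<in> monotone_maps \<Delta> (poset (?A k))" using g0 TD_ob[OF k] by simp
    have "f x = fn (Tc k) (g x)" if x: "x \<in> Field \<Delta>" for x
    proof -
      obtain j b where j: "j \<in> Ob I" "b \<in> Field (poset (?A j))" "f x = fn (Tc j) b" using fZ[OF x] by blast
      have gx: "g x \<in> Field (poset (?A k))" by (rule monotone_maps_mem[OF g x])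
      have eq: "fn (q j) b = fn (q k) (g x)" using fg[OF x] x \<phi>Tc[OF j(1,2)] j(3) by simp
      have r: "(fn (q k) (g x), fn (q k) (g x)) \<in> Q" by (rule Pos_refl[OF Qo hom_Pos_mem[OF q_hom[OF k] gx]])
      show ?thesis unfolding j(3)
        using Tc_le[OF j(1) k j(2) gx] Tc_le[OF k j(1) gx j(2)] r unfolding eq
        by (intro Pos_antisym[OF F_Ob[OF X]])
    qed
    then have "f = compose (Field \<Delta>) (fn (Tc k)) g"
      by (intro monotone_maps_eqI[OF f monotone_maps_compose[OF g homomorphism_monotone[OF Tc_h[OF k]]]]) simp
    then have "oper (F X) \<Delta> \<sigma> f = fn (Tc k) (oper (?A k) \<Delta> \<sigma> g)"
      using homomorphism_oper[OF Tc_h[OF k] op g] by simp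
    with k oper_mem[OF models_coherent[OF Am[OF k]] op g] show "oper (F X) \<Delta> \<sigma> f \<in> ?Z" by blast
  qed
  moreover have "\<exists>k\<in>Ob I. \<exists>u\<in>hom I i k. \<exists>v\<in>hom I j k. (fn (on_ar TD u) a, fn (on_ar TD v) b) \<in> on_ob TD k"
    if i: "i \<in> Ob I" "j \<in> Ob I" "a \<in> Field (on_ob TD i)" "b \<in> Field (on_ob TD j)"
      "(fn (Tc i) a, fn (Tc j) b) \<in> poset (F X)" for i j a b
    using homomorphism_le[OF \<phi>(1) i(5)] i \<phi>Tc TD_ob TD.concrete_colimit_le[OF q i(1-4)] B(2)
    by (metis (no_types, lifting))
  ultimately have "concrete_colimit I TD (poset (F X)) Tc"
    unfolding concrete_colimit_def using Tcc TD_ob by auto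
  then show "colimit I Pos (comp_func (mfun M) D) (on_ob (mfun M) X) (on_ar (mfun M) \<circ> c)"
    using TD.concrete_colimit_is_colimit unfolding on_ob[OF X] TD_def Tc_def by blast
qed

end

section \<open>Concrete isomorphisms as changes of structure\<close>

text \<open>Functors over \<open>Pos\<close> are determined by such object maps, because the forgetful functors are faithful:
a homomorphism must be sent to the same underlying map.\<close>

definition reduct ::
  "'u rel set \<Rightarrow> 'u signature \<Rightarrow> 'u inequation set \<Rightarrow> 'u signature \<Rightarrow> 'u inequation set \<Rightarrow>
     ('u algebra \<Rightarrow> 'u algebra) \<Rightarrow> bool" where
  "reduct P S E S' E' H \<longleftrightarrow>
     (\<forall>A\<in>models P S E. H A \<in> models P S' E' \<and> poset (H A) = poset A \<and>
        (\<forall>B\<in>models P S E. homomorphisms P S A B \<subseteq> homomorphisms P S' (H A) (H B)))"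

lemma reduct_functor:
  assumes H: "reduct P S E S' E' H"
  defines "G \<equiv> \<lparr>on_ob = H, on_ar = (\<lambda>h. Arrow (H (src h)) (H (tgt h)) (fn h))\<rparr>"
  shows "is_functor (variety P S E) (variety P S' E') G"
    and "func_eq_on (variety P S E) (comp_func forget G) forget"
proof -
  have 1: "H A \<in> models P S' E'" "poset (H A) = poset A" if "A \<in> models P S E" for A
    using H that by (auto simp: reduct_def)
  have 2: "h \<in> homomorphisms P S' (H A) (H B)"
    if "A \<in> models P S E" "B \<in> models P S E" "h \<in> homomorphisms P S A B" for A B h
    using H that by (auto simp: reduct_def)
  show "is_functor (variety P S E) (variety P S' E') G"
    unfolding is_functor_def Ob_variety G_def
    by (auto simp: Ar_variety hom_variety Idn_variety Cmp_variety 1 2)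
  show "func_eq_on (variety P S E) (comp_func forget G) forget"
    unfolding func_eq_on_def comp_func_def Ob_variety G_def
    by (auto simp: Ar_variety forget_def hom_variety 1)
qed

lemma concretely_isomorphicI:
  assumes H: "reduct P S E S' E' H" and K: "reduct P S' E' S E K"
    and KH: "\<And>A. A \<in> models P S E \<Longrightarrow> K (H A) = A" and HK: "\<And>B. B \<in> models P S' E' \<Longrightarrow> H (K B) = B"
  shows "concretely_isomorphic (variety P S E) (variety P S' E')"
proof -
  let ?G = "\<lparr>on_ob = H, on_ar = (\<lambda>h. Arrow (H (src h)) (H (tgt h)) (fn h))\<rparr>"
  let ?L = "\<lparr>on_ob = K, on_ar = (\<lambda>h. Arrow (K (src h)) (K (tgt h)) (fn h))\<rparr>"
  have "func_eq_on (variety P S E) (comp_func ?L ?G) id_func"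
    unfolding func_eq_on_def comp_func_def id_func_def Ob_variety
    by (auto simp: Ar_variety hom_variety KH intro!: arrow.expand)
  moreover have "func_eq_on (variety P S' E') (comp_func ?G ?L) id_func"
    unfolding func_eq_on_def comp_func_def id_func_def Ob_variety
    by (auto simp: Ar_variety hom_variety HK intro!: arrow.expand)
  ultimately show ?thesis
    unfolding concretely_isomorphic_def using reduct_functor[OF H] reduct_functor[OF K] by blast
qed

lemma functor_reduct:
  assumes G: "is_functor (variety P S E) (variety P S' E') G"
    and forget: "func_eq_on (variety P S E) (comp_func forget G) forget"
  shows "reduct P S E S' E' (on_ob G)"
  unfolding reduct_def
proof (intro ballI conjI subsetI)
  fix A assume A: "A \<in> models P S E"
  show "on_ob G A \<in> models P S' E'" using G A by (simp add: is_functor_def Ob_variety)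
  show "poset (on_ob G A) = poset A"
    using forget A by (simp add: func_eq_on_def Ob_variety comp_func_def)
  fix B h assume B: "B \<in> models P S E" and h: "h \<in> homomorphisms P S A B"
  define k where "k = Arrow A B h"
  have k: "k \<in> Ar (variety P S E)" using A B h by (simp add: k_def Ar_variety hom_variety)
  then have "on_ar G k \<in> hom (variety P S' E') (on_ob G A) (on_ob G B)"
    using G unfolding is_functor_def by (force simp: k_def)
  moreover have "fn (on_ar G k) = h"
  proof -
    have "on_ar forget (on_ar G k) = on_ar forget k"
      using forget k by (simp add: func_eq_on_def comp_func_def)
    from arg_cong[OF this, of fn] show ?thesis by (simp add: k_def)
  qed
  ultimately show "h \<in> homomorphisms P S' (on_ob G A) (on_ob G B)" by (simp add: hom_variety)
qed

lemma concretely_isomorphicD: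
  assumes "concretely_isomorphic (variety P S E) (variety P S' E')"
  obtains H K where "reduct P S E S' E' H" "reduct P S' E' S E K"
    "\<And>A. A \<in> models P S E \<Longrightarrow> K (H A) = A" "\<And>B. B \<in> models P S' E' \<Longrightarrow> H (K B) = B"
proof -
  let ?V = "variety P S E" and ?W = "variety P S' E'"
  obtain H K where H: "is_functor ?V ?W H" and K: "is_functor ?W ?V K"
    and KH: "func_eq_on ?V (comp_func K H) id_func" and HK: "func_eq_on ?W (comp_func H K) id_func"
    and f: "func_eq_on ?V (comp_func forget H) forget"
    using assms unfolding concretely_isomorphic_def by blast
  have "func_eq_on ?W (comp_func forget K) forget"
    using K HK f by (simp add: func_eq_on_def comp_func_def id_func_def is_functor_def hom_def) metis
  from functor_reduct[OF H f] functor_reduct[OF K this]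
  show ?thesis
    by (rule that) (use KH HK in \<open>simp_all add: func_eq_on_def comp_func_def id_func_def Ob_variety\<close>)
qed

section \<open>Concretely isomorphic varieties have isomorphic monads\<close>

text \<open>The component at \<open>X\<close> extends the unit of \<open>N\<close> along the unit of \<open>M\<close>, where \<open>K\<close> makes \<open>G X\<close> a model of
the variety of \<open>M\<close>. All equations hold on generators.\<close>

lemma free_monad_morphism:
  assumes "free_monad P S E M F" and "free_monad P S' E' N G" and K: "reduct P S' E' S E K"
  shows "\<exists>\<alpha>. monad_morphism Pos M N \<alpha> \<and>
    (\<forall>X\<in>Ob Pos. \<alpha> X \<in> hom Pos (poset (F X)) (poset (G X)) \<and> fn (\<alpha> X) \<in> homomorphisms P S (F X) (K (G X)) \<and>
       (\<forall>x\<in>Field X. fn (\<alpha> X) (fn (unit M X) x) = fn (unit N X) x))"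
proof -
  interpret M: free_monad P S E M F by fact
  interpret N: free_monad P S' E' N G by fact
  have KG: "K (G X) \<in> models P S E" "poset (K (G X)) = poset (G X)" if "X \<in> Ob Pos" for X
    using K N.F_model[OF that] by (auto simp: reduct_def)
  have Kh: "h \<in> homomorphisms P S (K (G X)) (K (G Y))"
    if "X \<in> Ob Pos" "Y \<in> Ob Pos" "h \<in> homomorphisms P S' (G X) (G Y)" for X Y h
    using K N.F_model[OF that(1)] N.F_model[OF that(2)] that(3) by (auto simp: reduct_def)
  have "\<exists>h. X \<in> Ob Pos \<longrightarrow> h \<in> homomorphisms P S (F X) (K (G X)) \<and>
      (\<forall>x\<in>Field X. h (fn (unit M X) x) = fn (unit N X) x)" for X
  proof (cases "X \<in> Ob Pos")
    case True
    have "fn (unit N X) \<in> monotone_maps X (poset (K (G X)))"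
      using N.unit_hom[OF True] by (simp add: hom_Pos KG(2)[OF True])
    then show ?thesis using free_algebra_extend[OF M.free[OF True] KG(1)[OF True]] by metis
  qed simp
  then obtain a where a: "\<And>X. X \<in> Ob Pos \<Longrightarrow> a X \<in> homomorphisms P S (F X) (K (G X))"
    "\<And>X x. X \<in> Ob Pos \<Longrightarrow> x \<in> Field X \<Longrightarrow> a X (fn (unit M X) x) = fn (unit N X) x" by metis
  define \<alpha> where "\<alpha> X = Arrow (poset (F X)) (poset (G X)) (a X)" for X
  have \<alpha>_fn: "fn (\<alpha> X) = a X" for X by (simp add: \<alpha>_def)
  have \<alpha>: "\<alpha> X \<in> hom Pos (poset (F X)) (poset (G X))" if X: "X \<in> Ob Pos" for X
    unfolding \<alpha>_def using homomorphism_monotone[OF a(1)[OF X]]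
    by (intro Arrow_in_hom_Pos M.F_Ob N.F_Ob X) (simp add: KG(2)[OF X])
  note \<alpha>h = a(1)[folded \<alpha>_fn] and \<alpha>u = a(2)[folded \<alpha>_fn]
  have \<alpha>K: "\<alpha> X \<in> hom Pos (poset (F X)) (poset (K (G X)))" if X: "X \<in> Ob Pos" for X
    using \<alpha>[OF X] KG(2)[OF X] by simp
  have "monad_morphism Pos M N \<alpha>"
    unfolding monad_morphism_def nat_trans_def Pos_sel
  proof (intro conjI ballI)
    fix X :: "'a rel" assume X: "X \<in> Ob Pos"
    note mu = M.unit_hom[OF X] and nu = N.unit_hom[OF X]
    show "\<alpha> X \<in> hom Pos (on_ob (mfun M) X) (on_ob (mfun N) X)"
      using \<alpha>[OF X] by (simp add: M.on_ob[OF X] N.on_ob[OF X])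
    show "Cmp Pos (\<alpha> X) (unit M X) = unit N X"
      by (rule hom_Pos_eqI[OF Cmp_Pos_in[OF mu \<alpha>[OF X]] nu]) (simp add: Cmp_Pos_apply[OF mu] \<alpha>u[OF X])
    let ?TX = "poset (F X)" and ?RX = "poset (G X)"
    note TX = M.F_Ob[OF X] and RX = N.F_Ob[OF X]
    note mm = M.mult_hom[OF X] and nm = N.mult_hom[OF X] and Ra = N.map_hom[OF \<alpha>[OF X]]
    note c1 = Cmp_Pos_in[OF mm \<alpha>[OF X]] and c2 = Cmp_Pos_in[OF \<alpha>[OF TX] Ra]
    note c3 = Cmp_Pos_in[OF c2 nm]
    show "Cmp Pos (\<alpha> X) (mult M X) =
        Cmp Pos (mult N X) (Cmp Pos (on_ar (mfun N) (\<alpha> X)) (\<alpha> (on_ob (mfun M) X)))"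
      unfolding M.on_ob[OF X]
    proof (rule M.arrow_ext[OF TX KG(1)[OF X]])
      show "Cmp Pos (\<alpha> X) (mult M X) \<in> hom Pos (poset (F ?TX)) (poset (K (G X)))"
        "Cmp Pos (mult N X) (Cmp Pos (on_ar (mfun N) (\<alpha> X)) (\<alpha> ?TX)) \<in> hom Pos (poset (F ?TX)) (poset (K (G X)))"
        using c1 c3 by (simp_all add: KG(2)[OF X])
      show "fn (Cmp Pos (\<alpha> X) (mult M X)) \<in> homomorphisms P S (F ?TX) (K (G X))"
        by (rule M.Cmp_homomorphism[OF mm M.mult_homomorphism[OF X] \<alpha>h[OF X] M.F_coherent[OF TX]])
      have "fn (Cmp Pos (on_ar (mfun N) (\<alpha> X)) (\<alpha> ?TX)) \<in> homomorphisms P S (F ?TX) (K (G ?RX))"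
        by (rule M.Cmp_homomorphism[OF \<alpha>K[OF TX] \<alpha>h[OF TX] Kh[OF TX RX N.map_homomorphism[OF \<alpha>[OF X]]]
            M.F_coherent[OF TX]])
      then show "fn (Cmp Pos (mult N X) (Cmp Pos (on_ar (mfun N) (\<alpha> X)) (\<alpha> ?TX)))
          \<in> homomorphisms P S (F ?TX) (K (G X))"
        using c2 by (intro M.Cmp_homomorphism[of _ "F ?TX" "K (G ?RX)", OF _ _ Kh[OF RX X N.mult_homomorphism[OF X]]
            M.F_coherent[OF TX]]) (simp_all add: KG(2)[OF RX])
      fix y assume y: "y \<in> Field ?TX"
      note uy = M.unit_mem[OF TX y]
      show "fn (Cmp Pos (\<alpha> X) (mult M X)) (fn (unit M ?TX) y) =
          fn (Cmp Pos (mult N X) (Cmp Pos (on_ar (mfun N) (\<alpha> X)) (\<alpha> ?TX))) (fn (unit M ?TX) y)"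
        by (simp add: Cmp_Pos_apply[OF mm uy] Cmp_Pos_apply[OF c2 uy] Cmp_Pos_apply[OF \<alpha>[OF TX] uy]
            M.mult_unit[OF X y] \<alpha>u[OF TX y] N.map_unit[OF \<alpha>[OF X] y] N.mult_unit[OF X hom_Pos_mem[OF \<alpha>[OF X] y]])
    qed
  next
    fix f :: "'a pos_arrow" assume "f \<in> Ar Pos"
    then have f: "f \<in> hom Pos (src f) (tgt f)" by (simp add: Ar_Pos)
    then have X: "src f \<in> Ob Pos" and Y: "tgt f \<in> Ob Pos" by (auto simp: hom_Pos)
    note Tf = M.map_hom[OF f] and Rf = N.map_hom[OF f]
    show "Cmp Pos (\<alpha> (tgt f)) (on_ar (mfun M) f) = Cmp Pos (on_ar (mfun N) f) (\<alpha> (src f))"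
    proof (rule M.arrow_ext[OF X KG(1)[OF Y]])
      show "Cmp Pos (\<alpha> (tgt f)) (on_ar (mfun M) f) \<in> hom Pos (poset (F (src f))) (poset (K (G (tgt f))))"
        "Cmp Pos (on_ar (mfun N) f) (\<alpha> (src f)) \<in> hom Pos (poset (F (src f))) (poset (K (G (tgt f))))"
        using Cmp_Pos_in[OF Tf \<alpha>[OF Y]] Cmp_Pos_in[OF \<alpha>[OF X] Rf] by (simp_all add: KG(2)[OF Y])
      show "fn (Cmp Pos (\<alpha> (tgt f)) (on_ar (mfun M) f)) \<in> homomorphisms P S (F (src f)) (K (G (tgt f)))"
        by (rule M.Cmp_homomorphism[OF Tf M.map_homomorphism[OF f] \<alpha>h[OF Y] M.F_coherent[OF X]])
      show "fn (Cmp Pos (on_ar (mfun N) f) (\<alpha> (src f))) \<in> homomorphisms P S (F (src f)) (K (G (tgt f)))"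
        by (rule M.Cmp_homomorphism[OF \<alpha>K[OF X] \<alpha>h[OF X] Kh[OF X Y N.map_homomorphism[OF f]] M.F_coherent[OF X]])
      fix x assume x: "x \<in> Field (src f)"
      show "fn (Cmp Pos (\<alpha> (tgt f)) (on_ar (mfun M) f)) (fn (unit M (src f)) x) =
          fn (Cmp Pos (on_ar (mfun N) f) (\<alpha> (src f))) (fn (unit M (src f)) x)"
        by (simp add: Cmp_Pos_apply[OF Tf M.unit_mem[OF X x]] Cmp_Pos_apply[OF \<alpha>[OF X] M.unit_mem[OF X x]]
            M.map_unit[OF f x] \<alpha>u[OF X x] \<alpha>u[OF Y hom_Pos_mem[OF f x]] N.map_unit[OF f x])
    qed
  qed
  with \<alpha> \<alpha>h \<alpha>u show ?thesis by blast
qed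

text \<open>The morphisms obtained from the two directions of the concrete isomorphism compose to endomorphisms
of free algebras that fix the generators.\<close>

lemma free_monads_isomorphic:
  assumes "free_monad P S E M F" and "free_monad P S' E' N G"
    and "concretely_isomorphic (variety P S E) (variety P S' E')"
  shows "monad_isomorphic Pos M N"
proof -
  interpret M: free_monad P S E M F by fact
  interpret N: free_monad P S' E' N G by fact
  obtain H K where H: "reduct P S E S' E' H" and K: "reduct P S' E' S E K"
    and KH: "\<And>A. A \<in> models P S E \<Longrightarrow> K (H A) = A" and HK: "\<And>B. B \<in> models P S' E' \<Longrightarrow> H (K B) = B"
    by (rule concretely_isomorphicD[OF assms(3)]) blast
  obtain \<alpha> where \<alpha>: "monad_morphism Pos M N \<alpha>"
    "\<And>X. X \<in> Ob Pos \<Longrightarrow> \<alpha> X \<in> hom Pos (poset (F X)) (poset (G X))"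
    "\<And>X. X \<in> Ob Pos \<Longrightarrow> fn (\<alpha> X) \<in> homomorphisms P S (F X) (K (G X))"
    "\<And>X x. X \<in> Ob Pos \<Longrightarrow> x \<in> Field X \<Longrightarrow> fn (\<alpha> X) (fn (unit M X) x) = fn (unit N X) x"
    using free_monad_morphism[OF assms(1,2) K] by blast
  obtain \<beta> where \<beta>: "monad_morphism Pos N M \<beta>"
    "\<And>X. X \<in> Ob Pos \<Longrightarrow> \<beta> X \<in> hom Pos (poset (G X)) (poset (F X))"
    "\<And>X. X \<in> Ob Pos \<Longrightarrow> fn (\<beta> X) \<in> homomorphisms P S' (G X) (H (F X))"
    "\<And>X x. X \<in> Ob Pos \<Longrightarrow> x \<in> Field X \<Longrightarrow> fn (\<beta> X) (fn (unit N X) x) = fn (unit M X) x"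
    using free_monad_morphism[OF assms(2,1) H] by blast
  have inv: "Cmp Pos (\<beta> X) (\<alpha> X) = Idn Pos (on_ob (mfun M) X) \<and>
      Cmp Pos (\<alpha> X) (\<beta> X) = Idn Pos (on_ob (mfun N) X)" if X: "X \<in> Ob Pos" for X
    unfolding M.on_ob[OF X] N.on_ob[OF X]
  proof
    have HF: "H (F X) \<in> models P S' E'" "poset (H (F X)) = poset (F X)"
      and KG: "K (G X) \<in> models P S E" "poset (K (G X)) = poset (G X)"
      using H K M.F_model[OF X] N.F_model[OF X] by (auto simp: reduct_def)
    have "fn (\<beta> X) \<in> homomorphisms P S (K (G X)) (K (H (F X)))"
      using K \<beta>(3)[OF X] N.F_model[OF X] HF(1) by (auto simp: reduct_def)
    then have \<beta>': "fn (\<beta> X) \<in> homomorphisms P S (K (G X)) (F X)" by (simp add: KH M.F_model[OF X])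
    have "fn (\<alpha> X) \<in> homomorphisms P S' (H (F X)) (H (K (G X)))"
      using H \<alpha>(3)[OF X] M.F_model[OF X] KG(1) by (auto simp: reduct_def)
    then have \<alpha>': "fn (\<alpha> X) \<in> homomorphisms P S' (H (F X)) (G X)" by (simp add: HK N.F_model[OF X])
    note a = \<alpha>(2)[OF X] and b = \<beta>(2)[OF X]
    show "Cmp Pos (\<beta> X) (\<alpha> X) = Idn Pos (poset (F X))"
    proof (rule M.arrow_ext[OF X M.F_model[OF X] Cmp_Pos_in[OF a b] Idn_Pos_in[OF M.F_Ob[OF X]]])
      show "fn (Cmp Pos (\<beta> X) (\<alpha> X)) \<in> homomorphisms P S (F X) (F X)"
        using a by (intro M.Cmp_homomorphism[OF _ \<alpha>(3)[OF X] \<beta>' M.F_coherent[OF X]]) (simp add: KG)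
      show "fn (Idn Pos (poset (F X))) \<in> homomorphisms P S (F X) (F X)"
        by (rule M.Idn_homomorphism[OF M.F_coherent[OF X]])
      show "fn (Cmp Pos (\<beta> X) (\<alpha> X)) (fn (unit M X) x) = fn (Idn Pos (poset (F X))) (fn (unit M X) x)"
        if "x \<in> Field X" for x
        using M.unit_mem[OF X that] by (simp add: Cmp_Pos_apply[OF a] \<alpha>(4)[OF X that] \<beta>(4)[OF X that] Idn_Pos_apply)
    qed
    show "Cmp Pos (\<alpha> X) (\<beta> X) = Idn Pos (poset (G X))"
    proof (rule N.arrow_ext[OF X N.F_model[OF X] Cmp_Pos_in[OF b a] Idn_Pos_in[OF N.F_Ob[OF X]]])
      show "fn (Cmp Pos (\<alpha> X) (\<beta> X)) \<in> homomorphisms P S' (G X) (G X)"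
        using b by (intro N.Cmp_homomorphism[OF _ \<beta>(3)[OF X] \<alpha>' N.F_coherent[OF X]]) (simp add: HF)
      show "fn (Idn Pos (poset (G X))) \<in> homomorphisms P S' (G X) (G X)"
        by (rule N.Idn_homomorphism[OF N.F_coherent[OF X]])
      show "fn (Cmp Pos (\<alpha> X) (\<beta> X)) (fn (unit N X) x) = fn (Idn Pos (poset (G X))) (fn (unit N X) x)"
        if "x \<in> Field X" for x
        using N.unit_mem[OF X that] by (simp add: Cmp_Pos_apply[OF b] \<alpha>(4)[OF X that] \<beta>(4)[OF X that] Idn_Pos_apply)
    qed
  qed
  show ?thesis unfolding monad_isomorphic_def using \<alpha>(1) \<beta>(1) inv by blast
qed

section \<open>Models are Eilenberg--Moore algebras\<close>

lemma Cmp_Pos_assoc: "\<lbrakk>f \<in> hom Pos X Y; g \<in> hom Pos Y Z; h \<in> hom Pos Z W\<rbrakk>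
    \<Longrightarrow> Cmp Pos h (Cmp Pos g f) = Cmp Pos (Cmp Pos h g) f"
  using category_Pos unfolding category_def hom_def by auto

lemma Cmp_Pos_Idn: "f \<in> hom Pos X Y \<Longrightarrow> Cmp Pos f (Idn Pos X) = f"
  using category_Pos unfolding category_def hom_def by auto

definition em_algebra :: "'u pos_monad \<Rightarrow> 'u rel \<Rightarrow> 'u pos_arrow \<Rightarrow> bool" where
  "em_algebra M X b \<longleftrightarrow>
     X \<in> Ob Pos \<and> b \<in> hom Pos (on_ob (mfun M) X) X \<and> Cmp Pos b (unit M X) = Idn Pos X \<and>
     Cmp Pos b (mult M X) = Cmp Pos b (on_ar (mfun M) b)"

text \<open>Associativity of \<open>b \<circ> \<beta> X\<close> combines associativity of \<open>b\<close>, naturality of \<open>\<beta>\<close>, and compatibility of \<open>\<beta>\<close>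
with the multiplications.\<close>

lemma em_algebra_pullback:
  assumes M: "is_monad Pos M" and N: "is_monad Pos N" and \<beta>: "monad_morphism Pos N M \<beta>"
    and b: "em_algebra M X b"
  shows "em_algebra N X (Cmp Pos b (\<beta> X))"
proof -
  let ?T = "on_ob (mfun M)" and ?R = "on_ob (mfun N)" and ?t = "on_ar (mfun M)" and ?r = "on_ar (mfun N)"
  have X: "X \<in> Ob Pos" and bh: "b \<in> hom Pos (?T X) X" and bu: "Cmp Pos b (unit M X) = Idn Pos X"
    and bm: "Cmp Pos b (mult M X) = Cmp Pos b (?t b)"
    using b by (auto simp: em_algebra_def)
  have TX: "?T X \<in> Ob Pos" and RX: "?R X \<in> Ob Pos" using M N X by (auto simp: is_monad_def is_functor_def)
  have \<beta>h: "\<beta> Y \<in> hom Pos (?R Y) (?T Y)" if "Y \<in> Ob Pos" for Y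
    using \<beta> that by (auto simp: monad_morphism_def nat_trans_def)
  have \<beta>n: "Cmp Pos (\<beta> Z) (?r f) = Cmp Pos (?t f) (\<beta> Y)" if "f \<in> hom Pos Y Z" for f Y Z
    using \<beta> that by (auto simp: monad_morphism_def nat_trans_def hom_def)
  have th: "?t f \<in> hom Pos (?T Y) (?T Z)" and rh: "?r f \<in> hom Pos (?R Y) (?R Z)" if "f \<in> hom Pos Y Z" for f Y Z
    using M N that by (auto simp: is_monad_def is_functor_def hom_def)
  have tc: "?t (Cmp Pos g f) = Cmp Pos (?t g) (?t f)" if "f \<in> hom Pos Y Z" "g \<in> hom Pos Z W" for f g Y Z W
    using M that by (auto simp: is_monad_def is_functor_def hom_def)
  have mM: "mult M X \<in> hom Pos (?T (?T X)) (?T X)" and mN: "mult N X \<in> hom Pos (?R (?R X)) (?R X)"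
    and uN: "unit N X \<in> hom Pos X (?R X)"
    using M N X by (auto simp: is_monad_def nat_trans_def comp_func_def id_func_def)
  note \<beta>X = \<beta>h[OF X] and \<beta>RX = \<beta>h[OF RX]
  have c: "Cmp Pos b (\<beta> X) \<in> hom Pos (?R X) X" by (rule Cmp_Pos_in[OF \<beta>X bh])
  have "Cmp Pos (Cmp Pos b (\<beta> X)) (unit N X) = Idn Pos X"
    using Cmp_Pos_assoc[OF uN \<beta>X bh] \<beta> X bu by (simp add: monad_morphism_def)
  moreover have "Cmp Pos (Cmp Pos b (\<beta> X)) (mult N X) = Cmp Pos (Cmp Pos b (\<beta> X)) (?r (Cmp Pos b (\<beta> X)))"
  proof -
    have "Cmp Pos (Cmp Pos b (\<beta> X)) (mult N X) = Cmp Pos b (Cmp Pos (\<beta> X) (mult N X))"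
      by (rule Cmp_Pos_assoc[OF mN \<beta>X bh, symmetric])
    also have "Cmp Pos (\<beta> X) (mult N X) = Cmp Pos (mult M X) (Cmp Pos (?t (\<beta> X)) (\<beta> (?R X)))"
      using \<beta> X by (simp add: monad_morphism_def)
    also have "Cmp Pos b \<dots> = Cmp Pos (Cmp Pos b (mult M X)) (Cmp Pos (?t (\<beta> X)) (\<beta> (?R X)))"
      by (rule Cmp_Pos_assoc[OF Cmp_Pos_in[OF \<beta>RX th[OF \<beta>X]] mM bh])
    also have "\<dots> = Cmp Pos b (Cmp Pos (?t b) (Cmp Pos (?t (\<beta> X)) (\<beta> (?R X))))"
      unfolding bm by (rule Cmp_Pos_assoc[OF Cmp_Pos_in[OF \<beta>RX th[OF \<beta>X]] th[OF bh] bh, symmetric])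
    also have "Cmp Pos (?t b) (Cmp Pos (?t (\<beta> X)) (\<beta> (?R X))) = Cmp Pos (?t (Cmp Pos b (\<beta> X))) (\<beta> (?R X))"
      using Cmp_Pos_assoc[OF \<beta>RX th[OF \<beta>X] th[OF bh]] tc[OF \<beta>X bh] by simp
    also have "\<dots> = Cmp Pos (\<beta> X) (?r (Cmp Pos b (\<beta> X)))"
      by (rule \<beta>n[OF c, symmetric])
    also have "Cmp Pos b \<dots> = Cmp Pos (Cmp Pos b (\<beta> X)) (?r (Cmp Pos b (\<beta> X)))"
      by (rule Cmp_Pos_assoc[OF rh[OF c] \<beta>X bh])
    finally show ?thesis .
  qed
  ultimately show ?thesis unfolding em_algebra_def using X c by blast
qed

context free_monad
begin

definition structure_map :: "'u algebra \<Rightarrow> 'u pos_arrow" where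
  "structure_map A = Arrow (poset (F (poset A))) (poset A) (counit A)"

text \<open>The operation \<open>\<sigma>\<close> is first evaluated at the generators \<open>\<eta> \<circ> f\<close> of the free algebra; the result is
then interpreted by the structure map \<open>b\<close>.\<close>

definition em_model :: "'u rel \<Rightarrow> 'u pos_arrow \<Rightarrow> 'u algebra" where
  "em_model X b = \<lparr>poset = X, oper = (\<lambda>\<Delta> \<sigma> f. if \<Delta> \<in> P \<and> \<sigma> \<in> S \<Delta> \<and> f \<in> monotone_maps \<Delta> X
     then fn b (oper (F X) \<Delta> \<sigma> (compose (Field \<Delta>) (fn (unit M X)) f)) else undefined)\<rparr>"

lemma poset_em_model [simp]: "poset (em_model X b) = X"
  by (simp add: em_model_def)

lemma structure_map_hom: "A \<in> models P S E \<Longrightarrow> structure_map A \<in> hom Pos (poset (F (poset A))) (poset A)"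
  unfolding structure_map_def
  by (intro Arrow_in_hom_Pos homomorphism_monotone[OF counit(1)] F_Ob models_poset)

lemma structure_map_fn [simp]: "fn (structure_map A) = counit A"
  by (simp add: structure_map_def)

lemma em_algebra_structure_map:
  assumes A: "A \<in> models P S E"
  shows "em_algebra M (poset A) (structure_map A)"
proof -
  let ?X = "poset A"
  note X = models_poset[OF A] and s = structure_map_hom[OF A] and c = counit(1)[OF A]
  note TX = F_Ob[OF X] and m = mult_hom[OF X] and Ts = map_hom[OF s]
  have "Cmp Pos (structure_map A) (unit M ?X) = Idn Pos ?X"
    by (rule hom_Pos_eqI[OF Cmp_Pos_in[OF unit_hom[OF X] s] Idn_Pos_in[OF X]])
      (simp add: Cmp_Pos_apply[OF unit_hom[OF X]] counit(2)[OF A] Idn_Pos_apply)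
  moreover have "Cmp Pos (structure_map A) (mult M ?X) = Cmp Pos (structure_map A) (on_ar (mfun M) (structure_map A))"
  proof (rule arrow_ext[OF TX A Cmp_Pos_in[OF m s] Cmp_Pos_in[OF Ts s]])
    show "fn (Cmp Pos (structure_map A) (mult M ?X)) \<in> homomorphisms P S (F (poset (F ?X))) A"
      using c by (intro Cmp_homomorphism[OF m mult_homomorphism[OF X] _ F_coherent[OF TX]]) simp
    show "fn (Cmp Pos (structure_map A) (on_ar (mfun M) (structure_map A))) \<in> homomorphisms P S (F (poset (F ?X))) A"
      using c by (intro Cmp_homomorphism[OF Ts map_homomorphism[OF s] _ F_coherent[OF TX]]) simp
    fix y assume y: "y \<in> Field (poset (F ?X))"
    show "fn (Cmp Pos (structure_map A) (mult M ?X)) (fn (unit M (poset (F ?X))) y) =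
        fn (Cmp Pos (structure_map A) (on_ar (mfun M) (structure_map A))) (fn (unit M (poset (F ?X))) y)"
      by (simp add: Cmp_Pos_apply[OF m unit_mem[OF TX y]] Cmp_Pos_apply[OF Ts unit_mem[OF TX y]]
          mult_unit[OF X y] map_unit[OF s y] counit(2)[OF A homomorphism_mem[OF c y]])
  qed
  ultimately show ?thesis unfolding em_algebra_def on_ob[OF X] using X s by blast
qed

lemma em_model_oper:
  "\<lbrakk>\<Delta> \<in> P; \<sigma> \<in> S \<Delta>; f \<in> monotone_maps \<Delta> X\<rbrakk> \<Longrightarrow>
    oper (em_model X b) \<Delta> \<sigma> f = fn b (oper (F X) \<Delta> \<sigma> (compose (Field \<Delta>) (fn (unit M X)) f))"
  by (simp add: em_model_def)

text \<open>Associativity of \<open>b\<close> makes it a homomorphism: a family \<open>k\<close> in \<open>F X\<close> is the multiplication applied to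
the generators \<open>\<eta> \<circ> k\<close>, and \<open>b \<circ> \<mu>\<close> may be replaced by \<open>b \<circ> T b\<close>. Then every assignment \<open>f\<close> in \<open>X\<close>
is the image under \<open>b\<close> of the assignment \<open>\<eta> \<circ> f\<close> in \<open>F X\<close>, so the inequations descend.\<close>

lemma em_model:
  assumes b: "em_algebra M X b"
  shows "em_model X b \<in> models P S E" and "fn b \<in> homomorphisms P S (F X) (em_model X b)"
proof -
  have X: "X \<in> Ob Pos" using b by (simp add: em_algebra_def)
  have bh: "b \<in> hom Pos (poset (F X)) X" and bu: "Cmp Pos b (unit M X) = Idn Pos X"
    and bm: "Cmp Pos b (mult M X) = Cmp Pos b (on_ar (mfun M) b)"
    using b by (auto simp: em_algebra_def on_ob[OF X])
  note TX = F_Ob[OF X] and m = mult_hom[OF X] and Tb = map_hom[OF bh]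
  note u = unit_hom[OF X] and uT = unit_hom[OF TX]
  have mm: "fn (unit M X) \<in> monotone_maps X (poset (F X))"
    "fn (unit M (poset (F X))) \<in> monotone_maps (poset (F X)) (poset (F (poset (F X))))"
    "fn b \<in> monotone_maps (poset (F X)) X"
    using u uT bh by (auto simp: hom_Pos)
  have bu': "fn b (fn (unit M X) x) = x" if "x \<in> Field X" for x
    using arg_cong[OF bu, of "\<lambda>h. fn h x"] that by (simp add: Cmp_Pos_apply[OF u] Idn_Pos_apply)
  have bm': "fn b (fn (mult M X) y) = fn b (fn (on_ar (mfun M) b) y)" if "y \<in> Field (poset (F (poset (F X))))" for y
    using arg_cong[OF bm, of "\<lambda>h. fn h y"] that by (simp add: Cmp_Pos_apply[OF m] Cmp_Pos_apply[OF Tb])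
  note um = monotone_maps_compose[OF _ mm(1)]
  have coh: "coherent_algebra P S (em_model X b)"
    unfolding coherent_algebra_def poset_em_model
  proof (intro conjI ballI allI impI X)
    fix \<Delta> \<sigma> f assume op: "\<Delta> \<in> P" "\<sigma> \<in> S \<Delta>" and f: "f \<in> monotone_maps \<Delta> X"
    show "oper (em_model X b) \<Delta> \<sigma> f \<in> Field X"
      unfolding em_model_oper[OF op f] by (rule hom_Pos_mem[OF bh oper_mem[OF F_coherent[OF X] op um[OF f]]])
    fix g assume g: "g \<in> monotone_maps \<Delta> X" and le: "pointwise_le \<Delta> X f g"
    show "(oper (em_model X b) \<Delta> \<sigma> f, oper (em_model X b) \<Delta> \<sigma> g) \<in> X"
      unfolding em_model_oper[OF op f] em_model_oper[OF op g]
      using le hom_Pos_le[OF u]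
      by (intro hom_Pos_le[OF bh] oper_le[OF F_coherent[OF X] op um[OF f] um[OF g]]) (simp add: pointwise_le_def)
  qed (auto simp: em_model_def)
  show hom: "fn b \<in> homomorphisms P S (F X) (em_model X b)"
    unfolding homomorphisms_def poset_em_model
  proof (intro CollectI conjI ballI mm(3))
    fix \<Delta> \<sigma> k assume op: "\<Delta> \<in> P" "\<sigma> \<in> S \<Delta>" and k: "k \<in> monotone_maps \<Delta> (poset (F X))"
    let ?k = "compose (Field \<Delta>) (fn (unit M (poset (F X)))) k"
    have k': "?k \<in> monotone_maps \<Delta> (poset (F (poset (F X))))" by (rule monotone_maps_compose[OF k mm(2)])
    have km: "k i \<in> Field (poset (F X))" if "i \<in> Field \<Delta>" for i by (rule monotone_maps_mem[OF k that])
    have bk: "compose (Field \<Delta>) (fn b) k \<in> monotone_maps \<Delta> X" by (rule monotone_maps_compose[OF k mm(3)])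
    have 1: "compose (Field \<Delta>) (fn (mult M X)) ?k = k"
      by (rule monotone_maps_eqI[OF monotone_maps_compose[OF k' homomorphism_monotone[OF mult_homomorphism[OF X]]] k])
        (simp add: mult_unit[OF X] km)
    have 2: "compose (Field \<Delta>) (fn (on_ar (mfun M) b)) ?k = compose (Field \<Delta>) (fn (unit M X)) (compose (Field \<Delta>) (fn b) k)"
      by (rule monotone_maps_eqI[OF monotone_maps_compose[OF k' homomorphism_monotone[OF map_homomorphism[OF bh]]] um[OF bk]])
        (simp add: map_unit[OF bh] km)
    have "fn b (oper (F X) \<Delta> \<sigma> k) = fn b (fn (mult M X) (oper (F (poset (F X))) \<Delta> \<sigma> ?k))"
      by (simp add: homomorphism_oper[OF mult_homomorphism[OF X] op k'] 1)
    also have "\<dots> = fn b (fn (on_ar (mfun M) b) (oper (F (poset (F X))) \<Delta> \<sigma> ?k))"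
      by (rule bm'[OF oper_mem[OF F_coherent[OF TX] op k']])
    also have "\<dots> = oper (em_model X b) \<Delta> \<sigma> (compose (Field \<Delta>) (fn b) k)"
      by (simp add: homomorphism_oper[OF map_homomorphism[OF bh] op k'] 2 em_model_oper[OF op bk])
    finally show "fn b (oper (F X) \<Delta> \<sigma> k) = oper (em_model X b) \<Delta> \<sigma> (compose (Field \<Delta>) (fn b) k)" .
  qed
  show "em_model X b \<in> models P S E"
  proof (rule models_factor[OF coh])
    fix \<Gamma> f assume f: "f \<in> monotone_maps \<Gamma> (poset (em_model X b))"
    then have f': "f \<in> monotone_maps \<Gamma> X" by simp
    have "f = compose (Field \<Gamma>) (fn b) (compose (Field \<Gamma>) (fn (unit M X)) f)"
      by (rule monotone_maps_eqI[OF f' monotone_maps_compose[OF um[OF f'] mm(3)]])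
        (simp add: bu' monotone_maps_mem[OF f'])
    then show "\<exists>B h g. B \<in> models P S E \<and> h \<in> homomorphisms P S B (em_model X b) \<and>
        g \<in> monotone_maps \<Gamma> (poset B) \<and> f = compose (Field \<Gamma>) h g"
      using F_model[OF X] hom um[OF f'] by blast
  qed
qed

lemma structure_map_em_model:
  assumes b: "em_algebra M X b"
  shows "structure_map (em_model X b) = b"
proof -
  have X: "X \<in> Ob Pos" and bh: "b \<in> hom Pos (poset (F X)) X" and bu: "Cmp Pos b (unit M X) = Idn Pos X"
    using b by (auto simp: em_algebra_def on_ob)
  have "fn b (fn (unit M X) x) = x" if "x \<in> Field X" for x
    using arg_cong[OF bu, of "\<lambda>h. fn h x"] that by (simp add: Cmp_Pos_apply[OF unit_hom[OF X]] Idn_Pos_apply)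
  then have "counit (em_model X b) = fn b"
    using counit[OF em_model(1)[OF b]] em_model(2)[OF b]
    by (intro hom_ext[OF X em_model(1)[OF b]]) auto
  then show ?thesis using bh by (intro arrow.expand) (simp add: structure_map_def hom_Pos)
qed

lemma em_model_structure_map:
  assumes A: "A \<in> models P S E"
  shows "em_model (poset A) (structure_map A) = A"
proof -
  note X = models_poset[OF A] and c = counit[OF A] and Ac = models_coherent[OF A]
  have "oper (em_model (poset A) (structure_map A)) \<Delta> \<sigma> f = oper A \<Delta> \<sigma> f" for \<Delta> \<sigma> f
  proof (cases "\<Delta> \<in> P \<and> \<sigma> \<in> S \<Delta> \<and> f \<in> monotone_maps \<Delta> (poset A)")
    case True
    then have op: "\<Delta> \<in> P" "\<sigma> \<in> S \<Delta>" and f: "f \<in> monotone_maps \<Delta> (poset A)" by auto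
    have uf: "compose (Field \<Delta>) (fn (unit M (poset A))) f \<in> monotone_maps \<Delta> (poset (F (poset A)))"
      using unit_hom[OF X] by (intro monotone_maps_compose[OF f]) (simp add: hom_Pos)
    have "compose (Field \<Delta>) (counit A) (compose (Field \<Delta>) (fn (unit M (poset A))) f) = f"
      by (rule monotone_maps_eqI[OF monotone_maps_compose[OF uf homomorphism_monotone[OF c(1)]] f])
        (simp add: c(2) monotone_maps_mem[OF f])
    then show ?thesis using homomorphism_oper[OF c(1) op uf] by (simp add: em_model_oper[OF op f])
  next
    case False
    then have "oper A \<Delta> \<sigma> f = undefined" using Ac unfolding coherent_algebra_def by blast
    then show ?thesis using False by (auto simp: em_model_def)
  qed
  then show ?thesis by (intro algebra.equality ext) simp_all
qed

text \<open>From left to right both sides are homomorphisms agreeing on generators; from right to left an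
operation of \<open>A\<close> is the structure map applied to the operation at generators.\<close>

lemma homomorphism_iff_structure_map:
  assumes A: "A \<in> models P S E" and B: "B \<in> models P S E" and h: "h \<in> hom Pos (poset A) (poset B)"
  shows "fn h \<in> homomorphisms P S A B \<longleftrightarrow>
    Cmp Pos h (structure_map A) = Cmp Pos (structure_map B) (on_ar (mfun M) h)"
proof
  note X = models_poset[OF A] and Y = models_poset[OF B]
  note sA = structure_map_hom[OF A] and sB = structure_map_hom[OF B] and cA = counit[OF A] and cB = counit[OF B]
  note Th = map_hom[OF h]
  {
    assume hh: "fn h \<in> homomorphisms P S A B"
    show "Cmp Pos h (structure_map A) = Cmp Pos (structure_map B) (on_ar (mfun M) h)"
    proof (rule arrow_ext[OF X B Cmp_Pos_in[OF sA h] Cmp_Pos_in[OF Th sB]])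
      show "fn (Cmp Pos h (structure_map A)) \<in> homomorphisms P S (F (poset A)) B"
        using cA(1) by (intro Cmp_homomorphism[OF sA _ hh F_coherent[OF X]]) simp
      show "fn (Cmp Pos (structure_map B) (on_ar (mfun M) h)) \<in> homomorphisms P S (F (poset A)) B"
        using cB(1) by (intro Cmp_homomorphism[OF Th map_homomorphism[OF h] _ F_coherent[OF X]]) simp
      fix x assume x: "x \<in> Field (poset A)"
      show "fn (Cmp Pos h (structure_map A)) (fn (unit M (poset A)) x) =
          fn (Cmp Pos (structure_map B) (on_ar (mfun M) h)) (fn (unit M (poset A)) x)"
        by (simp add: Cmp_Pos_apply[OF sA unit_mem[OF X x]] Cmp_Pos_apply[OF Th unit_mem[OF X x]]
            cA(2)[OF x] map_unit[OF h x] cB(2)[OF hom_Pos_mem[OF h x]])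
    qed
  next
    assume eq: "Cmp Pos h (structure_map A) = Cmp Pos (structure_map B) (on_ar (mfun M) h)"
    have eq': "fn h (counit A y) = counit B (fn (on_ar (mfun M) h) y)" if "y \<in> Field (poset (F (poset A)))" for y
      using arg_cong[OF eq, of "\<lambda>g. fn g y"] by (simp add: Cmp_Pos_apply[OF sA that] Cmp_Pos_apply[OF Th that])
    show "fn h \<in> homomorphisms P S A B"
      unfolding homomorphisms_def
    proof (intro CollectI conjI ballI)
      show hm: "fn h \<in> monotone_maps (poset A) (poset B)" using h by (simp add: hom_Pos)
      fix \<Delta> \<sigma> f assume op: "\<Delta> \<in> P" "\<sigma> \<in> S \<Delta>" and f: "f \<in> monotone_maps \<Delta> (poset A)"
      let ?uf = "compose (Field \<Delta>) (fn (unit M (poset A))) f"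
      have uf: "?uf \<in> monotone_maps \<Delta> (poset (F (poset A)))"
        using unit_hom[OF X] by (intro monotone_maps_compose[OF f]) (simp add: hom_Pos)
      have Thuf: "compose (Field \<Delta>) (fn (on_ar (mfun M) h)) ?uf \<in> monotone_maps \<Delta> (poset (F (poset B)))"
        by (rule monotone_maps_compose[OF uf homomorphism_monotone[OF map_homomorphism[OF h]]])
      have hf: "compose (Field \<Delta>) (fn h) f \<in> monotone_maps \<Delta> (poset B)" by (rule monotone_maps_compose[OF f hm])
      have 1: "compose (Field \<Delta>) (counit A) ?uf = f"
        by (rule monotone_maps_eqI[OF monotone_maps_compose[OF uf homomorphism_monotone[OF cA(1)]] f])
          (simp add: cA(2) monotone_maps_mem[OF f])
      have 2: "compose (Field \<Delta>) (counit B) (compose (Field \<Delta>) (fn (on_ar (mfun M) h)) ?uf) = compose (Field \<Delta>) (fn h) f"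
        by (rule monotone_maps_eqI[OF monotone_maps_compose[OF Thuf homomorphism_monotone[OF cB(1)]] hf])
          (simp add: map_unit[OF h] monotone_maps_mem[OF f] cB(2) hom_Pos_mem[OF h])
      have "fn h (oper A \<Delta> \<sigma> f) = fn h (counit A (oper (F (poset A)) \<Delta> \<sigma> ?uf))"
        by (simp add: homomorphism_oper[OF cA(1) op uf] 1)
      also have "\<dots> = counit B (fn (on_ar (mfun M) h) (oper (F (poset A)) \<Delta> \<sigma> ?uf))"
        by (rule eq'[OF oper_mem[OF F_coherent[OF X] op uf]])
      also have "\<dots> = oper B \<Delta> \<sigma> (compose (Field \<Delta>) (fn h) f)"
        by (simp add: homomorphism_oper[OF map_homomorphism[OF h] op uf] homomorphism_oper[OF cB(1) op Thuf] 2)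
      finally show "fn h (oper A \<Delta> \<sigma> f) = oper B \<Delta> \<sigma> (compose (Field \<Delta>) (fn h) f)" .
    qed
  }
qed

end

text \<open>A model of the first variety is read as an Eilenberg--Moore algebra of \<open>M\<close>, pulled back along \<open>\<beta>\<close>,
and read as a model of the second variety.\<close>

lemma reduct_of_monad_morphism:
  assumes M: "free_monad P S E M F" and N: "free_monad P S' E' N G" and \<beta>: "monad_morphism Pos N M \<beta>"
  shows "reduct P S E S' E' (\<lambda>A. free_monad.em_model P S' N G (poset A)
    (Cmp Pos (free_monad.structure_map P S M F A) (\<beta> (poset A))))"
proof -
  interpret M: free_monad P S E M F by fact
  interpret N: free_monad P S' E' N G by fact
  have em: "em_algebra N (poset A) (Cmp Pos (M.structure_map A) (\<beta> (poset A)))" if "A \<in> models P S E" for A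
    by (rule em_algebra_pullback[OF M.is_monad N.is_monad \<beta> M.em_algebra_structure_map[OF that]])
  show ?thesis
    unfolding reduct_def
  proof (intro ballI conjI subsetI)
    fix A assume A: "A \<in> models P S E"
    let ?H = "\<lambda>A. N.em_model (poset A) (Cmp Pos (M.structure_map A) (\<beta> (poset A)))"
    show HA: "?H A \<in> models P S' E'" by (rule N.em_model(1)[OF em[OF A]])
    show "poset (?H A) = poset A" by simp
    fix B h assume B: "B \<in> models P S E" and h: "h \<in> homomorphisms P S A B"
    note X = models_poset[OF A] and Y = models_poset[OF B]
    note sA = M.structure_map_hom[OF A] and sB = M.structure_map_hom[OF B]
    define k where "k = Arrow (poset A) (poset B) h"
    have k: "k \<in> hom Pos (poset A) (poset B)"
      unfolding k_def by (rule Arrow_in_hom_Pos[OF X Y homomorphism_monotone[OF h]])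
    have HB: "?H B \<in> models P S' E'" by (rule N.em_model(1)[OF em[OF B]])
    have \<beta>h: "\<beta> Z \<in> hom Pos (poset (G Z)) (poset (F Z))" if "Z \<in> Ob Pos" for Z
      using \<beta> that by (simp add: monad_morphism_def nat_trans_def M.on_ob N.on_ob)
    have \<beta>n: "Cmp Pos (\<beta> (poset B)) (on_ar (mfun N) k) = Cmp Pos (on_ar (mfun M) k) (\<beta> (poset A))"
      using \<beta> k by (auto simp: monad_morphism_def nat_trans_def hom_def)
    have eq: "Cmp Pos k (M.structure_map A) = Cmp Pos (M.structure_map B) (on_ar (mfun M) k)"
      using M.homomorphism_iff_structure_map[OF A B k] h by (simp add: k_def)
    have "Cmp Pos k (Cmp Pos (M.structure_map A) (\<beta> (poset A))) =
        Cmp Pos (Cmp Pos (M.structure_map B) (\<beta> (poset B))) (on_ar (mfun N) k)"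
      using Cmp_Pos_assoc[OF \<beta>h[OF X] sA k] Cmp_Pos_assoc[OF \<beta>h[OF X] M.map_hom[OF k] sB]
        Cmp_Pos_assoc[OF N.map_hom[OF k] \<beta>h[OF Y] sB] eq \<beta>n by simp
    then have "fn k \<in> homomorphisms P S' (?H A) (?H B)"
      using k by (subst N.homomorphism_iff_structure_map[OF HA HB])
        (simp_all add: N.structure_map_em_model em A B)
    then show "h \<in> homomorphisms P S' (?H A) (?H B)" by (simp add: k_def)
  qed
qed

lemma concretely_isomorphic_of_monads:
  assumes M: "free_monad P S E M F" and N: "free_monad P S' E' N G" and iso: "monad_isomorphic Pos M N"
  shows "concretely_isomorphic (variety P S E) (variety P S' E')"
proof -
  interpret M: free_monad P S E M F by fact
  interpret N: free_monad P S' E' N G by fact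
  obtain \<alpha> \<beta> where \<alpha>: "monad_morphism Pos M N \<alpha>" and \<beta>: "monad_morphism Pos N M \<beta>"
    and inv: "\<And>X. X \<in> Ob Pos \<Longrightarrow> Cmp Pos (\<beta> X) (\<alpha> X) = Idn Pos (on_ob (mfun M) X) \<and>
      Cmp Pos (\<alpha> X) (\<beta> X) = Idn Pos (on_ob (mfun N) X)"
    using iso unfolding monad_isomorphic_def by blast
  have \<alpha>h: "\<alpha> X \<in> hom Pos (poset (F X)) (poset (G X))" and \<beta>h: "\<beta> X \<in> hom Pos (poset (G X)) (poset (F X))"
    if "X \<in> Ob Pos" for X
    using \<alpha> \<beta> that by (simp_all add: monad_morphism_def nat_trans_def M.on_ob N.on_ob)
  show ?thesis
  proof (rule concretely_isomorphicI[OF reduct_of_monad_morphism[OF M N \<beta>] reduct_of_monad_morphism[OF N M \<alpha>]])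
    fix A assume A: "A \<in> models P S E"
    note X = models_poset[OF A]
    have em: "em_algebra N (poset A) (Cmp Pos (M.structure_map A) (\<beta> (poset A)))"
      by (rule em_algebra_pullback[OF M.is_monad N.is_monad \<beta> M.em_algebra_structure_map[OF A]])
    have "Cmp Pos (Cmp Pos (M.structure_map A) (\<beta> (poset A))) (\<alpha> (poset A)) = M.structure_map A"
      using Cmp_Pos_assoc[OF \<alpha>h[OF X] \<beta>h[OF X] M.structure_map_hom[OF A]] inv[OF X]
        Cmp_Pos_Idn[OF M.structure_map_hom[OF A]] by (simp add: M.on_ob[OF X])
    then show "M.em_model (poset (N.em_model (poset A) (Cmp Pos (M.structure_map A) (\<beta> (poset A)))))
      (Cmp Pos (N.structure_map (N.em_model (poset A) (Cmp Pos (M.structure_map A) (\<beta> (poset A)))))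
        (\<alpha> (poset (N.em_model (poset A) (Cmp Pos (M.structure_map A) (\<beta> (poset A))))))) = A"
      by (simp add: N.structure_map_em_model[OF em] M.em_model_structure_map[OF A])
  next
    fix A assume A: "A \<in> models P S' E'"
    note X = models_poset[OF A]
    have em: "em_algebra M (poset A) (Cmp Pos (N.structure_map A) (\<alpha> (poset A)))"
      by (rule em_algebra_pullback[OF N.is_monad M.is_monad \<alpha> N.em_algebra_structure_map[OF A]])
    have "Cmp Pos (Cmp Pos (N.structure_map A) (\<alpha> (poset A))) (\<beta> (poset A)) = N.structure_map A"
      using Cmp_Pos_assoc[OF \<beta>h[OF X] \<alpha>h[OF X] N.structure_map_hom[OF A]] inv[OF X]
        Cmp_Pos_Idn[OF N.structure_map_hom[OF A]] by (simp add: N.on_ob[OF X])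
    then show "N.em_model (poset (M.em_model (poset A) (Cmp Pos (N.structure_map A) (\<alpha> (poset A)))))
      (Cmp Pos (M.structure_map (M.em_model (poset A) (Cmp Pos (N.structure_map A) (\<alpha> (poset A)))))
        (\<beta> (poset (M.em_model (poset A) (Cmp Pos (N.structure_map A) (\<alpha> (poset A))))))) = A"
      by (simp add: M.structure_map_em_model[OF em] N.em_model_structure_map[OF A])
  qed
qed

section \<open>Every poset is a filtered colimit of contexts\<close>

text \<open>The index category of a directed preorder \<open>R\<close> on \<open>J\<close>, with \<open>e\<close> and \<open>d\<close> coding its elements and its
comparable pairs as elements of \<open>'u\<close>, the form in which small index categories are quantified over.\<close>

definition thin_category ::
  "('b \<Rightarrow> 'u) \<Rightarrow> ('b \<times> 'b \<Rightarrow> 'u) \<Rightarrow> 'b set \<Rightarrow> ('b \<times> 'b) set \<Rightarrow> ('u, 'u) cat" where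
  "thin_category e d J R =
     \<lparr>Ob = e ` J, Ar = d ` R,
      Dom = (\<lambda>u. e (fst (inv_into R d u))), Cod = (\<lambda>u. e (snd (inv_into R d u))),
      Idn = (\<lambda>i. d (inv_into J e i, inv_into J e i)),
      Cmp = (\<lambda>v u. d (fst (inv_into R d u), snd (inv_into R d v)))\<rparr>"

lemma thin_category:
  assumes e: "inj_on e J" and d: "inj_on d R" and R: "R \<subseteq> J \<times> J"
    and reflexive: "refl_on J R" and transitive: "Relation.trans R"
    and directed: "J \<noteq> {}" "\<forall>s\<in>J. \<forall>t\<in>J. \<exists>r. (s, r) \<in> R \<and> (t, r) \<in> R"
  defines "I \<equiv> thin_category e d J R"
  shows "filtered I"
    and "\<And>s t. (s, t) \<in> R \<Longrightarrow> d (s, t) \<in> hom I (e s) (e t)"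
    and "\<And>u. u \<in> Ar I \<Longrightarrow> \<exists>s t. (s, t) \<in> R \<and> u = d (s, t) \<and> Dom I u = e s \<and> Cod I u = e t"
    and "\<And>s. s \<in> J \<Longrightarrow> Idn I (e s) = d (s, s)"
    and "\<And>r s t. (r, s) \<in> R \<Longrightarrow> (s, t) \<in> R \<Longrightarrow> Cmp I (d (s, t)) (d (r, s)) = d (r, t)"
proof -
  have refl: "(s, s) \<in> R" if "s \<in> J" for s using reflexive that by (rule refl_onD)
  have trans: "(r, t) \<in> R" if "(r, s) \<in> R" "(s, t) \<in> R" for r s t using transitive that by (rule transD)
  have inv: "inv_into R d (d p) = p" if "p \<in> R" for p by (rule inv_into_f_f[OF d that])
  have inve: "inv_into J e (e s) = s" if "s \<in> J" for s by (rule inv_into_f_f[OF e that])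
  have sel: "Ob I = e ` J" "Ar I = d ` R" by (simp_all add: I_def thin_category_def)
  have dc: "Dom I (d (s, t)) = e s" "Cod I (d (s, t)) = e t" if "(s, t) \<in> R" for s t
    using that by (simp_all add: I_def thin_category_def inv)
  show hom: "d (s, t) \<in> hom I (e s) (e t)" if "(s, t) \<in> R" for s t
    using that by (auto simp: hom_def sel dc)
  show ar: "\<exists>s t. (s, t) \<in> R \<and> u = d (s, t) \<and> Dom I u = e s \<and> Cod I u = e t" if u: "u \<in> Ar I" for u
  proof -
    obtain p where p: "p \<in> R" "u = d p" using u unfolding sel by blast
    obtain s t where "p = (s, t)" by (cases p)
    with p have "(s, t) \<in> R" "u = d (s, t)" by auto
    then show ?thesis using dc[of s t] by blast
  qed
  show idn: "Idn I (e s) = d (s, s)" if "s \<in> J" for s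
    using that by (simp add: I_def thin_category_def inve)
  show cmp: "Cmp I (d (s, t)) (d (r, s)) = d (r, t)" if "(r, s) \<in> R" "(s, t) \<in> R" for r s t
    using that by (simp add: I_def thin_category_def inv)
  have eq: "s = t" if "e s = e t" "s \<in> J" "t \<in> J" for s t using inj_onD[OF e that] .
  have ar2: "\<exists>r s t. (r, s) \<in> R \<and> (s, t) \<in> R \<and> u = d (r, s) \<and> v = d (s, t)"
    if u: "u \<in> Ar I" and v: "v \<in> Ar I" and uv: "Cod I u = Dom I v" for u v
  proof -
    obtain r s where 1: "(r, s) \<in> R" "u = d (r, s)" "Cod I u = e s" using ar[OF u] by blast
    obtain s' t where 2: "(s', t) \<in> R" "v = d (s', t)" "Dom I v = e s'" using ar[OF v] by blast
    have "s = s'" using 1 2 uv R by (intro eq) auto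
    with 1 2 show ?thesis by blast
  qed
  have thin: "u = v" if u: "u \<in> hom I i j" and v: "v \<in> hom I i j" for u v i j
  proof -
    obtain s t where 1: "(s, t) \<in> R" "u = d (s, t)" "Dom I u = e s" "Cod I u = e t"
      using ar[of u] u by (auto simp: hom_def)
    obtain s' t' where 2: "(s', t') \<in> R" "v = d (s', t')" "Dom I v = e s'" "Cod I v = e t'"
      using ar[of v] v by (auto simp: hom_def)
    have "s = s'" "t = t'" using 1 2 u v R by (auto simp: hom_def intro!: eq)
    with 1 2 show ?thesis by simp
  qed
  have cat: "category I"
    unfolding category_def
  proof (intro conjI ballI impI)
    fix u assume u: "u \<in> Ar I"
    obtain s t where st: "(s, t) \<in> R" "u = d (s, t)" "Dom I u = e s" "Cod I u = e t" using ar[OF u] by blast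
    then have J: "s \<in> J" "t \<in> J" using R by auto
    show "Dom I u \<in> Ob I" "Cod I u \<in> Ob I" using st J by (auto simp: sel)
    show "Cmp I u (Idn I (Dom I u)) = u" "Cmp I (Idn I (Cod I u)) u = u"
      using st J by (simp_all add: idn dc cmp refl)
    fix v assume v: "v \<in> Ar I"
    show "Cmp I v u \<in> hom I (Dom I u) (Cod I v)" if uv: "Cod I u = Dom I v"
    proof -
      obtain r s t where "(r, s) \<in> R" "(s, t) \<in> R" "u = d (r, s)" "v = d (s, t)" using ar2[OF u v uv] by blast
      then show ?thesis by (simp add: cmp dc hom trans[of r s t])
    qed
    fix w assume w: "w \<in> Ar I"
    show "Cmp I w (Cmp I v u) = Cmp I (Cmp I w v) u" if uvw: "Cod I u = Dom I v \<and> Cod I v = Dom I w"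
    proof -
      obtain r s t where 1: "(r, s) \<in> R" "(s, t) \<in> R" "u = d (r, s)" "v = d (s, t)"
        using ar2[OF u v] uvw by blast
      obtain s' t' q where 2: "(s', t') \<in> R" "(t', q) \<in> R" "v = d (s', t')" "w = d (t', q)"
        using ar2[OF v w] uvw by blast
      have "s' = s" "t' = t" using inj_onD[OF d, of "(s, t)" "(s', t')"] 1 2 by auto
      with 1 2 show ?thesis by (simp add: cmp trans[of r s t] trans[of s t q])
    qed
  next
    fix i assume "i \<in> Ob I"
    then obtain s where "s \<in> J" "i = e s" by (auto simp: sel)
    then show "Idn I i \<in> hom I i i" using hom[OF refl] by (simp add: idn)
  qed
  show "filtered I"
    unfolding filtered_def
  proof (intro conjI ballI cat)
    show "Ob I \<noteq> {}" using directed(1) by (simp add: sel)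
    fix i j assume i: "i \<in> Ob I" and j: "j \<in> Ob I"
    obtain s t where st: "s \<in> J" "i = e s" "t \<in> J" "j = e t" using i j by (auto simp: sel)
    obtain r where r: "(s, r) \<in> R" "(t, r) \<in> R" using directed(2) st by blast
    then have "e r \<in> Ob I" using R by (auto simp: sel)
    with hom[OF r(1)] hom[OF r(2)] st show "\<exists>k\<in>Ob I. hom I i k \<noteq> {} \<and> hom I j k \<noteq> {}" by auto
    fix u v assume uv: "u \<in> hom I i j" "v \<in> hom I i j"
    have "Idn I j \<in> hom I j j" using cat j by (simp add: category_def)
    with j thin[OF uv] show "\<exists>k\<in>Ob I. \<exists>w\<in>hom I j k. Cmp I w u = Cmp I w v" by blast
  qed
qed

context
  fixes P :: "'u rel set"
  assumes U: "universe TYPE('u)" and P: "contexts P"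
begin

text \<open>The induced order on \<open>s\<close> is isomorphic to a context, and \<open>c\<close> is the inclusion transported along the
isomorphism.\<close>

lemma context_of_finite_subset:
  assumes X: "X \<in> Ob Pos" and s: "s \<subseteq> Field X" "finite s"
  shows "\<exists>\<Gamma> c. \<Gamma> \<in> P \<and> c \<in> monotone_maps \<Gamma> X \<and> c ` Field \<Gamma> = s \<and>
    (\<forall>a\<in>Field \<Gamma>. \<forall>b\<in>Field \<Gamma>. (c a, c b) \<in> X \<longrightarrow> (a, b) \<in> \<Gamma>)"
proof -
  define Y where "Y = X \<inter> s \<times> s"
  have F: "Field Y = s"
    using Pos_refl[OF X] s unfolding Y_def Field_def by blast
  have "Partial_order Y"
    using X s unfolding Ob_Pos order_on_defs F
    by (auto simp: Y_def refl_on_def trans_def antisym_def)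
  moreover have "small (Field Y)"
    unfolding F small_iff_few using s(2) by (intro few_countable[OF U] countable_finite)
  ultimately have Y: "Y \<in> Ob Pos" by (simp add: Ob_Pos)
  then obtain \<Gamma> where \<Gamma>: "\<Gamma> \<in> P" "isomorphic Pos Y \<Gamma>"
    using P s(2) F unfolding contexts_def by blast
  then obtain f g where f: "f \<in> hom Pos Y \<Gamma>" and g: "g \<in> hom Pos \<Gamma> Y"
    and gf: "Cmp Pos g f = Idn Pos Y" and fg: "Cmp Pos f g = Idn Pos \<Gamma>"
    unfolding isomorphic_def by blast
  have fg': "fn f (fn g a) = a" if "a \<in> Field \<Gamma>" for a
    using arg_cong[OF fg, of "\<lambda>h. fn h a"] that by (simp add: Cmp_Pos_apply[OF g] Idn_Pos_apply)
  have gf': "fn g (fn f a) = a" if "a \<in> s" for a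
    using arg_cong[OF gf, of "\<lambda>h. fn h a"] that by (simp add: Cmp_Pos_apply[OF f] Idn_Pos_apply F)
  have img: "fn g ` Field \<Gamma> = s"
    using hom_Pos_mem[OF g] hom_Pos_mem[OF f] gf' unfolding F by force
  have "fn g \<in> monotone_maps \<Gamma> X"
    using g img s(1) hom_Pos_le[OF g] unfolding hom_Pos monotone_maps_def monotone_on_def Y_def by (auto simp: PiE_iff)
  moreover have "(a, b) \<in> \<Gamma>" if "a \<in> Field \<Gamma>" "b \<in> Field \<Gamma>" "(fn g a, fn g b) \<in> X" for a b
  proof -
    have "(fn g a, fn g b) \<in> Y" using that img by (auto simp: Y_def)
    from hom_Pos_le[OF f this] show ?thesis by (simp add: fg' that)
  qed
  ultimately show ?thesis using \<Gamma>(1) img by blast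
qed

text \<open>The index is the directed set of finite subsets, each represented by the context \<open>\<Gamma> s\<close> and its
embedding \<open>c s\<close>; between these representatives the inclusion \<open>s \<subseteq> t\<close> becomes \<open>\<delta> s t\<close>.\<close>

lemma colimit_of_contexts:
  assumes X: "X \<in> Ob Pos"
  shows "\<exists>(I :: ('u, 'u) cat) D c. filtered I \<and> small (Ob I) \<and> small (Ar I) \<and> is_functor I Pos D \<and>
    (\<forall>i\<in>Ob I. on_ob D i \<in> P) \<and> concrete_colimit I D X c"
proof -
  define J where "J = {s. s \<subseteq> Field X \<and> finite s}"
  define R where "R = {(s, t). s \<in> J \<and> t \<in> J \<and> s \<subseteq> t}"
  have "few TYPE('u) (Field X)" using X by (simp add: Ob_Pos small_iff_few)
  then have fJ: "few TYPE('u) J" unfolding J_def by (rule few_finite_subsets[OF U])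
  have fR: "few TYPE('u) R"
    by (rule few_subset[OF few_Sigma[OF U fJ fJ]]) (auto simp: R_def)
  obtain e :: "'u set \<Rightarrow> 'u" where e: "inj_on e J" using few_code[OF U fJ] by blast
  obtain d :: "'u set \<times> 'u set \<Rightarrow> 'u" where d: "inj_on d R" using few_code[OF U fR] by blast
  define I where "I = thin_category e d J R"
  have RJ: "R \<subseteq> J \<times> J" and Rr: "\<And>s. s \<in> J \<Longrightarrow> (s, s) \<in> R"
    and Rt: "\<And>r s t. (r, s) \<in> R \<Longrightarrow> (s, t) \<in> R \<Longrightarrow> (r, t) \<in> R"
    and Rd: "J \<noteq> {}" "\<And>s t. s \<in> J \<Longrightarrow> t \<in> J \<Longrightarrow> (s, s \<union> t) \<in> R \<and> (t, s \<union> t) \<in> R"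
    by (auto simp: R_def J_def)
  have Ro: "refl_on J R" "Relation.trans R"
    by (auto simp: refl_on_def trans_def R_def)
  have Rd': "\<forall>s\<in>J. \<forall>t\<in>J. \<exists>r. (s, r) \<in> R \<and> (t, r) \<in> R" using Rd(2) by blast
  note thin = thin_category[OF e d RJ Ro Rd(1) Rd', folded I_def]
  have filt: "filtered I" by (rule thin(1))
  have Ob: "Ob I = e ` J" and Ar: "Ar I = d ` R" by (simp_all add: I_def thin_category_def)
  have inve: "inv_into J e (e s) = s" if "s \<in> J" for s by (rule inv_into_f_f[OF e that])
  have invd: "inv_into R d (d p) = p" if "p \<in> R" for p by (rule inv_into_f_f[OF d that])
  have "\<forall>s. \<exists>\<Gamma> c. s \<in> J \<longrightarrow> \<Gamma> \<in> P \<and> c \<in> monotone_maps \<Gamma> X \<and> c ` Field \<Gamma> = s \<and>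
      (\<forall>a\<in>Field \<Gamma>. \<forall>b\<in>Field \<Gamma>. (c a, c b) \<in> X \<longrightarrow> (a, b) \<in> \<Gamma>)"
  proof
    fix s
    show "\<exists>\<Gamma> c. s \<in> J \<longrightarrow> \<Gamma> \<in> P \<and> c \<in> monotone_maps \<Gamma> X \<and> c ` Field \<Gamma> = s \<and>
      (\<forall>a\<in>Field \<Gamma>. \<forall>b\<in>Field \<Gamma>. (c a, c b) \<in> X \<longrightarrow> (a, b) \<in> \<Gamma>)"
    proof (cases "s \<in> J")
      case True
      then have "s \<subseteq> Field X" "finite s" by (auto simp: J_def)
      from context_of_finite_subset[OF X this] show ?thesis by blast
    qed simp
  qed
  then obtain \<Gamma> c where \<Gamma>: "\<And>s. s \<in> J \<Longrightarrow> \<Gamma> s \<in> P" and c: "\<And>s. s \<in> J \<Longrightarrow> c s \<in> monotone_maps (\<Gamma> s) X"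
    and img: "\<And>s. s \<in> J \<Longrightarrow> c s ` Field (\<Gamma> s) = s"
    and refl: "\<And>s a b. s \<in> J \<Longrightarrow> a \<in> Field (\<Gamma> s) \<Longrightarrow> b \<in> Field (\<Gamma> s) \<Longrightarrow> (c s a, c s b) \<in> X \<Longrightarrow> (a, b) \<in> \<Gamma> s"
    by metis
  have \<Gamma>o: "\<Gamma> s \<in> Ob Pos" if "s \<in> J" for s using P \<Gamma>[OF that] by (auto simp: contexts_def)
  have inj: "a = b" if "s \<in> J" "a \<in> Field (\<Gamma> s)" "b \<in> Field (\<Gamma> s)" "c s a = c s b" for s a b
    using refl[OF that(1-3)] refl[OF that(1,3,2)] that Pos_refl[OF X monotone_maps_mem[OF c]] Pos_antisym[OF \<Gamma>o]
    by metis
  define \<delta> where "\<delta> s t y = inv_into (Field (\<Gamma> t)) (c t) (c s y)" for s t y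
  have \<delta>: "\<delta> s t y \<in> Field (\<Gamma> t)" "c t (\<delta> s t y) = c s y" if "(s, t) \<in> R" "y \<in> Field (\<Gamma> s)" for s t y
  proof -
    have "c s y \<in> c t ` Field (\<Gamma> t)" using that img by (auto simp: R_def)
    then show "\<delta> s t y \<in> Field (\<Gamma> t)" "c t (\<delta> s t y) = c s y"
      unfolding \<delta>_def by (auto intro: inv_into_into f_inv_into_f)
  qed
  have R: "s \<in> J" "t \<in> J" if "(s, t) \<in> R" for s t using that by (auto simp: R_def)
  define ar where "ar = (\<lambda>(s, t). Arrow (\<Gamma> s) (\<Gamma> t) (\<lambda>y\<in>Field (\<Gamma> s). \<delta> s t y))"
  define D where "D = \<lparr>on_ob = (\<lambda>i. \<Gamma> (inv_into J e i)), on_ar = (\<lambda>u. ar (inv_into R d u))\<rparr>"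
  have Do: "on_ob D (e s) = \<Gamma> s" if "s \<in> J" for s by (simp add: D_def inve that)
  have Da: "on_ar D (d (s, t)) = ar (s, t)" if "(s, t) \<in> R" for s t by (simp add: D_def invd that)
  have arh: "ar (s, t) \<in> hom Pos (\<Gamma> s) (\<Gamma> t)" if st: "(s, t) \<in> R" for s t
    unfolding ar_def prod.case
  proof (rule Arrow_in_hom_Pos[OF \<Gamma>o[OF R(1)[OF st]] \<Gamma>o[OF R(2)[OF st]]], rule monotone_maps_restrictI)
    show "\<delta> s t x \<in> Field (\<Gamma> t)" if "x \<in> Field (\<Gamma> s)" for x by (rule \<delta>(1)[OF st that])
    show "(\<delta> s t x, \<delta> s t y) \<in> \<Gamma> t" if xy: "(x, y) \<in> \<Gamma> s" for x y
    proof -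
      have F: "x \<in> Field (\<Gamma> s)" "y \<in> Field (\<Gamma> s)" using xy by (auto intro: FieldI1 FieldI2)
      show ?thesis
        using monotone_maps_le[OF c[OF R(1)[OF st]] xy] \<delta>[OF st F(1)] \<delta>[OF st F(2)]
        by (intro refl R(2)[OF st]) auto
    qed
  qed
  have ara: "fn (ar (s, t)) y = \<delta> s t y" if "y \<in> Field (\<Gamma> s)" for s t y
    using that by (simp add: ar_def)
  have functorial: "is_functor I Pos D"
    unfolding is_functor_def
  proof (intro conjI ballI impI)
    fix i assume "i \<in> Ob I"
    then obtain s where s: "s \<in> J" "i = e s" by (auto simp: Ob)
    show "on_ob D i \<in> Ob Pos" using s \<Gamma>o by (simp add: Do)
    show "on_ar D (Idn I i) = Idn Pos (on_ob D i)"
      unfolding s(2) thin(4)[OF s(1)] Da[OF Rr[OF s(1)]] Do[OF s(1)]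
      by (rule hom_Pos_eqI[OF arh[OF Rr[OF s(1)]] Idn_Pos_in[OF \<Gamma>o[OF s(1)]]])
        (simp add: ara Idn_Pos_apply, rule inj[OF s(1)], auto simp: \<delta>[OF Rr[OF s(1)]])
  next
    fix u assume u: "u \<in> Ar I"
    obtain r s where u': "(r, s) \<in> R" "u = d (r, s)" "Dom I u = e r" "Cod I u = e s" using thin(3)[OF u] by blast
    show "on_ar D u \<in> hom Pos (on_ob D (Dom I u)) (on_ob D (Cod I u))"
      using arh[OF u'(1)] R[OF u'(1)] by (simp add: u'(3,4) Do) (simp add: u'(1,2) Da)
    fix v assume v: "v \<in> Ar I" and uv: "Cod I u = Dom I v"
    obtain s' t where v': "(s', t) \<in> R" "v = d (s', t)" "Dom I v = e s'" "Cod I v = e t" using thin(3)[OF v] by blast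
    have "e s' = e s" using u'(4) v'(3) uv by simp
    then have "s' = s" by (rule inj_onD[OF e _ R(1)[OF v'(1)] R(2)[OF u'(1)]])
    then have st: "(s, t) \<in> R" "v = d (s, t)" using v' by auto
    note rt = Rt[OF u'(1) st(1)]
    show "on_ar D (Cmp I v u) = Cmp Pos (on_ar D v) (on_ar D u)"
      unfolding u'(2) st(2) thin(5)[OF u'(1) st(1)] Da[OF rt] Da[OF u'(1)] Da[OF st(1)]
    proof (rule hom_Pos_eqI[OF arh[OF rt] Cmp_Pos_in[OF arh[OF u'(1)] arh[OF st(1)]]])
      fix y assume y: "y \<in> Field (\<Gamma> r)"
      have "\<delta> r t y = \<delta> s t (\<delta> r s y)"
        by (rule inj[OF R(2)[OF rt]])
          (simp_all add: \<delta>[OF rt y] \<delta>[OF u'(1) y] \<delta>[OF st(1) \<delta>(1)[OF u'(1) y]])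
      then show "fn (ar (r, t)) y = fn (Cmp Pos (ar (s, t)) (ar (r, s))) y"
        using \<delta>(1)[OF u'(1) y] by (simp add: Cmp_Pos_apply[OF arh[OF u'(1)] y] ara y)
    qed
  qed
  define cc where "cc i = Arrow (\<Gamma> (inv_into J e i)) X (c (inv_into J e i))" for i
  have cce: "cc (e s) = Arrow (\<Gamma> s) X (c s)" if "s \<in> J" for s by (simp add: cc_def inve that)
  have cch: "Arrow (\<Gamma> s) X (c s) \<in> hom Pos (\<Gamma> s) X" if "s \<in> J" for s
    by (rule Arrow_in_hom_Pos[OF \<Gamma>o[OF that] X c[OF that]])
  have "cocone I Pos D X cc"
    unfolding cocone_def
  proof (intro conjI ballI X)
    show "cc i \<in> hom Pos (on_ob D i) X" if "i \<in> Ob I" for i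
      using that cch by (auto simp: Ob Do cce)
    fix u assume u: "u \<in> Ar I"
    obtain r s where u': "(r, s) \<in> R" "u = d (r, s)" "Dom I u = e r" "Cod I u = e s" using thin(3)[OF u] by blast
    note rs = R[OF u'(1)] and a = arh[OF u'(1)]
    have "Cmp Pos (Arrow (\<Gamma> s) X (c s)) (ar (r, s)) = Arrow (\<Gamma> r) X (c r)"
      by (rule hom_Pos_eqI[OF Cmp_Pos_in[OF a cch[OF rs(2)]] cch[OF rs(1)]])
        (simp add: Cmp_Pos_apply[OF a] ara \<delta>[OF u'(1)])
    then show "Cmp Pos (cc (Cod I u)) (on_ar D u) = cc (Dom I u)"
      unfolding u'(3,4) cce[OF rs(1)] cce[OF rs(2)] by (simp add: u'(1,2) Da)
  qed
  moreover have "\<exists>i\<in>Ob I. \<exists>a\<in>Field (on_ob D i). x = fn (cc i) a" if x: "x \<in> Field X" for x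
  proof -
    have s: "{x} \<in> J" using x by (simp add: J_def)
    obtain a where "a \<in> Field (\<Gamma> {x})" "c {x} a = x" using img[OF s] by blast
    with s show ?thesis by (intro bexI[of _ "e {x}"] bexI[of _ a]) (auto simp: Ob Do cce)
  qed
  moreover have "\<exists>k\<in>Ob I. \<exists>u\<in>hom I i k. \<exists>v\<in>hom I j k. (fn (on_ar D u) a, fn (on_ar D v) b) \<in> on_ob D k"
    if ij: "i \<in> Ob I" "j \<in> Ob I" "a \<in> Field (on_ob D i)" "b \<in> Field (on_ob D j)" "(fn (cc i) a, fn (cc j) b) \<in> X"
    for i j a b
  proof -
    obtain s t where st: "s \<in> J" "i = e s" "t \<in> J" "j = e t" using ij by (auto simp: Ob)
    note r = Rd(2)[OF st(1,3)]
    have r1: "(s, s \<union> t) \<in> R" and r2: "(t, s \<union> t) \<in> R" using r by auto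
    have a: "a \<in> Field (\<Gamma> s)" and b: "b \<in> Field (\<Gamma> t)" and le: "(c s a, c t b) \<in> X"
      using ij st by (auto simp: Do cce)
    have "(\<delta> s (s \<union> t) a, \<delta> t (s \<union> t) b) \<in> \<Gamma> (s \<union> t)"
      using \<delta>[OF r1 a] \<delta>[OF r2 b] le by (intro refl R(2)[OF r1]) auto
    then show ?thesis
      using R(2)[OF r1] thin(2)[OF r1] thin(2)[OF r2] st a b
      by (intro bexI[of _ "e (s \<union> t)"] bexI[of _ "d (s, s \<union> t)"] bexI[of _ "d (t, s \<union> t)"])
        (auto simp: Do Da r1 r2 ara Ob)
  qed
  ultimately have "concrete_colimit I D X cc" unfolding concrete_colimit_def by blast
  moreover have "small (Ob I)" "small (Ar I)"
    unfolding Ob Ar small_iff_few using fJ fR by (auto intro: few_image)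
  moreover have "\<forall>i\<in>Ob I. on_ob D i \<in> P" using \<Gamma> by (auto simp: Ob Do)
  ultimately show ?thesis using filt functorial by blast
qed

end

section \<open>The variety of an enriched finitary monad\<close>

text \<open>An element \<open>\<sigma>\<close> of \<open>T \<Gamma>\<close> will be an operation symbol; this is the operation applied to the variables.\<close>

definition basic_term :: "'u rel \<Rightarrow> 'u \<Rightarrow> 'u trm" where
  "basic_term \<Gamma> \<sigma> = Op \<Gamma> \<sigma> (\<lambda>i\<in>Field \<Gamma>. Var i)"

lemma basic_term_in: "\<Gamma> \<in> P \<Longrightarrow> \<sigma> \<in> S \<Gamma> \<Longrightarrow> basic_term \<Gamma> \<sigma> \<in> terms P S \<Gamma>"
  unfolding basic_term_def by (rule terms.op) (auto intro: terms.var)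

lemma evaluate_basic_term:
  assumes "f \<in> monotone_maps \<Gamma> (poset A)"
  shows "evaluate A f (basic_term \<Gamma> \<sigma>) = Some (oper A \<Gamma> \<sigma> f)"
proof -
  have "(\<lambda>i\<in>Field \<Gamma>. f i) = f"
    using assms by (auto simp: monotone_maps_def intro: extensionalityI[of _ "Field \<Gamma>"])
  moreover have "(\<lambda>i\<in>Field \<Gamma>. the (evaluate A f ((\<lambda>i\<in>Field \<Gamma>. Var i) i))) = (\<lambda>i\<in>Field \<Gamma>. f i)"
    by (auto simp: fun_eq_iff restrict_def)
  ultimately show ?thesis
    using monotone_maps_le[OF assms] by (auto simp: basic_term_def FieldI1 FieldI2)
qed

locale enriched_finitary_monad =
  fixes P :: "'u rel set" and M :: "'u pos_monad"
  assumes U: "universe TYPE('u)" and P: "contexts P"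
    and monad: "is_monad Pos M" and enr: "enriched M" and fin: "finitary M"
begin

abbreviation T :: "'u rel \<Rightarrow> 'u rel" where "T \<equiv> on_ob (mfun M)"

text \<open>The Kleisli extension of \<open>f : Y \<rightarrow> T X\<close>.\<close>

definition star :: "'u rel \<Rightarrow> 'u rel \<Rightarrow> ('u \<Rightarrow> 'u) \<Rightarrow> 'u \<Rightarrow> 'u" where
  "star Y X f = fn (Cmp Pos (mult M X) (on_ar (mfun M) (Arrow Y (T X) f)))"

lemma functor_T: "is_functor Pos Pos (mfun M)"
  using monad by (simp add: is_monad_def)

lemma T_Ob: "X \<in> Ob Pos \<Longrightarrow> T X \<in> Ob Pos"
  using functor_T by (simp add: is_functor_def)

lemma T_hom: "f \<in> hom Pos X Y \<Longrightarrow> on_ar (mfun M) f \<in> hom Pos (T X) (T Y)"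
  using functor_T by (auto simp: is_functor_def hom_def)

lemma T_Cmp: "f \<in> hom Pos X Y \<Longrightarrow> g \<in> hom Pos Y Z \<Longrightarrow>
    on_ar (mfun M) (Cmp Pos g f) = Cmp Pos (on_ar (mfun M) g) (on_ar (mfun M) f)"
  using functor_T by (auto simp: is_functor_def hom_def)

lemma unit_hom: "X \<in> Ob Pos \<Longrightarrow> unit M X \<in> hom Pos X (T X)"
  and mult_hom: "X \<in> Ob Pos \<Longrightarrow> mult M X \<in> hom Pos (T (T X)) (T X)"
  using monad by (auto simp: is_monad_def nat_trans_def id_func_def comp_func_def)

lemma unit_natural: "f \<in> hom Pos X Y \<Longrightarrow> Cmp Pos (unit M Y) f = Cmp Pos (on_ar (mfun M) f) (unit M X)"
  and mult_natural: "f \<in> hom Pos X Y \<Longrightarrow>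
    Cmp Pos (mult M Y) (on_ar (mfun M) (on_ar (mfun M) f)) = Cmp Pos (on_ar (mfun M) f) (mult M X)"
  using monad by (auto simp: is_monad_def nat_trans_def id_func_def comp_func_def hom_def)

lemma unit_mm: "X \<in> Ob Pos \<Longrightarrow> fn (unit M X) \<in> monotone_maps X (T X)"
  using unit_hom by (simp add: hom_Pos)

lemma unit_mem: "X \<in> Ob Pos \<Longrightarrow> x \<in> Field X \<Longrightarrow> fn (unit M X) x \<in> Field (T X)"
  by (rule hom_Pos_mem[OF unit_hom])

lemma laws:
  assumes "X \<in> Ob Pos"
  shows "Cmp Pos (mult M X) (unit M (T X)) = Idn Pos (T X)"
    and "Cmp Pos (mult M X) (on_ar (mfun M) (unit M X)) = Idn Pos (T X)"
    and "Cmp Pos (mult M X) (mult M (T X)) = Cmp Pos (mult M X) (on_ar (mfun M) (mult M X))"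
  using monad assms by (auto simp: is_monad_def)

context
  fixes X Y f
  assumes X: "X \<in> Ob Pos" and Y: "Y \<in> Ob Pos" and f: "f \<in> monotone_maps Y (T X)"
begin

lemma arrow_f: "Arrow Y (T X) f \<in> hom Pos Y (T X)"
  by (rule Arrow_in_hom_Pos[OF Y T_Ob[OF X] f])

lemma star_arrow: "Cmp Pos (mult M X) (on_ar (mfun M) (Arrow Y (T X) f)) \<in> hom Pos (T Y) (T X)"
  by (rule Cmp_Pos_in[OF T_hom[OF arrow_f] mult_hom[OF X]])

lemma star_mm: "star Y X f \<in> monotone_maps (T Y) (T X)"
  using star_arrow by (simp add: hom_Pos star_def)

lemma star_unit: "y \<in> Field Y \<Longrightarrow> star Y X f (fn (unit M Y) y) = f y"
proof -
  assume y: "y \<in> Field Y"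
  note a = arrow_f and Ta = T_hom[OF arrow_f]
  have "star Y X f (fn (unit M Y) y) = fn (mult M X) (fn (Cmp Pos (on_ar (mfun M) (Arrow Y (T X) f)) (unit M Y)) y)"
    unfolding star_def by (simp add: Cmp_Pos_apply[OF Ta unit_mem[OF Y y]] Cmp_Pos_apply[OF unit_hom[OF Y] y])
  also have "\<dots> = fn (Cmp Pos (mult M X) (unit M (T X))) (f y)"
    unfolding unit_natural[OF a, symmetric]
    by (simp add: Cmp_Pos_apply[OF a y] Cmp_Pos_apply[OF unit_hom[OF T_Ob[OF X]] monotone_maps_mem[OF f y]])
  also have "\<dots> = f y" using monotone_maps_mem[OF f y] by (simp add: laws(1)[OF X] Idn_Pos_apply)
  finally show ?thesis .
qed

lemma star_star:
  assumes Z: "Z \<in> Ob Pos" and g: "g \<in> monotone_maps Z (T Y)" and a: "a \<in> Field (T Z)"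
  shows "star Z X (compose (Field Z) (star Y X f) g) a = star Y X f (star Z Y g a)"
proof -
  let ?t = "on_ar (mfun M)" and ?f = "Arrow Y (T X) f" and ?g = "Arrow Z (T Y) g"
  have gh: "?g \<in> hom Pos Z (T Y)" by (rule Arrow_in_hom_Pos[OF Z T_Ob[OF Y] g])
  have sf: "Cmp Pos (mult M X) (?t ?f) \<in> hom Pos (T Y) (T X)" by (rule star_arrow)
  note tf = T_hom[OF arrow_f] and m = mult_hom[OF X] and mT = mult_hom[OF T_Ob[OF X]]
  have eq: "Arrow Z (T X) (compose (Field Z) (star Y X f) g) = Cmp Pos (Cmp Pos (mult M X) (?t ?f)) ?g"
  proof (rule arrow.expand)
    show "src (Arrow Z (T X) (compose (Field Z) (star Y X f) g)) = src (Cmp Pos (Cmp Pos (mult M X) (?t ?f)) ?g) \<and>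
      tgt (Arrow Z (T X) (compose (Field Z) (star Y X f) g)) = tgt (Cmp Pos (Cmp Pos (mult M X) (?t ?f)) ?g) \<and>
      fn (Arrow Z (T X) (compose (Field Z) (star Y X f) g)) = fn (Cmp Pos (Cmp Pos (mult M X) (?t ?f)) ?g)"
      using Cmp_Pos_in[OF gh sf] by (simp add: hom_Pos fn_Cmp_Pos[OF gh] star_def)
  qed
  have "Cmp Pos (mult M X) (?t (Cmp Pos (Cmp Pos (mult M X) (?t ?f)) ?g)) =
      Cmp Pos (mult M X) (Cmp Pos (Cmp Pos (?t (mult M X)) (?t (?t ?f))) (?t ?g))"
    by (simp add: T_Cmp[OF gh sf] T_Cmp[OF tf m])
  also have "\<dots> = Cmp Pos (Cmp Pos (mult M X) (?t (mult M X))) (Cmp Pos (?t (?t ?f)) (?t ?g))"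
    using Cmp_Pos_assoc[OF T_hom[OF gh] T_hom[OF tf] T_hom[OF m]]
      Cmp_Pos_assoc[OF Cmp_Pos_in[OF T_hom[OF gh] T_hom[OF tf]] T_hom[OF m] m] by simp
  also have "\<dots> = Cmp Pos (mult M X) (Cmp Pos (mult M (T X)) (Cmp Pos (?t (?t ?f)) (?t ?g)))"
    unfolding laws(3)[OF X, symmetric]
    by (rule Cmp_Pos_assoc[OF Cmp_Pos_in[OF T_hom[OF gh] T_hom[OF tf]] mT m, symmetric])
  also have "Cmp Pos (mult M (T X)) (Cmp Pos (?t (?t ?f)) (?t ?g)) =
      Cmp Pos (Cmp Pos (?t ?f) (mult M Y)) (?t ?g)"
    using Cmp_Pos_assoc[OF T_hom[OF gh] T_hom[OF tf] mT] mult_natural[OF arrow_f] by simp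
  also have "Cmp Pos (mult M X) \<dots> = Cmp Pos (Cmp Pos (mult M X) (?t ?f)) (Cmp Pos (mult M Y) (?t ?g))"
    using Cmp_Pos_assoc[OF T_hom[OF gh] mult_hom[OF Y] tf]
      Cmp_Pos_assoc[OF Cmp_Pos_in[OF T_hom[OF gh] mult_hom[OF Y]] tf m] by simp
  finally show ?thesis
    unfolding star_def[of Z] eq
    by (simp add: Cmp_Pos_apply[OF Cmp_Pos_in[OF T_hom[OF gh] mult_hom[OF Y]] a]) (simp add: star_def)
qed

end

text \<open>Enrichment enters here; it makes the canonical operations monotone.\<close>

lemma star_le:
  assumes X: "X \<in> Ob Pos" and Y: "Y \<in> Ob Pos" and f: "f \<in> monotone_maps Y (T X)" and g: "g \<in> monotone_maps Y (T X)"
    and le: "\<And>y. y \<in> Field Y \<Longrightarrow> (f y, g y) \<in> T X" and a: "a \<in> Field (T Y)"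
  shows "(star Y X f a, star Y X g a) \<in> T X"
proof -
  note af = arrow_f[OF X Y f] and ag = arrow_f[OF X Y g]
  have "pointwise_le (T Y) (T (T X)) (fn (on_ar (mfun M) (Arrow Y (T X) f))) (fn (on_ar (mfun M) (Arrow Y (T X) g)))"
    using enr Y T_Ob[OF X] af ag le unfolding enriched_def by (simp add: pointwise_le_def)
  then show ?thesis
    using a hom_Pos_le[OF mult_hom[OF X]] unfolding star_def
    by (simp add: Cmp_Pos_apply[OF T_hom[OF af] a] Cmp_Pos_apply[OF T_hom[OF ag] a] pointwise_le_def)
qed

lemma map_eq_star:
  assumes f: "f \<in> hom Pos X Y" and a: "a \<in> Field (T X)"
  shows "fn (on_ar (mfun M) f) a = star X Y (compose (Field X) (fn (unit M Y)) (fn f)) a"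
proof -
  have X: "X \<in> Ob Pos" and Y: "Y \<in> Ob Pos" using f by (auto simp: hom_Pos)
  note u = unit_hom[OF Y]
  have eq: "Arrow X (T Y) (compose (Field X) (fn (unit M Y)) (fn f)) = Cmp Pos (unit M Y) f"
    by (rule arrow.expand) (use Cmp_Pos_in[OF f u] in \<open>simp add: hom_Pos fn_Cmp_Pos[OF f]\<close>)
  have "Cmp Pos (mult M Y) (on_ar (mfun M) (Cmp Pos (unit M Y) f)) = Cmp Pos (Idn Pos (T Y)) (on_ar (mfun M) f)"
    using Cmp_Pos_assoc[OF T_hom[OF f] T_hom[OF u] mult_hom[OF Y]] by (simp add: T_Cmp[OF f u] laws(2)[OF Y])
  then show ?thesis
    unfolding star_def eq using a hom_Pos_mem[OF T_hom[OF f] a]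
    by (simp add: Cmp_Pos_apply[OF T_hom[OF f] a] Idn_Pos_apply)
qed

lemma mult_eq_star:
  assumes X: "X \<in> Ob Pos" and a: "a \<in> Field (T (T X))"
  shows "fn (mult M X) a = star (T X) X (\<lambda>x\<in>Field (T X). x) a"
proof -
  have "Arrow (T X) (T X) (\<lambda>x\<in>Field (T X). x) = Idn Pos (T X)" by (simp add: Pos_def)
  moreover have "on_ar (mfun M) (Idn Pos (T X)) = Idn Pos (T (T X))"
    using functor_T T_Ob[OF X] by (simp add: is_functor_def)
  ultimately show ?thesis
    unfolding star_def using Cmp_Pos_Idn[OF mult_hom[OF X]] by simp
qed

definition sig :: "'u signature" where "sig \<Gamma> = Field (T \<Gamma>)"

text \<open>Equations are pairs of inequations. Those for substitution and for the unit turn composites of basic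
terms along a monotone family, and variables, into basic terms.\<close>

inductive_set ineqs :: "'u inequation set" where
  order: "\<Gamma> \<in> P \<Longrightarrow> (\<sigma>, \<tau>) \<in> T \<Gamma> \<Longrightarrow> (\<Gamma>, basic_term \<Gamma> \<sigma>, basic_term \<Gamma> \<tau>) \<in> ineqs"
| subst_le: "\<Gamma> \<in> P \<Longrightarrow> \<Delta> \<in> P \<Longrightarrow> \<sigma> \<in> sig \<Delta> \<Longrightarrow> k \<in> monotone_maps \<Delta> (T \<Gamma>) \<Longrightarrow>
    (\<Gamma>, Op \<Delta> \<sigma> (\<lambda>i\<in>Field \<Delta>. basic_term \<Gamma> (k i)), basic_term \<Gamma> (star \<Delta> \<Gamma> k \<sigma>)) \<in> ineqs"
| subst_ge: "\<Gamma> \<in> P \<Longrightarrow> \<Delta> \<in> P \<Longrightarrow> \<sigma> \<in> sig \<Delta> \<Longrightarrow> k \<in> monotone_maps \<Delta> (T \<Gamma>) \<Longrightarrow>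
    (\<Gamma>, basic_term \<Gamma> (star \<Delta> \<Gamma> k \<sigma>), Op \<Delta> \<sigma> (\<lambda>i\<in>Field \<Delta>. basic_term \<Gamma> (k i))) \<in> ineqs"
| unit_le: "\<Gamma> \<in> P \<Longrightarrow> x \<in> Field \<Gamma> \<Longrightarrow> (\<Gamma>, basic_term \<Gamma> (fn (unit M \<Gamma>) x), Var x) \<in> ineqs"
| unit_ge: "\<Gamma> \<in> P \<Longrightarrow> x \<in> Field \<Gamma> \<Longrightarrow> (\<Gamma>, Var x, basic_term \<Gamma> (fn (unit M \<Gamma>) x)) \<in> ineqs"

lemma context_Ob: "\<Gamma> \<in> P \<Longrightarrow> \<Gamma> \<in> Ob Pos"
  using P by (auto simp: contexts_def)

lemma is_signature_sig: "is_signature P sig"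
  unfolding is_signature_def sig_def using T_Ob[OF context_Ob] by (auto simp: Ob_Pos)

lemma ineqs_in: "ineqs \<subseteq> inequations P sig"
proof -
  have b: "basic_term \<Gamma> \<sigma> \<in> terms P sig \<Gamma>" if "\<Gamma> \<in> P" "\<sigma> \<in> Field (T \<Gamma>)" for \<Gamma> \<sigma>
    using that by (intro basic_term_in) (simp_all add: sig_def)
  have o: "Op \<Delta> \<sigma> (\<lambda>i\<in>Field \<Delta>. basic_term \<Gamma> (k i)) \<in> terms P sig \<Gamma>"
    if "\<Gamma> \<in> P" "\<Delta> \<in> P" "\<sigma> \<in> sig \<Delta>" "k \<in> monotone_maps \<Delta> (T \<Gamma>)" for \<Gamma> \<Delta> \<sigma> k
    using that by (intro terms.op) (auto intro: b monotone_maps_mem)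
  have s: "star \<Delta> \<Gamma> k \<sigma> \<in> Field (T \<Gamma>)"
    if "\<Gamma> \<in> P" "\<Delta> \<in> P" "\<sigma> \<in> sig \<Delta>" "k \<in> monotone_maps \<Delta> (T \<Gamma>)" for \<Gamma> \<Delta> \<sigma> k
    using monotone_maps_mem[OF star_mm[OF context_Ob[OF that(1)] context_Ob[OF that(2)] that(4)]] that(3)
    by (simp add: sig_def)
  show ?thesis
  proof
    fix e assume "e \<in> ineqs"
    moreover obtain \<Gamma> s t where e: "e = (\<Gamma>, s, t)" by (cases e)
    ultimately have "(\<Gamma>, s, t) \<in> ineqs" by simp
    then show "e \<in> inequations P sig"
      unfolding e
      by cases (auto simp: inequations_def intro!: b o s terms.var unit_mem context_Ob intro: FieldI1 FieldI2)
  qed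
qed

sublocale V: coherent_variety P sig ineqs
  by unfold_locales (rule U P is_signature_sig ineqs_in)+

text \<open>The order inequations make composite terms defined; the remaining ones then say that composites and
variables have the expected values.\<close>

lemma models_iff:
  assumes A: "coherent_algebra P sig A"
  shows "A \<in> models P sig ineqs \<longleftrightarrow>
    (\<forall>\<Gamma>\<in>P. \<forall>f\<in>monotone_maps \<Gamma> (poset A).
       (\<forall>\<sigma> \<tau>. (\<sigma>, \<tau>) \<in> T \<Gamma> \<longrightarrow> (oper A \<Gamma> \<sigma> f, oper A \<Gamma> \<tau> f) \<in> poset A) \<and>
       (\<forall>\<Delta>\<in>P. \<forall>\<sigma>\<in>sig \<Delta>. \<forall>k\<in>monotone_maps \<Delta> (T \<Gamma>).
          oper A \<Delta> \<sigma> (\<lambda>i\<in>Field \<Delta>. oper A \<Gamma> (k i) f) = oper A \<Gamma> (star \<Delta> \<Gamma> k \<sigma>) f) \<and>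
       (\<forall>x\<in>Field \<Gamma>. oper A \<Gamma> (fn (unit M \<Gamma>) x) f = f x))" (is "_ \<longleftrightarrow> ?R")
proof
  note Ao = coherent_poset[OF A]
  have ev: "evaluate A f (Op \<Delta> \<sigma> (\<lambda>i\<in>Field \<Delta>. basic_term \<Gamma> (k i))) =
      (if \<forall>i j. (i, j) \<in> \<Delta> \<longrightarrow> (oper A \<Gamma> (k i) f, oper A \<Gamma> (k j) f) \<in> poset A
       then Some (oper A \<Delta> \<sigma> (\<lambda>i\<in>Field \<Delta>. oper A \<Gamma> (k i) f)) else None)"
    if f: "f \<in> monotone_maps \<Gamma> (poset A)" for \<Gamma> f \<Delta> \<sigma> k
  proof -
    have "(\<lambda>i\<in>Field \<Delta>. the (evaluate A f ((\<lambda>i\<in>Field \<Delta>. basic_term \<Gamma> (k i)) i))) =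
        (\<lambda>i\<in>Field \<Delta>. oper A \<Gamma> (k i) f)"
      by (auto simp: fun_eq_iff restrict_def evaluate_basic_term[OF f])
    then show ?thesis by (auto simp: evaluate_basic_term[OF f] FieldI1 FieldI2)
  qed
  {
    assume m: "A \<in> models P sig ineqs"
    have sat: "satisfies A e" if "e \<in> ineqs" for e using m that by (simp add: models_def)
    show ?R
    proof (intro ballI conjI allI impI)
      fix \<Gamma> f assume \<Gamma>: "\<Gamma> \<in> P" and f: "f \<in> monotone_maps \<Gamma> (poset A)"
      show "(oper A \<Gamma> \<sigma> f, oper A \<Gamma> \<tau> f) \<in> poset A" if "(\<sigma>, \<tau>) \<in> T \<Gamma>" for \<sigma> \<tau>
      proof -
        have "(\<Gamma>, basic_term \<Gamma> \<sigma>, basic_term \<Gamma> \<tau>) \<in> ineqs" using \<Gamma> that by (rule ineqs.order)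
        from sat[OF this] f show ?thesis by (auto simp: evaluate_basic_term)
      qed
      show "oper A \<Gamma> (fn (unit M \<Gamma>) x) f = f x" if x: "x \<in> Field \<Gamma>" for x
      proof -
        have 1: "(\<Gamma>, basic_term \<Gamma> (fn (unit M \<Gamma>) x), Var x) \<in> ineqs"
          using \<Gamma> x by (rule ineqs.unit_le)
        have 2: "(\<Gamma>, Var x, basic_term \<Gamma> (fn (unit M \<Gamma>) x)) \<in> ineqs"
          using \<Gamma> x by (rule ineqs.unit_ge)
        from sat[OF 1] sat[OF 2] f show ?thesis
          by (intro Pos_antisym[OF Ao]) (auto simp: evaluate_basic_term)
      qed
      fix \<Delta> \<sigma> k assume h: "\<Delta> \<in> P" "\<sigma> \<in> sig \<Delta>" "k \<in> monotone_maps \<Delta> (T \<Gamma>)"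
      let ?t = "Op \<Delta> \<sigma> (\<lambda>i\<in>Field \<Delta>. basic_term \<Gamma> (k i))"
      have 1: "(\<Gamma>, ?t, basic_term \<Gamma> (star \<Delta> \<Gamma> k \<sigma>)) \<in> ineqs"
        using \<Gamma> h by (rule ineqs.subst_le)
      have 2: "(\<Gamma>, basic_term \<Gamma> (star \<Delta> \<Gamma> k \<sigma>), ?t) \<in> ineqs"
        using \<Gamma> h by (rule ineqs.subst_ge)
      from sat[OF 1] sat[OF 2] f
      show "oper A \<Delta> \<sigma> (\<lambda>i\<in>Field \<Delta>. oper A \<Gamma> (k i) f) = oper A \<Gamma> (star \<Delta> \<Gamma> k \<sigma>) f"
        by (intro Pos_antisym[OF Ao]) (auto simp: evaluate_basic_term ev[OF f] simp del: evaluate.simps split: if_splits)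
    qed
  next
    assume R: ?R
    have "satisfies A e" if "e \<in> ineqs" for e
    proof -
      obtain \<Gamma> s t where e: "e = (\<Gamma>, s, t)" by (cases e)
      have \<Gamma>: "\<Gamma> \<in> P" using that ineqs_in unfolding e inequations_def by auto
      show ?thesis
        unfolding e satisfies.simps
      proof
        fix f assume f: "f \<in> monotone_maps \<Gamma> (poset A)"
        note R' = R[rule_format, OF \<Gamma> f]
        have om: "oper A \<Gamma> \<sigma> f \<in> Field (poset A)" if "\<sigma> \<in> Field (T \<Gamma>)" for \<sigma>
          using oper_mem[OF A \<Gamma> _ f] that by (simp add: sig_def)
        have le: "\<forall>i j. (i, j) \<in> \<Delta> \<longrightarrow> (oper A \<Gamma> (k i) f, oper A \<Gamma> (k j) f) \<in> poset A"
          if "k \<in> monotone_maps \<Delta> (T \<Gamma>)" for \<Delta> k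
          using R' monotone_maps_le[OF that] by blast
        have st: "oper A \<Gamma> (star \<Delta> \<Gamma> k \<sigma>) f \<in> Field (poset A)"
          if "\<Delta> \<in> P" "\<sigma> \<in> sig \<Delta>" "k \<in> monotone_maps \<Delta> (T \<Gamma>)" for \<Delta> \<sigma> k
          using monotone_maps_mem[OF star_mm[OF context_Ob[OF \<Gamma>] context_Ob[OF that(1)] that(3)]] that(2)
          by (intro om) (simp add: sig_def)
        show "\<exists>a b. evaluate A f s = Some a \<and> evaluate A f t = Some b \<and> (a, b) \<in> poset A"
          using that unfolding e
        proof cases
          case (order \<sigma> \<tau>)
          then show ?thesis using R' by (simp add: evaluate_basic_term[OF f])
        next
          case (subst_le \<Delta> \<sigma> k)
          then show ?thesis
            using R' le[OF subst_le(6)] Pos_refl[OF Ao st[OF subst_le(4-6)]]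
            by (simp add: evaluate_basic_term[OF f] ev[OF f] del: evaluate.simps(2))
        next
          case (subst_ge \<Delta> \<sigma> k)
          then show ?thesis
            using R' le[OF subst_ge(6)] Pos_refl[OF Ao st[OF subst_ge(4-6)]]
            by (simp add: evaluate_basic_term[OF f] ev[OF f] del: evaluate.simps(2))
        next
          case (unit_le x)
          then show ?thesis
            using R' Pos_refl[OF Ao monotone_maps_mem[OF f]] by (simp add: evaluate_basic_term[OF f])
        next
          case (unit_ge x)
          then show ?thesis
            using R' Pos_refl[OF Ao monotone_maps_mem[OF f]] by (simp add: evaluate_basic_term[OF f])
        qed
      qed
    qed
    with A show "A \<in> models P sig ineqs" by (simp add: models_def)
  }
qed

text \<open>The operation \<open>\<sigma>\<close> takes the value at \<open>\<sigma>\<close> of the Kleisli extension of its argument.\<close>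

definition canonical :: "'u rel \<Rightarrow> 'u algebra" where
  "canonical X = \<lparr>poset = T X, oper = (\<lambda>\<Delta> \<sigma> f.
     if \<Delta> \<in> P \<and> \<sigma> \<in> sig \<Delta> \<and> f \<in> monotone_maps \<Delta> (T X) then star \<Delta> X f \<sigma> else undefined)\<rparr>"

lemma poset_canonical [simp]: "poset (canonical X) = T X"
  by (simp add: canonical_def)

lemma oper_canonical:
  "\<lbrakk>\<Delta> \<in> P; \<sigma> \<in> sig \<Delta>; f \<in> monotone_maps \<Delta> (T X)\<rbrakk> \<Longrightarrow> oper (canonical X) \<Delta> \<sigma> f = star \<Delta> X f \<sigma>"
  by (simp add: canonical_def)

lemma sig_mem: "\<sigma> \<in> sig \<Delta> \<longleftrightarrow> \<sigma> \<in> Field (T \<Delta>)"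
  by (simp add: sig_def)

lemma canonical_coherent:
  assumes X: "X \<in> Ob Pos"
  shows "coherent_algebra P sig (canonical X)"
  unfolding coherent_algebra_def poset_canonical
proof (intro conjI ballI allI impI T_Ob[OF X])
  fix \<Delta> \<sigma> f assume op: "\<Delta> \<in> P" "\<sigma> \<in> sig \<Delta>" and f: "f \<in> monotone_maps \<Delta> (T X)"
  show "oper (canonical X) \<Delta> \<sigma> f \<in> Field (T X)"
    using monotone_maps_mem[OF star_mm[OF X context_Ob[OF op(1)] f]] op(2) by (simp add: oper_canonical[OF op f] sig_mem)
  show "(oper (canonical X) \<Delta> \<sigma> f, oper (canonical X) \<Delta> \<sigma> g) \<in> T X"
    if "g \<in> monotone_maps \<Delta> (T X)" "pointwise_le \<Delta> (T X) f g" for g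
    using star_le[OF X context_Ob[OF op(1)] f that(1)] that op by (simp add: oper_canonical f sig_mem pointwise_le_def)
qed (auto simp: canonical_def)

lemma canonical_model:
  assumes X: "X \<in> Ob Pos"
  shows "canonical X \<in> models P sig ineqs"
  unfolding models_iff[OF canonical_coherent[OF X]] poset_canonical
proof (intro ballI conjI allI impI)
  fix \<Gamma> f assume \<Gamma>: "\<Gamma> \<in> P" and f: "f \<in> monotone_maps \<Gamma> (T X)"
  note \<Gamma>o = context_Ob[OF \<Gamma>] and sf = star_mm[OF X context_Ob[OF \<Gamma>] f]
  have op: "oper (canonical X) \<Gamma> \<sigma> f = star \<Gamma> X f \<sigma>" if "\<sigma> \<in> Field (T \<Gamma>)" for \<sigma>
    using that by (intro oper_canonical \<Gamma> f) (simp add: sig_mem)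
  show "(oper (canonical X) \<Gamma> \<sigma> f, oper (canonical X) \<Gamma> \<tau> f) \<in> T X" if "(\<sigma>, \<tau>) \<in> T \<Gamma>" for \<sigma> \<tau>
    using monotone_maps_le[OF sf that] that by (simp add: op FieldI1 FieldI2)
  show "oper (canonical X) \<Gamma> (fn (unit M \<Gamma>) x) f = f x" if "x \<in> Field \<Gamma>" for x
    using star_unit[OF X \<Gamma>o f that] by (simp add: op unit_mem[OF \<Gamma>o that])
  fix \<Delta> \<sigma> k assume \<Delta>: "\<Delta> \<in> P" "\<sigma> \<in> sig \<Delta>" and k: "k \<in> monotone_maps \<Delta> (T \<Gamma>)"
  note \<Delta>o = context_Ob[OF \<Delta>(1)]
  have eq: "(\<lambda>i\<in>Field \<Delta>. oper (canonical X) \<Gamma> (k i) f) = compose (Field \<Delta>) (star \<Gamma> X f) k"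
    by (auto simp: compose_def fun_eq_iff restrict_def op monotone_maps_mem[OF k])
  have \<sigma>: "\<sigma> \<in> Field (T \<Delta>)" using \<Delta>(2) by (simp add: sig_mem)
  show "oper (canonical X) \<Delta> \<sigma> (\<lambda>i\<in>Field \<Delta>. oper (canonical X) \<Gamma> (k i) f) =
      oper (canonical X) \<Gamma> (star \<Delta> \<Gamma> k \<sigma>) f"
    unfolding eq oper_canonical[OF \<Delta> monotone_maps_compose[OF k sf]]
    using monotone_maps_mem[OF star_mm[OF \<Gamma>o \<Delta>o k] \<sigma>] by (simp add: op star_star[OF X \<Gamma>o f \<Delta>o k \<sigma>])
qed

lemma star_homomorphism:
  assumes X: "X \<in> Ob Pos" and Y: "Y \<in> Ob Pos" and f: "f \<in> monotone_maps Y (T X)"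
  shows "star Y X f \<in> homomorphisms P sig (canonical Y) (canonical X)"
  unfolding homomorphisms_def poset_canonical
proof (intro CollectI conjI ballI star_mm[OF X Y f])
  fix \<Delta> \<sigma> k assume op: "\<Delta> \<in> P" "\<sigma> \<in> sig \<Delta>" and k: "k \<in> monotone_maps \<Delta> (T Y)"
  have \<sigma>: "\<sigma> \<in> Field (T \<Delta>)" using op(2) by (simp add: sig_mem)
  show "star Y X f (oper (canonical Y) \<Delta> \<sigma> k) = oper (canonical X) \<Delta> \<sigma> (compose (Field \<Delta>) (star Y X f) k)"
    unfolding oper_canonical[OF op k] oper_canonical[OF op monotone_maps_compose[OF k star_mm[OF X Y f]]]
    by (rule star_star[OF X Y f context_Ob[OF op(1)] k \<sigma>, symmetric])
qed

text \<open>The canonical algebra on \<open>X\<close> is free: \<open>T X\<close> is the colimit of the \<open>T \<Gamma>\<close> over the contexts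
  in \<open>X\<close>, and there the value of \<open>\<sigma> \<in> T \<Gamma>\<close> is forced to be the operation \<open>\<sigma>\<close>.\<close>

lemma canonical_free:
  assumes X: "X \<in> Ob Pos"
  shows "free_algebra P sig ineqs X (canonical X) (fn (unit M X))"
  unfolding free_algebra_def poset_canonical
proof (intro conjI ballI canonical_model[OF X] unit_mm[OF X])
  fix B f assume B: "B \<in> models P sig ineqs" and f: "f \<in> monotone_maps X (poset B)"
  note Bc = models_coherent[OF B] and Bo = models_poset[OF B]
  have B1: "(oper B \<Gamma> \<sigma> g, oper B \<Gamma> \<tau> g) \<in> poset B"
    if "\<Gamma> \<in> P" "g \<in> monotone_maps \<Gamma> (poset B)" "(\<sigma>, \<tau>) \<in> T \<Gamma>" for \<Gamma> g \<sigma> \<tau>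
    using B that unfolding models_iff[OF Bc] by blast
  have B2: "oper B \<Delta> \<sigma> (\<lambda>i\<in>Field \<Delta>. oper B \<Gamma> (k i) g) = oper B \<Gamma> (star \<Delta> \<Gamma> k \<sigma>) g"
    if "\<Gamma> \<in> P" "g \<in> monotone_maps \<Gamma> (poset B)" "\<Delta> \<in> P" "\<sigma> \<in> sig \<Delta>" "k \<in> monotone_maps \<Delta> (T \<Gamma>)" for \<Gamma> g \<Delta> \<sigma> k
    using B that unfolding models_iff[OF Bc] by blast
  have B3: "oper B \<Gamma> (fn (unit M \<Gamma>) x) g = g x"
    if "\<Gamma> \<in> P" "g \<in> monotone_maps \<Gamma> (poset B)" "x \<in> Field \<Gamma>" for \<Gamma> g x
    using B that unfolding models_iff[OF Bc] by blast
  obtain I :: "('u, 'u) cat" and D c where I: "filtered I" "small (Ob I)" "small (Ar I)" and Df: "is_functor I Pos D"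
    and DP: "\<And>i. i \<in> Ob I \<Longrightarrow> on_ob D i \<in> P" and c: "concrete_colimit I D X c"
    using colimit_of_contexts[OF U P X] by blast
  define TD where "TD = comp_func (mfun M) D"
  interpret D: filtered_diagram I D
    using I Df U by unfold_locales (auto simp: small_iff_few)
  interpret TD: filtered_diagram I TD
    using I U comp_functor[OF Df functor_T] by unfold_locales (auto simp: small_iff_few TD_def)
  have "colimit I Pos TD (T X) (on_ar (mfun M) \<circ> c)"
    using fin I Df D.concrete_colimit_is_colimit[OF c]
    unfolding finitary_def preserves_filtered_colimits_def TD_def by blast
  then have Tc: "concrete_colimit I TD (T X) (on_ar (mfun M) \<circ> c)" by (rule TD.colimit_is_concrete)
  note cc = D.concrete_colimit_cocone[OF c]
  have ch: "c i \<in> hom Pos (on_ob D i) X" if "i \<in> Ob I" for i by (rule D.cocone_hom[OF cc that])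
  have TDo: "on_ob TD i = T (on_ob D i)" and TDa: "on_ar TD u = on_ar (mfun M) (on_ar D u)" for i u
    by (simp_all add: TD_def comp_func_def)
  define g where "g i = compose (Field (on_ob D i)) f (fn (c i))" for i
  have g: "g i \<in> monotone_maps (on_ob D i) (poset B)" if "i \<in> Ob I" for i
    unfolding g_def using ch[OF that] f by (intro monotone_maps_compose) (auto simp: hom_Pos)
  have DO: "on_ob D i \<in> Ob Pos" if "i \<in> Ob I" for i by (rule D.D_ob[OF that])
  define m where "m i = (\<lambda>\<sigma>\<in>Field (T (on_ob D i)). oper B (on_ob D i) \<sigma> (g i))" for i
  have mm: "m i \<in> monotone_maps (T (on_ob D i)) (poset B)" if i: "i \<in> Ob I" for i
    unfolding m_def
  proof (rule monotone_maps_restrictI)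
    show "oper B (on_ob D i) \<sigma> (g i) \<in> Field (poset B)" if "\<sigma> \<in> Field (T (on_ob D i))" for \<sigma>
      using that by (intro oper_mem[OF Bc DP[OF i] _ g[OF i]]) (simp add: sig_mem)
    show "(oper B (on_ob D i) \<sigma> (g i), oper B (on_ob D i) \<tau> (g i)) \<in> poset B" if "(\<sigma>, \<tau>) \<in> T (on_ob D i)" for \<sigma> \<tau>
      by (rule B1[OF DP[OF i] g[OF i] that])
  qed
  have mh: "Arrow (T (on_ob D i)) (poset B) (m i) \<in> hom Pos (T (on_ob D i)) (poset B)" if "i \<in> Ob I" for i
    by (rule Arrow_in_hom_Pos[OF T_Ob[OF DO[OF that]] Bo mm[OF that]])
  have "cocone I Pos TD (poset B) (\<lambda>i. Arrow (T (on_ob D i)) (poset B) (m i))"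
    unfolding cocone_def TDo TDa
  proof (intro conjI ballI Bo mh)
    fix u assume "u \<in> Ar I"
    then have u: "u \<in> hom I (Dom I u) (Cod I u)" by (simp add: hom_def)
    let ?i = "Dom I u" and ?j = "Cod I u"
    note i = D.hom_ob[OF u] and Du = D.D_ar[OF u]
    note TDu = T_hom[OF Du]
    let ?k = "compose (Field (on_ob D ?i)) (fn (unit M (on_ob D ?j))) (fn (on_ar D u))"
    have k: "?k \<in> monotone_maps (on_ob D ?i) (T (on_ob D ?j))"
      using Du by (intro monotone_maps_compose[OF _ unit_mm[OF DO[OF i(2)]]]) (simp add: hom_Pos)
    show "Cmp Pos (Arrow (T (on_ob D ?j)) (poset B) (m ?j)) (on_ar (mfun M) (on_ar D u)) =
        Arrow (T (on_ob D ?i)) (poset B) (m ?i)"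
    proof (rule hom_Pos_eqI[OF Cmp_Pos_in[OF TDu mh[OF i(2)]] mh[OF i(1)]])
      fix \<sigma> assume \<sigma>: "\<sigma> \<in> Field (T (on_ob D ?i))"
      have "(\<lambda>y\<in>Field (on_ob D ?i). oper B (on_ob D ?j) (?k y) (g ?j)) = g ?i"
        using B3[OF DP[OF i(2)] g[OF i(2)] hom_Pos_mem[OF Du]] D.cocone_app[OF cc u] hom_Pos_mem[OF Du]
        by (auto simp: g_def compose_def fun_eq_iff restrict_def)
      then have "oper B (on_ob D ?j) (star (on_ob D ?i) (on_ob D ?j) ?k \<sigma>) (g ?j) = oper B (on_ob D ?i) \<sigma> (g ?i)"
        using B2[OF DP[OF i(2)] g[OF i(2)] DP[OF i(1)] _ k, of \<sigma>] \<sigma> by (simp add: sig_mem)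
      then show "fn (Cmp Pos (Arrow (T (on_ob D ?j)) (poset B) (m ?j)) (on_ar (mfun M) (on_ar D u))) \<sigma> =
          fn (Arrow (T (on_ob D ?i)) (poset B) (m ?i)) \<sigma>"
        using \<sigma> hom_Pos_mem[OF TDu \<sigma>] by (simp add: Cmp_Pos_apply[OF TDu \<sigma>] m_def map_eq_star[OF Du \<sigma>])
    qed
  qed
  then obtain h where h: "h \<in> hom Pos (T X) (poset B)"
    and hc: "\<And>i. i \<in> Ob I \<Longrightarrow> Cmp Pos h (on_ar (mfun M) (c i)) = Arrow (T (on_ob D i)) (poset B) (m i)"
    using TD.concrete_colimit_is_colimit[OF Tc] unfolding colimit_def comp_def by blast
  have h_app: "fn h (fn (on_ar (mfun M) (c i)) \<sigma>) = oper B (on_ob D i) \<sigma> (g i)"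
    if i: "i \<in> Ob I" and \<sigma>: "\<sigma> \<in> Field (T (on_ob D i))" for i \<sigma>
    using arg_cong[OF hc[OF i], of "\<lambda>h. fn h \<sigma>"] \<sigma> by (simp add: Cmp_Pos_apply[OF T_hom[OF ch[OF i]] \<sigma>] m_def)
  have uc: "compose (Field (on_ob D i)) (fn (unit M X)) (fn (c i)) \<in> monotone_maps (on_ob D i) (T X)"
    if "i \<in> Ob I" for i
    using ch[OF that] by (intro monotone_maps_compose[OF _ unit_mm[OF X]]) (simp add: hom_Pos)
  have Tc_surj: "\<exists>i \<sigma>. i \<in> Ob I \<and> \<sigma> \<in> Field (T (on_ob D i)) \<and> a = fn (on_ar (mfun M) (c i)) \<sigma>"
    if "a \<in> Field (T X)" for a
    using TD.concrete_colimit_surj[OF Tc that] unfolding TDo comp_def by metis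
  have hu: "fn h (fn (unit M X) x) = f x" if x: "x \<in> Field X" for x
  proof -
    obtain i a where ia: "i \<in> Ob I" "a \<in> Field (on_ob D i)" "x = fn (c i) a" by (rule D.concrete_colimit_surj[OF c x])
    note u = unit_mem[OF DO[OF ia(1)] ia(2)]
    have "fn (unit M X) x = fn (on_ar (mfun M) (c i)) (fn (unit M (on_ob D i)) a)"
      using arg_cong[OF unit_natural[OF ch[OF ia(1)]], of "\<lambda>h. fn h a"] ia(3)
      by (simp add: Cmp_Pos_apply[OF ch[OF ia(1)] ia(2)] Cmp_Pos_apply[OF unit_hom[OF DO[OF ia(1)]] ia(2)])
    then show ?thesis
      using B3[OF DP[OF ia(1)] g[OF ia(1)] ia(2)] ia by (simp add: h_app u g_def)
  qed
  have hh: "fn h \<in> homomorphisms P sig (canonical X) B"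
    unfolding homomorphisms_def poset_canonical
  proof (intro CollectI conjI ballI)
    show hm: "fn h \<in> monotone_maps (T X) (poset B)" using h by (simp add: hom_Pos)
    fix \<Delta> \<sigma> k assume op: "\<Delta> \<in> P" "\<sigma> \<in> sig \<Delta>" and k: "k \<in> monotone_maps \<Delta> (T X)"
    have \<sigma>: "\<sigma> \<in> Field (T \<Delta>)" using op(2) by (simp add: sig_mem)
    note \<Delta>o = context_Ob[OF op(1)]
    obtain i l where i: "i \<in> Ob I" and l: "l \<in> monotone_maps \<Delta> (T (on_ob D i))"
      and kl: "\<And>x. x \<in> Field \<Delta> \<Longrightarrow> k x = fn (on_ar (mfun M) (c i)) (l x)"
      using TD.factor_finite[OF Tc \<Delta>o V.context_finite[OF op(1)] k] unfolding TDo comp_def by metis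
    let ?uc = "compose (Field (on_ob D i)) (fn (unit M X)) (fn (c i))"
    note lm = monotone_maps_mem[OF l]
    have k_eq: "k = compose (Field \<Delta>) (star (on_ob D i) X ?uc) l"
      by (rule monotone_maps_eqI[OF k monotone_maps_compose[OF l star_mm[OF X DO[OF i] uc[OF i]]]])
        (simp add: kl map_eq_star[OF ch[OF i]] lm)
    have sm: "star \<Delta> (on_ob D i) l \<sigma> \<in> Field (T (on_ob D i))"
      by (rule monotone_maps_mem[OF star_mm[OF DO[OF i] \<Delta>o l] \<sigma>])
    have "oper (canonical X) \<Delta> \<sigma> k = star (on_ob D i) X ?uc (star \<Delta> (on_ob D i) l \<sigma>)"
      unfolding oper_canonical[OF op k] by (subst k_eq) (rule star_star[OF X DO[OF i] uc[OF i] \<Delta>o l \<sigma>])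
    also have "\<dots> = fn (on_ar (mfun M) (c i)) (star \<Delta> (on_ob D i) l \<sigma>)"
      by (rule map_eq_star[OF ch[OF i] sm, symmetric])
    finally have "fn h (oper (canonical X) \<Delta> \<sigma> k) = oper B (on_ob D i) (star \<Delta> (on_ob D i) l \<sigma>) (g i)"
      by (simp add: h_app[OF i sm])
    also have "\<dots> = oper B \<Delta> \<sigma> (\<lambda>x\<in>Field \<Delta>. oper B (on_ob D i) (l x) (g i))"
      by (rule B2[OF DP[OF i] g[OF i] op l, symmetric])
    also have "(\<lambda>x\<in>Field \<Delta>. oper B (on_ob D i) (l x) (g i)) = compose (Field \<Delta>) (fn h) k"
      by (auto simp: compose_def fun_eq_iff restrict_def kl h_app[OF i lm])
    finally show "fn h (oper (canonical X) \<Delta> \<sigma> k) = oper B \<Delta> \<sigma> (compose (Field \<Delta>) (fn h) k)" .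
  qed
  show "\<exists>!h. h \<in> homomorphisms P sig (canonical X) B \<and> (\<forall>x\<in>Field X. h (fn (unit M X) x) = f x)"
  proof (rule ex1I[of _ "fn h"])
    show "fn h \<in> homomorphisms P sig (canonical X) B \<and> (\<forall>x\<in>Field X. fn h (fn (unit M X) x) = f x)"
      using hh hu by blast
    fix h' assume h': "h' \<in> homomorphisms P sig (canonical X) B \<and> (\<forall>x\<in>Field X. h' (fn (unit M X) x) = f x)"
    show "h' = fn h"
    proof (rule homomorphism_eqI[OF conjunct1[OF h'] hh])
      fix a assume "a \<in> Field (poset (canonical X))"
      then obtain i \<sigma> where i: "i \<in> Ob I" and \<sigma>: "\<sigma> \<in> Field (T (on_ob D i))" and a: "a = fn (on_ar (mfun M) (c i)) \<sigma>"
        using Tc_surj[of a] by auto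
      let ?uc = "compose (Field (on_ob D i)) (fn (unit M X)) (fn (c i))"
      have \<sigma>': "\<sigma> \<in> sig (on_ob D i)" using \<sigma> by (simp add: sig_mem)
      have "a = oper (canonical X) (on_ob D i) \<sigma> ?uc"
        unfolding a by (simp add: oper_canonical[OF DP[OF i] \<sigma>' uc[OF i]] map_eq_star[OF ch[OF i] \<sigma>])
      then have "h' a = oper B (on_ob D i) \<sigma> (compose (Field (on_ob D i)) h' ?uc)"
        using homomorphism_oper[OF conjunct1[OF h'] DP[OF i] \<sigma>', of ?uc] uc[OF i] by simp
      also have "compose (Field (on_ob D i)) h' ?uc = g i"
        using h' hom_Pos_mem[OF ch[OF i]] by (auto simp: g_def compose_def fun_eq_iff restrict_def)
      finally show "h' a = fn h a" unfolding a by (simp add: h_app[OF i \<sigma>])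
    qed
  qed
qed

lemma free_monad_canonical: "free_monad P sig ineqs M canonical"
proof unfold_locales
  fix X :: "'u rel" assume X: "X \<in> Ob Pos"
  note TX = T_Ob[OF X]
  show "free_algebra P sig ineqs X (canonical X) (fn (unit M X))" by (rule canonical_free[OF X])
  show "T X = poset (canonical X)" by simp
  show "unit M X \<in> hom Pos X (poset (canonical X))" using unit_hom[OF X] by simp
  show "mult M X \<in> hom Pos (poset (canonical (poset (canonical X)))) (poset (canonical X))"
    using mult_hom[OF X] by simp
  have i: "(\<lambda>x\<in>Field (T X). x) \<in> monotone_maps (T X) (T X)" by (rule monotone_maps_restrictI)
  have "fn (mult M X) = star (T X) X (\<lambda>x\<in>Field (T X). x)"
    using mult_hom[OF X] star_mm[OF X TX i] mult_eq_star[OF X]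
    by (intro monotone_maps_eqI[of _ "T (T X)" "T X" _ "T X"]) (auto simp: hom_Pos)
  then show "fn (mult M X) \<in> homomorphisms P sig (canonical (poset (canonical X))) (canonical X)"
    using star_homomorphism[OF X TX i] by simp
  show "fn (mult M X) (fn (unit M (poset (canonical X))) y) = y" if "y \<in> Field (poset (canonical X))" for y
    using arg_cong[OF laws(1)[OF X], of "\<lambda>h. fn h y"] that
    by (simp add: Cmp_Pos_apply[OF unit_hom[OF TX]] Idn_Pos_apply)
next
  fix X Y :: "'u rel" and f assume f: "f \<in> hom Pos X Y"
  then have X: "X \<in> Ob Pos" and Y: "Y \<in> Ob Pos" by (auto simp: hom_Pos)
  show "on_ar (mfun M) f \<in> hom Pos (poset (canonical X)) (poset (canonical Y))" using T_hom[OF f] by simp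
  have k: "compose (Field X) (fn (unit M Y)) (fn f) \<in> monotone_maps X (T Y)"
    using f by (intro monotone_maps_compose[OF _ unit_mm[OF Y]]) (simp add: hom_Pos)
  have "fn (on_ar (mfun M) f) = star X Y (compose (Field X) (fn (unit M Y)) (fn f))"
    using T_hom[OF f] star_mm[OF Y X k] map_eq_star[OF f]
    by (intro monotone_maps_eqI[of _ "T X" "T Y" _ "T Y"]) (auto simp: hom_Pos)
  then show "fn (on_ar (mfun M) f) \<in> homomorphisms P sig (canonical X) (canonical Y)"
    using star_homomorphism[OF Y X k] by simp
  show "fn (on_ar (mfun M) f) (fn (unit M X) x) = fn (unit M Y) (fn f x)" if x: "x \<in> Field X" for x
    using arg_cong[OF unit_natural[OF f], of "\<lambda>h. fn h x"]
    by (simp add: Cmp_Pos_apply[OF f x] Cmp_Pos_apply[OF unit_hom[OF X] x])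
qed

end

section \<open>The correspondence\<close>

text \<open>An element may have many partners under \<open>G\<close>, but they form a single class of \<open>s\<close>, and elements with a
common class of partners are related by \<open>r\<close>.\<close>

lemma bij_betw_quotients:
  assumes r: "equiv A r" and s: "equiv B s"
    and total: "\<And>a. a \<in> A \<Longrightarrow> \<exists>b. G a b" and range: "\<And>a b. a \<in> A \<Longrightarrow> G a b \<Longrightarrow> b \<in> B"
    and cong: "\<And>a a' b b'. \<lbrakk>a \<in> A; a' \<in> A; G a b; G a' b'\<rbrakk> \<Longrightarrow> (a, a') \<in> r \<longleftrightarrow> (b, b') \<in> s"
    and surj: "\<And>b. b \<in> B \<Longrightarrow> \<exists>a\<in>A. \<exists>b'. G a b' \<and> (b, b') \<in> s"
  shows "bij_betw (\<lambda>K. s `` {b. \<exists>a\<in>K. G a b}) (A // r) (B // s)"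
proof -
  have class_image: "s `` {b. \<exists>a'\<in>r `` {a}. G a' b} = s `` {b}" if a: "a \<in> A" and ab: "G a b" for a b
  proof
    have b: "b \<in> B" by (rule range[OF a ab])
    show "s `` {b. \<exists>a'\<in>r `` {a}. G a' b} \<subseteq> s `` {b}"
    proof clarify
      fix c b' a' assume h: "(b', c) \<in> s" "(a, a') \<in> r" "G a' b'"
      have "a' \<in> A" using r h(2) by (auto simp: equiv_def)
      then have "(b, b') \<in> s" using cong[OF a _ ab h(3)] h(2) by simp
      then show "(b, c) \<in> s" using s h(1) unfolding equiv_def by (meson transD)
    qed
    have "(a, a) \<in> r" using r a by (simp add: equiv_def refl_on_def)
    then show "s `` {b} \<subseteq> s `` {b. \<exists>a'\<in>r `` {a}. G a' b}" using ab by blast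
  qed
  show ?thesis
    unfolding bij_betw_def
  proof
    show "inj_on (\<lambda>K. s `` {b. \<exists>a\<in>K. G a b}) (A // r)"
    proof (rule inj_onI)
      fix K L assume K: "K \<in> A // r" and L: "L \<in> A // r"
        and eq: "s `` {b. \<exists>a\<in>K. G a b} = s `` {b. \<exists>a\<in>L. G a b}"
      obtain a where a: "a \<in> A" "K = r `` {a}" using K by (rule quotientE)
      obtain a' where a': "a' \<in> A" "L = r `` {a'}" using L by (rule quotientE)
      obtain b where b: "G a b" using total[OF a(1)] by blast
      obtain b' where b': "G a' b'" using total[OF a'(1)] by blast
      have "s `` {b} = s `` {b'}"
        using eq unfolding a(2) a'(2) class_image[OF a(1) b] class_image[OF a'(1) b'] .
      then have "(b, b') \<in> s"
        using eq_equiv_class_iff[OF s range[OF a(1) b] range[OF a'(1) b']] by simp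
      then have "(a, a') \<in> r" using cong[OF a(1) a'(1) b b'] by simp
      then show "K = L" unfolding a(2) a'(2) by (rule equiv_class_eq[OF r])
    qed
    show "(\<lambda>K. s `` {b. \<exists>a\<in>K. G a b}) ` (A // r) = B // s"
    proof
      show "(\<lambda>K. s `` {b. \<exists>a\<in>K. G a b}) ` (A // r) \<subseteq> B // s"
      proof clarify
        fix K assume "K \<in> A // r"
        then obtain a where a: "a \<in> A" "K = r `` {a}" by (rule quotientE)
        obtain b where b: "G a b" using total[OF a(1)] by blast
        show "s `` {b. \<exists>a\<in>K. G a b} \<in> B // s"
          unfolding a(2) class_image[OF a(1) b] by (rule quotientI[OF range[OF a(1) b]])
      qed
      show "B // s \<subseteq> (\<lambda>K. s `` {b. \<exists>a\<in>K. G a b}) ` (A // r)"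
      proof
        fix L assume "L \<in> B // s"
        then obtain b where b: "b \<in> B" "L = s `` {b}" by (rule quotientE)
        obtain a b' where a: "a \<in> A" "G a b'" "(b, b') \<in> s" using surj[OF b(1)] by blast
        have "L = s `` {b. \<exists>a'\<in>r `` {a}. G a' b}"
          unfolding b(2) class_image[OF a(1,2)] by (rule equiv_class_eq[OF s a(3)])
        then show "L \<in> (\<lambda>K. s `` {b. \<exists>a\<in>K. G a b}) ` (A // r)"
          using quotientI[OF a(1), of r] by blast
      qed
    qed
  qed
qed

theorem corollary4p7:
  fixes P :: "'u rel set"
  assumes "universe TYPE('u)"
    and "contexts P"
  shows "(\<forall>V\<in>varieties P.
            (\<exists>M. free_algebra_monad V M) \<and>
            (\<forall>M. free_algebra_monad V M \<longrightarrow> is_monad Pos M \<and> finitary M \<and> enriched M)) \<and>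
         bij_betw (\<lambda>K. monad_iso_rel `` {M. \<exists>V\<in>K. free_algebra_monad V M})
           (varieties P // concrete_iso_rel P)
           ((enriched_finitary_monads :: 'u pos_monad set) // monad_iso_rel)"
proof -
  have variety: "\<exists>S E. V = variety P S E \<and> coherent_variety P S E" if "V \<in> varieties P" for V
    using that assms unfolding varieties_def
    by (auto simp: coherent_variety_def coherent_variety_axioms_def signature_def)
  have ex: "\<exists>M. free_algebra_monad V M" if V: "V \<in> varieties P" for V
  proof -
    obtain S E where V': "V = variety P S E" "coherent_variety P S E" using variety[OF V] by blast
    obtain M F where "free_monad P S E M F" using coherent_variety.free_monad_exists[OF V'(2)] by blast
    then show ?thesis unfolding V'(1) by (rule free_monad.free_algebra_monad_exists)
  qed
  have pres: "\<exists>S E F. V = variety P S E \<and> free_monad P S E M F"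
    if V: "V \<in> varieties P" and M: "free_algebra_monad V M" for V M
  proof -
    obtain S E where V': "V = variety P S E" "coherent_variety P S E" using variety[OF V] by blast
    then show ?thesis using coherent_variety.free_monad_of_adjunction[OF V'(2)] M by blast
  qed
  have mon: "is_monad Pos M \<and> finitary M \<and> enriched M"
    if V: "V \<in> varieties P" and M: "free_algebra_monad V M" for V M
    using pres[OF V M] free_monad.is_monad free_monad.finitary free_monad.enriched by blast
  have efm: "M \<in> enriched_finitary_monads"
    if V: "V \<in> varieties P" and M: "free_algebra_monad V M" for V M
    using mon[OF V M] by (simp add: enriched_finitary_monads_def)
  have cong: "(V, W) \<in> concrete_iso_rel P \<longleftrightarrow> (M, N) \<in> monad_iso_rel"
    if V: "V \<in> varieties P" and W: "W \<in> varieties P" and M: "free_algebra_monad V M" and N: "free_algebra_monad W N"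
    for V W M N
  proof -
    obtain S E F where 1: "V = variety P S E" "free_monad P S E M F" using pres[OF V M] by blast
    obtain S' E' G where 2: "W = variety P S' E'" "free_monad P S' E' N G" using pres[OF W N] by blast
    show ?thesis
      using V W efm[OF V M] efm[OF W N] free_monads_isomorphic[OF 1(2) 2(2)]
        concretely_isomorphic_of_monads[OF 1(2) 2(2)]
      unfolding concrete_iso_rel_def monad_iso_rel_def 1(1) 2(1) by blast
  qed
  have surj: "\<exists>V\<in>varieties P. \<exists>N. free_algebra_monad V N \<and> (M, N) \<in> monad_iso_rel"
    if M: "M \<in> enriched_finitary_monads" for M :: "'u pos_monad"
  proof -
    interpret M: enriched_finitary_monad P M
      using M assms by unfold_locales (auto simp: enriched_finitary_monads_def)
    \<comment> \<open>The free-algebra monad \<open>N\<close> of this variety and the given monad both describe its free algebras, so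
      they are isomorphic.\<close>
    let ?V = "variety P M.sig M.ineqs"
    have V: "?V \<in> varieties P"
      unfolding varieties_def using M.is_signature_sig M.ineqs_in by blast
    obtain N where N: "free_algebra_monad ?V N" using ex[OF V] by blast
    obtain G where G: "free_monad P M.sig M.ineqs N G"
      using M.V.free_monad_of_adjunction[OF N] by blast
    have "(?V, ?V) \<in> concrete_iso_rel P"
      using equiv_concrete_iso_rel[of P] V unfolding equiv_def by (blast dest: refl_onD)
    then have "monad_isomorphic Pos M N"
      by (intro free_monads_isomorphic[OF M.free_monad_canonical G]) (simp add: concrete_iso_rel_def)
    then show ?thesis using V N M efm[OF V N] unfolding monad_iso_rel_def by blast
  qed
  have "bij_betw (\<lambda>K. monad_iso_rel `` {M. \<exists>V\<in>K. free_algebra_monad V M})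
      (varieties P // concrete_iso_rel P) ((enriched_finitary_monads :: 'u pos_monad set) // monad_iso_rel)"
    by (rule bij_betw_quotients[OF equiv_concrete_iso_rel equiv_monad_iso_rel ex efm cong surj])
  with ex mon show ?thesis by blast
qed

end
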